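(* Every weighted projective space $\mathbb{CP}^{[p]}$ supports a Bochner-Kähler (orbifold) metric.
   Context: For $p=(p_1,\ldots,p_{m+1})$, $m\ge1$, a sequence of positive integers with no common divisor, the weighted projective space $\mathbb{CP}^{[p]}$, $[p]=[p_1,\ldots,p_{m+1}]$, is the complex orbifold of complex dimension $m$ obtained as the quotient of $\mathbb C^{m+1}\setminus\{0\}$ by the $\mathbb C^*$-action $\lambda\cdot(Z_1,\ldots,Z_{m+1})=(\lambda^{p_1}Z_1,\ldots,\lambda^{p_{m+1}}Z_{m+1})$. A Bochner-Kähler metric on it is a smooth orbifold Kähler metric that is Bochner-Kähler in the local (uniformizing) orbifold charts. Bochner-Kähler structures in complex dimension $n$ (here $n=m$): $\mathbb C^n$ consists of columns, $z^*$ is conjugate transpose, $\mathfrak u(n)=\{a\in M_n(\mathbb C):a^*=-a\}$. For a Kähler manifold $(M,g,\Omega)$ of complex dimension $n\ge1$, the unitary coframe bundle $\pi:P\to M$ has fiber $P_x$ = the complex-linear isometries $u:T_xM\to\mathbb C^n$. Let $\omega(v)=u(\pi'(v))$ for $v\in T_uP$ (so $\pi^*\Omega=-\frac i2\omega^*\wedge\omega$) and let $\phi$ be the unique $\mathfrak u(n)$-valued $1$-form with $d\omega=-\phi\wedge\omega$. The structure is Bochner-Kähler if there are $H:P\to i\mathfrak u(n)$ (Hermitian matrices), $T:P\to\mathbb C^n$, $V:P\to\mathbb R$ with $$d\phi=-\phi\wedge\phi+H\,\omega^*\wedge\omega-H\,\omega\wedge\omega^*-\omega\wedge\omega^*H+(\omega^*\wedge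 H\omega)\,I_n+(\operatorname{tr}H)\bigl(\omega^*\wedge\omega\,I_n-\omega\wedge\omega^*\bigr),$$ $$dH=-\phi H+H\phi+T\omega^*+\omega T^*,\qquad dT=-\phi T+\bigl(H^2+(\operatorname{tr}H)H+V I_n\bigr)\omega,$$ $$dV=(\operatorname{tr}H)(T^*\omega+\omega^*T)+(T^*H\omega+\omega^*HT).$$ For $n\ge2$ this is equivalent to the vanishing of the Bochner curvature (the component of the Kähler curvature tensor complementary to the scalar and traceless Ricci components); for $n=1$ it is the definition. *)

theory Defs
  imports "HOL-Analysis.Analysis" "HOL-Combinatorics.Transposition"
begin

section \<open>Smooth maps, tangent vectors and differential forms on a subset of a Euclidean space\<close>

primrec C_k_on :: "nat \<Rightarrow> 'a::euclidean_space set \<Rightarrow> ('a \<Rightarrow> 'b::real_normed_vector) \<Rightarrow> bool" where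
  "C_k_on 0 S f \<longleftrightarrow> continuous_on S f"
| "C_k_on (Suc k) S f \<longleftrightarrow>
     (\<forall>x\<in>S. f differentiable (at x)) \<and> (\<forall>v. C_k_on k S (\<lambda>x. frechet_derivative f (at x) v))"

text \<open>Only used for open sets.\<close>

definition smooth_on :: "'a::euclidean_space set \<Rightarrow> ('a \<Rightarrow> 'b::real_normed_vector) \<Rightarrow> bool" where
  "smooth_on S f \<longleftrightarrow> (\<forall>k. C_k_on k S f)"

text \<open>The velocities at \<open>u\<close> of curves in \<open>P\<close>.  For an embedded submanifold \<open>P\<close> this is the tangent
  space \<open>T\<^sub>u P\<close>, viewed inside the ambient space.  The curve need only be differentiable at \<open>0\<close>;
  its values away from \<open>0\<close> are irrelevant, so asking it to be defined on the whole line is harmless.\<close>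

definition tangent_space :: "'a::euclidean_space set \<Rightarrow> 'a \<Rightarrow> 'a set" where
  "tangent_space P u =
     {v. \<exists>c :: real \<Rightarrow> 'a. (\<forall>t. c t \<in> P) \<and> c 0 = u \<and> (c has_vector_derivative v) (at 0)}"

text \<open>A \<open>1\<close>-form on \<open>P\<close> is a function of a point and a tangent vector; only its values on
  \<open>T\<^sub>u P\<close>, for \<open>u \<in> P\<close>, are relevant.  A smooth form on an embedded submanifold is one which
  is locally the restriction of a smooth form on an open set of the ambient space.\<close>

definition local_extension ::
  "'a::euclidean_space set \<Rightarrow> ('a \<Rightarrow> 'a \<Rightarrow> 'b::real_normed_vector) \<Rightarrow> 'a set \<Rightarrow> ('a \<Rightarrow> 'a \<Rightarrow> 'b) \<Rightarrow> bool"
where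
  "local_extension P \<alpha> N A \<longleftrightarrow>
     open N \<and> (\<forall>y\<in>N. linear (A y)) \<and> (\<forall>v. smooth_on N (\<lambda>y. A y v)) \<and>
     (\<forall>y\<in>P \<inter> N. \<forall>v\<in>tangent_space P y. A y v = \<alpha> y v)"

definition one_form_on ::
  "'a::euclidean_space set \<Rightarrow> ('a \<Rightarrow> 'a \<Rightarrow> 'b::real_normed_vector) \<Rightarrow> bool" where
  "one_form_on P \<alpha> \<longleftrightarrow> (\<forall>u\<in>P. \<exists>N A. u \<in> N \<and> local_extension P \<alpha> N A)"

text \<open>The exterior derivative in an open set, evaluated on constant vector fields.  The convention is
  \<open>d\<alpha>(X,Y) = X \<alpha>(Y) - Y \<alpha>(X) - \<alpha>([X,Y])\<close>, matching the wedge product below.\<close>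

definition ext_deriv1 ::
  "('a::euclidean_space \<Rightarrow> 'a \<Rightarrow> 'b::real_normed_vector) \<Rightarrow> 'a \<Rightarrow> 'a \<Rightarrow> 'a \<Rightarrow> 'b" where
  "ext_deriv1 A y v w =
     frechet_derivative (\<lambda>z. A z w) (at y) v - frechet_derivative (\<lambda>z. A z v) (at y) w"

text \<open>\<open>d\<alpha> = \<beta>\<close> on \<open>P\<close>: exterior differentiation commutes with restriction, so \<open>d\<alpha>\<close> is the
  restriction of the exterior derivative of any local extension of \<open>\<alpha>\<close>.\<close>

definition has_ext_deriv_on ::
  "('a::euclidean_space \<Rightarrow> 'a \<Rightarrow> 'b::real_normed_vector) \<Rightarrow> ('a \<Rightarrow> 'a \<Rightarrow> 'a \<Rightarrow> 'b) \<Rightarrow> 'a set \<Rightarrow> bool"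
where
  "has_ext_deriv_on \<alpha> \<beta> P \<longleftrightarrow>
     (\<forall>u\<in>P. \<exists>N A. u \<in> N \<and> local_extension P \<alpha> N A \<and>
        (\<forall>y\<in>P \<inter> N. \<forall>v\<in>tangent_space P y. \<forall>w\<in>tangent_space P y. ext_deriv1 A y v w = \<beta> y v w))"

text \<open>\<open>df = \<alpha>\<close> on \<open>P\<close> for a function \<open>f\<close>.  A derivative of \<open>f\<close> within \<open>P\<close> is unique
  only on tangent vectors, and only its values there are constrained.\<close>

definition has_differential_on ::
  "('a::euclidean_space \<Rightarrow> 'b::real_normed_vector) \<Rightarrow> ('a \<Rightarrow> 'a \<Rightarrow> 'b) \<Rightarrow> 'a set \<Rightarrow> bool"
where
  "has_differential_on f \<alpha> P \<longleftrightarrow>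
     (\<forall>u\<in>P. \<exists>D. (f has_derivative D) (at u within P) \<and> (\<forall>v\<in>tangent_space P u. D v = \<alpha> u v))"

definition wedge :: "('b \<Rightarrow> 'c \<Rightarrow> 'd::ab_group_add) \<Rightarrow> ('a \<Rightarrow> 'b) \<Rightarrow> ('a \<Rightarrow> 'c) \<Rightarrow> 'a \<Rightarrow> 'a \<Rightarrow> 'd" where
  "wedge m \<alpha> \<beta> v w = m (\<alpha> v) (\<beta> w) - m (\<alpha> w) (\<beta> v)"


section \<open>Kaehler metrics and their unitary coframe bundles\<close>

definition cadjoint :: "complex^'n^'m \<Rightarrow> complex^'m^'n" where
  "cadjoint A = (\<chi> i j. cnj (A $ j $ i))"

text \<open>For columns \<open>a\<close>, \<open>b\<close>: the scalar \<open>a\<^sup>* b\<close> and the matrix \<open>a b\<^sup>*\<close>.\<close>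

definition cdot :: "complex^'n \<Rightarrow> complex^'n \<Rightarrow> complex" where
  "cdot a b = (\<Sum>i\<in>UNIV. cnj (a $ i) * b $ i)"

definition outer :: "complex^'n \<Rightarrow> complex^'n \<Rightarrow> complex^'n^'n" where
  "outer a b = (\<chi> i j. a $ i * cnj (b $ j))"

type_synonym 'n metric = "complex^'n \<Rightarrow> complex^'n \<Rightarrow> complex^'n \<Rightarrow> real"

definition kaehler_form :: "'n::finite metric \<Rightarrow> 'n metric" where
  "kaehler_form g x v w = g x (\<i> *s v) w"

text \<open>A Kaehler metric on an open set of \<open>\<complex>\<^sup>n\<close>, with its standard complex structure.  The last
  conjunct says that the Kaehler form is closed.\<close>

definition kaehler_metric_on :: "(complex^'n::finite) set \<Rightarrow> 'n metric \<Rightarrow> bool" where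
  "kaehler_metric_on U g \<longleftrightarrow> open U \<and>
     (\<forall>v w. smooth_on U (\<lambda>x. g x v w)) \<and>
     (\<forall>x\<in>U. bilinear (g x) \<and> (\<forall>v w. g x v w = g x w v) \<and> (\<forall>v. v \<noteq> 0 \<longrightarrow> g x v v > 0) \<and>
        (\<forall>v w. g x (\<i> *s v) (\<i> *s w) = g x v w)) \<and>
     (\<forall>x\<in>U. \<forall>a b c.
        frechet_derivative (\<lambda>y. kaehler_form g y b c) (at x) a +
        frechet_derivative (\<lambda>y. kaehler_form g y c a) (at x) b +
        frechet_derivative (\<lambda>y. kaehler_form g y a b) (at x) c = 0)"

text \<open>The inner product of \<open>complex^'n\<close> is \<open>Re (v\<^sup>* w)\<close>, so the points over \<open>x\<close> are exactly the
  complex-linear isometries from \<open>(T\<^sub>x U, g\<^sub>x)\<close> to \<open>\<complex>\<^sup>n\<close>.\<close>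

definition unitary_coframes ::
  "(complex^'n::finite) set \<Rightarrow> 'n metric \<Rightarrow> ((complex^'n) \<times> (complex^'n^'n)) set" where
  "unitary_coframes U g = {(x, A). x \<in> U \<and> (\<forall>v w. inner (A *v v) (A *v w) = g x v w)}"

definition coframe_form ::
  "(complex^'n) \<times> (complex^'n^'n) \<Rightarrow> (complex^'n) \<times> (complex^'n^'n) \<Rightarrow> complex^'n::finite" where
  "coframe_form u v = snd u *v fst v"


section \<open>Bochner-Kaehler metrics\<close>

text \<open>The conjuncts are, in order: \<open>\<phi>\<close> is a \<open>\<uu>(n)\<close>-valued \<open>1\<close>-form; the first structure equation for \<open>d\<omega>\<close>; \<open>H\<close> is
  Hermitian; and the structure equations for \<open>d\<phi>\<close>, \<open>dH\<close>, \<open>dT\<close>, \<open>dV\<close>.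
  The first two determine \<open>\<phi>\<close>.  Differentiability of \<open>H\<close>, \<open>T\<close>, \<open>V\<close> is all that is needed:
  the equations then force smoothness.  A scalar \<open>c\<close> times the identity is \<open>mat c\<close>.\<close>

definition bochner_kaehler_on :: "(complex^'n::finite) set \<Rightarrow> 'n metric \<Rightarrow> bool" where
  "bochner_kaehler_on U g \<longleftrightarrow> kaehler_metric_on U g \<and>
    (let P = unitary_coframes U g; \<omega> = coframe_form in
     \<exists>(\<phi> :: (complex^'n) \<times> (complex^'n^'n) \<Rightarrow> (complex^'n) \<times> (complex^'n^'n) \<Rightarrow> complex^'n^'n)
      (H :: (complex^'n) \<times> (complex^'n^'n) \<Rightarrow> complex^'n^'n)
      (T :: (complex^'n) \<times> (complex^'n^'n) \<Rightarrow> complex^'n)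
      (V :: (complex^'n) \<times> (complex^'n^'n) \<Rightarrow> real).
        one_form_on P \<phi> \<and>
        (\<forall>u\<in>P. \<forall>v\<in>tangent_space P u. cadjoint (\<phi> u v) = - \<phi> u v) \<and>
        has_ext_deriv_on \<omega> (\<lambda>u v w. - wedge (*v) (\<phi> u) (\<omega> u) v w) P \<and>
        (\<forall>u\<in>P. cadjoint (H u) = H u) \<and>
        has_ext_deriv_on \<phi>
          (\<lambda>u v w. - wedge (**) (\<phi> u) (\<phi> u) v w
             + mat (wedge cdot (\<omega> u) (\<omega> u) v w) ** H u
             - H u ** wedge outer (\<omega> u) (\<omega> u) v w
             - wedge outer (\<omega> u) (\<omega> u) v w ** H u
             + mat (wedge cdot (\<omega> u) (\<lambda>y. H u *v \<omega> u y) v w)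
             + mat (trace (H u)) **
                 (mat (wedge cdot (\<omega> u) (\<omega> u) v w) - wedge outer (\<omega> u) (\<omega> u) v w)) P \<and>
        has_differential_on H
          (\<lambda>u v. - \<phi> u v ** H u + H u ** \<phi> u v + outer (T u) (\<omega> u v) + outer (\<omega> u v) (T u)) P \<and>
        has_differential_on T
          (\<lambda>u v. - \<phi> u v *v T u
             + (H u ** H u + mat (trace (H u)) ** H u + mat (complex_of_real (V u))) *v \<omega> u v) P \<and>
        has_differential_on (\<lambda>u. complex_of_real (V u))
          (\<lambda>u v. trace (H u) * (cdot (T u) (\<omega> u v) + cdot (\<omega> u v) (T u))
             + (cdot (T u) (H u *v \<omega> u v) + cdot (\<omega> u v) (H u *v T u))) P)"


section \<open>Complex orbifolds and orbifold metrics\<close>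

definition holomorphic_map_on :: "(complex^'n::finite) set \<Rightarrow> (complex^'n \<Rightarrow> complex^'m::finite) \<Rightarrow> bool" where
  "holomorphic_map_on W h \<longleftrightarrow>
     (\<forall>x\<in>W. \<exists>D. (h has_derivative D) (at x) \<and> (\<forall>c v. D (c *s v) = c *s D v))"

text \<open>A uniformizing chart consists of an open set \<open>U i\<close> of \<open>\<complex>\<^sup>n\<close>, a finite group \<open>\<Gamma> i\<close> of
  biholomorphisms of \<open>U i\<close> and a map \<open>\<psi> i\<close> from \<open>U i\<close> to the underlying space whose fibres are the
  \<open>\<Gamma> i\<close>-orbits.  A local transition map is a holomorphic embedding of an open subset of \<open>U i\<close> into
  \<open>U j\<close> covering the identity of the underlying space; in particular the elements of \<open>\<Gamma> i\<close> are
  transition maps from the chart \<open>i\<close> to itself.\<close>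

definition orbifold_transition ::
  "('i \<Rightarrow> (complex^'n::finite) set) \<Rightarrow> ('i \<Rightarrow> complex^'n \<Rightarrow> 'x) \<Rightarrow> 'i \<Rightarrow> 'i
     \<Rightarrow> (complex^'n) set \<Rightarrow> (complex^'n \<Rightarrow> complex^'n) \<Rightarrow> bool" where
  "orbifold_transition U \<psi> i j W h \<longleftrightarrow>
     open W \<and> W \<subseteq> U i \<and> h ` W \<subseteq> U j \<and> holomorphic_map_on W h \<and> inj_on h W \<and>
     (\<forall>x\<in>W. \<psi> j (h x) = \<psi> i x)"

text \<open>The topology of the underlying set \<open>X\<close> is the one induced by the charts; it is second countable
  because the index type is countable, and the last conjunct is the Hausdorff property.\<close>

definition complex_orbifold ::
  "'x set \<Rightarrow> ('i::countable \<Rightarrow> (complex^'n::finite) set) \<Rightarrow> ('i \<Rightarrow> (complex^'n \<Rightarrow> complex^'n) set)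
     \<Rightarrow> ('i \<Rightarrow> complex^'n \<Rightarrow> 'x) \<Rightarrow> bool" where
  "complex_orbifold X U \<Gamma> \<psi> \<longleftrightarrow>
     (\<forall>i. open (U i) \<and> connected (U i)) \<and>
     (\<forall>i. finite (\<Gamma> i) \<and>
        (\<forall>a\<in>\<Gamma> i. bij_betw a (U i) (U i) \<and> holomorphic_map_on (U i) a) \<and>
        (\<exists>e\<in>\<Gamma> i. \<forall>x\<in>U i. e x = x) \<and>
        (\<forall>a\<in>\<Gamma> i. \<forall>b\<in>\<Gamma> i. \<exists>c\<in>\<Gamma> i. \<forall>x\<in>U i. c x = a (b x)) \<and>
        (\<forall>a\<in>\<Gamma> i. \<exists>b\<in>\<Gamma> i. \<forall>x\<in>U i. b (a x) = x)) \<and>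
     (\<Union>i. \<psi> i ` U i) = X \<and>
     (\<forall>i. \<forall>x\<in>U i. \<forall>y\<in>U i. \<psi> i x = \<psi> i y \<longleftrightarrow> (\<exists>a\<in>\<Gamma> i. y = a x)) \<and>
     (\<forall>i j. \<forall>x\<in>U i. \<forall>y\<in>U j. \<psi> i x = \<psi> j y \<longrightarrow>
        (\<exists>W h. orbifold_transition U \<psi> i j W h \<and> x \<in> W \<and> h x = y)) \<and>
     (\<forall>i j. \<forall>x\<in>U i. \<forall>y\<in>U j. \<psi> i x \<noteq> \<psi> j y \<longrightarrow>
        (\<exists>W W'. open W \<and> W \<subseteq> U i \<and> x \<in> W \<and> open W' \<and> W' \<subseteq> U j \<and> y \<in> W' \<and>
           \<psi> i ` W \<inter> \<psi> j ` W' = {}))"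

text \<open>An orbifold metric assigns a metric to each uniformizing chart so that all transition maps,
  and hence all elements of the groups \<open>\<Gamma> i\<close>, are isometries.\<close>

definition bochner_kaehler_orbifold_metric ::
  "'x set \<Rightarrow> ('i::countable \<Rightarrow> (complex^'n::finite) set) \<Rightarrow> ('i \<Rightarrow> (complex^'n \<Rightarrow> complex^'n) set)
     \<Rightarrow> ('i \<Rightarrow> complex^'n \<Rightarrow> 'x) \<Rightarrow> ('i \<Rightarrow> 'n metric) \<Rightarrow> bool" where
  "bochner_kaehler_orbifold_metric X U \<Gamma> \<psi> g \<longleftrightarrow>
     complex_orbifold X U \<Gamma> \<psi> \<and>
     (\<forall>i. bochner_kaehler_on (U i) (g i)) \<and>
     (\<forall>i j W h. orbifold_transition U \<psi> i j W h \<longrightarrow>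
        (\<forall>x\<in>W. \<forall>v w. g j (h x) (frechet_derivative h (at x) v) (frechet_derivative h (at x) w)
                         = g i x v w))"


section \<open>Weighted projective spaces\<close>

text \<open>For \<open>CARD('n) = m\<close> the type \<open>'n option\<close> indexes the \<open>m + 1\<close> homogeneous coordinates.\<close>

definition wscale :: "('n option \<Rightarrow> nat) \<Rightarrow> complex \<Rightarrow> complex^('n::finite option) \<Rightarrow> complex^('n option)" where
  "wscale p c Z = (\<chi> j. c ^ p j * Z $ j)"

definition worbit :: "('n option \<Rightarrow> nat) \<Rightarrow> complex^('n::finite option) \<Rightarrow> (complex^('n option)) set" where
  "worbit p Z = {wscale p c Z | c. c \<noteq> 0}"

definition wps :: "('n::finite option \<Rightarrow> nat) \<Rightarrow> (complex^('n option)) set set" where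
  "wps p = worbit p ` (UNIV - {0})"

text \<open>The transposition of \<open>None\<close> and \<open>i\<close> identifies \<open>'n\<close>, i.e. the indices other than \<open>None\<close>,
  with the homogeneous indices other than \<open>i\<close>.  Thus \<open>wps_lift i\<close> is the affine slice
  \<open>Z $ i = 1\<close>, and the charts have the usual uniformizing groups of \<open>p i\<close>-th roots of unity.\<close>

definition wps_lift :: "'n option \<Rightarrow> complex^'n \<Rightarrow> complex^('n::finite option)" where
  "wps_lift i z = (\<chi> j. case Transposition.transpose None i j of None \<Rightarrow> 1 | Some k \<Rightarrow> z $ k)"

definition wps_chart :: "('n option \<Rightarrow> nat) \<Rightarrow> 'n option \<Rightarrow> complex^'n \<Rightarrow> (complex^('n::finite option)) set" where
  "wps_chart p i z = worbit p (wps_lift i z)"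

definition wps_group :: "('n option \<Rightarrow> nat) \<Rightarrow> 'n option \<Rightarrow> (complex^'n \<Rightarrow> complex^'n::finite) set" where
  "wps_group p i = {(\<lambda>z. \<chi> k. c ^ p (Transposition.transpose None i (Some k)) * z $ k) | c. c ^ p i = 1}"


subsection \<open>The standard charts form a complex orbifold\<close>

lemma wps_lift_same [simp]: "wps_lift i z $ i = 1"
  by (simp add: wps_lift_def)

lemma wps_lift_other [simp]: "wps_lift i z $ Transposition.transpose None i (Some k) = z $ k"
  by (simp add: wps_lift_def)

lemma wps_index_cases:
  obtains "j = i" | k where "j = Transposition.transpose None i (Some k)"
  by (metis Transposition.transpose_involutory Transposition.transpose_apply_first not_Some_eq)

lemma wps_lift_section:
  assumes "Z $ i = 1" shows "wps_lift i (\<chi> k. Z $ Transposition.transpose None i (Some k)) = Z"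
proof -
  have "wps_lift i (\<chi> k. Z $ Transposition.transpose None i (Some k)) $ j = Z $ j" for j
    by (cases rule: wps_index_cases[of j i]) (use assms in auto)
  then show ?thesis by (simp add: vec_eq_iff)
qed

lemma wps_lift_eq_iff [simp]: "wps_lift i z = wps_lift i w \<longleftrightarrow> z = w"
  by (metis vec_eq_iff wps_lift_other)

lemma wscale_wscale: "wscale p c (wscale p d Z) = wscale p (c * d) Z"
  by (simp add: wscale_def vec_eq_iff power_mult_distrib)

lemma wscale_nth [simp]: "wscale p c Z $ j = c ^ p j * Z $ j"
  by (simp add: wscale_def)

lemma wscale_1 [simp]: "wscale p 1 Z = Z"
  by (simp add: vec_eq_iff)

lemma worbit_eq_iff: "worbit p Z = worbit p W \<longleftrightarrow> (\<exists>c. c \<noteq> 0 \<and> W = wscale p c Z)"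
proof
  assume "worbit p Z = worbit p W"
  moreover have "W \<in> worbit p W"
    unfolding worbit_def by (auto intro!: exI[of _ 1])
  ultimately show "\<exists>c. c \<noteq> 0 \<and> W = wscale p c Z"
    by (auto simp: worbit_def)
next
  assume "\<exists>c. c \<noteq> 0 \<and> W = wscale p c Z"
  then obtain c where c: "c \<noteq> 0" "W = wscale p c Z" by blast
  have "\<exists>e. wscale p d Z = wscale p e W \<and> e \<noteq> 0" if "d \<noteq> 0" for d
    using c that by (intro exI[of _ "d / c"]) (simp add: wscale_wscale)
  moreover have "\<exists>e. wscale p d W = wscale p e Z \<and> e \<noteq> 0" if "d \<noteq> 0" for d
    using c that by (intro exI[of _ "d * c"]) (simp add: wscale_wscale)
  ultimately show "worbit p Z = worbit p W"
    unfolding worbit_def by blast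
qed

lemma wps_chart_eq_iff:
  "wps_chart p i z = wps_chart p j w \<longleftrightarrow> (\<exists>c. c \<noteq> 0 \<and> wps_lift j w = wscale p c (wps_lift i z))"
  by (simp add: wps_chart_def worbit_eq_iff)

lemma wps_chart_fibre:
  assumes "p i > 0"
  shows "wps_chart p i z = wps_chart p i w \<longleftrightarrow> (\<exists>a\<in>wps_group p i. w = a z)"
proof -
  have "wps_lift i w = wscale p c (wps_lift i z) \<longleftrightarrow>
      c ^ p i = 1 \<and> w = (\<chi> k. c ^ p (Transposition.transpose None i (Some k)) * z $ k)" for c
  proof
    assume "wps_lift i w = wscale p c (wps_lift i z)"
    then have *: "wps_lift i w $ j = c ^ p j * wps_lift i z $ j" for j by simp
    from *[of i] have "c ^ p i = 1" by simp
    moreover have "w $ k = c ^ p (Transposition.transpose None i (Some k)) * z $ k" for k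
      using *[of "Transposition.transpose None i (Some k)"] by simp
    ultimately show "c ^ p i = 1 \<and> w = (\<chi> k. c ^ p (Transposition.transpose None i (Some k)) * z $ k)"
      by (simp add: vec_eq_iff)
  next
    assume *: "c ^ p i = 1 \<and> w = (\<chi> k. c ^ p (Transposition.transpose None i (Some k)) * z $ k)"
    have "wps_lift i w $ j = c ^ p j * wps_lift i z $ j" for j
      by (cases rule: wps_index_cases[of j i]) (use * in auto)
    then show "wps_lift i w = wscale p c (wps_lift i z)" by (simp add: vec_eq_iff)
  qed
  moreover have "c \<noteq> 0" if "c ^ p i = 1" for c :: complex
    using that assms by (auto simp: power_0_left)
  ultimately show ?thesis
    by (auto simp: wps_chart_eq_iff wps_group_def)
qed

lemma complex_nth_root_exists:
  fixes w :: complex assumes "w \<noteq> 0" "n > 0" obtains c where "c ^ n = w" "c \<noteq> 0"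
proof
  show "exp (Ln w / of_nat n) ^ n = w"
    using assms by (simp flip: exp_of_nat_mult)
qed auto

lemma wps_charts_cover:
  fixes p :: "'n::finite option \<Rightarrow> nat"
  assumes "\<And>i. p i > 0" shows "(\<Union>i. wps_chart p i ` UNIV) = wps p"
proof safe
  fix i :: "'n option" and z :: "complex^'n"
  have "wps_lift i z \<noteq> 0" by (metis wps_lift_same zero_index zero_neq_one)
  then show "wps_chart p i z \<in> wps p" by (auto simp: wps_def wps_chart_def)
next
  fix O' assume "O' \<in> wps p"
  then obtain Z where Z: "Z \<noteq> 0" "O' = worbit p Z" by (auto simp: wps_def)
  then obtain i where i: "Z $ i \<noteq> 0" by (auto simp: vec_eq_iff)
  obtain c where c: "c ^ p i = 1 / Z $ i" "c \<noteq> 0"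
    using complex_nth_root_exists[of "1 / Z $ i" "p i"] i assms by auto
  define z where "z = (\<chi> k. wscale p c Z $ Transposition.transpose None i (Some k))"
  have "wps_lift i z = wscale p c Z"
    unfolding z_def by (rule wps_lift_section) (use c i in simp)
  then have "O' = wps_chart p i z"
    using Z c by (auto simp: wps_chart_def worbit_eq_iff)
  then show "O' \<in> (\<Union>i. range (wps_chart p i))" by auto
qed

definition cdiff_at :: "(complex^'n::finite \<Rightarrow> complex) \<Rightarrow> complex^'n \<Rightarrow> bool" where
  "cdiff_at f x \<longleftrightarrow> (\<exists>D. (f has_derivative D) (at x) \<and> (\<forall>c v. D (c *s v) = c * D v))"

lemma cdiff_at_const [simp]: "cdiff_at (\<lambda>z. c) x"
  unfolding cdiff_at_def by (rule exI[of _ "\<lambda>_. 0"]) auto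

lemma cdiff_at_nth [simp]: "cdiff_at (\<lambda>z. z $ k) x"
  unfolding cdiff_at_def
  by (rule exI[of _ "\<lambda>v. v $ k"]) (simp add: bounded_linear_imp_has_derivative bounded_linear_vec_nth)

lemma cdiff_at_mult: assumes "cdiff_at f x" "cdiff_at g x" shows "cdiff_at (\<lambda>z. f z * g z) x"
proof -
  obtain D E where "(f has_derivative D) (at x)" "\<forall>c v. D (c *s v) = c * D v"
    "(g has_derivative E) (at x)" "\<forall>c v. E (c *s v) = c * E v"
    using assms unfolding cdiff_at_def by blast
  then show ?thesis unfolding cdiff_at_def
    by (intro exI[of _ "\<lambda>v. f x * E v + D v * g x"] conjI has_derivative_mult) (auto simp: distrib_left mult_ac)
qed

lemma cdiff_at_power: "cdiff_at f x \<Longrightarrow> cdiff_at (\<lambda>z. f z ^ n) x"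
  by (induction n) (auto intro: cdiff_at_mult)

lemma cdiff_at_compose:
  assumes "cdiff_at f x" "(F has_field_derivative F') (at (f x))" shows "cdiff_at (\<lambda>z. F (f z)) x"
proof -
  obtain D where D: "(f has_derivative D) (at x)" "\<forall>c v. D (c *s v) = c * D v"
    using assms unfolding cdiff_at_def by blast
  have "((\<lambda>z. F (f z)) has_derivative (\<lambda>v. F' * D v)) (at x)"
    using has_derivative_compose[OF D(1) assms(2)[unfolded has_field_derivative_def]] by simp
  with D show ?thesis unfolding cdiff_at_def by (intro exI[of _ "\<lambda>v. F' * D v"]) auto
qed

lemma holomorphic_map_onI:
  fixes h :: "complex^'n::finite \<Rightarrow> complex^'b::finite"
  assumes "\<And>x k. x \<in> W \<Longrightarrow> cdiff_at (\<lambda>z. h z $ k) x" shows "holomorphic_map_on W h"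
  unfolding holomorphic_map_on_def
proof
  fix x assume "x \<in> W"
  then obtain D where D: "\<And>k. ((\<lambda>z. h z $ k) has_derivative D k) (at x)" "\<And>k c v. D k (c *s v) = c * D k v"
    using assms unfolding cdiff_at_def by metis
  have "(h has_derivative (\<lambda>v. \<chi> k. D k v)) (at x)"
  proof -
    have "norm (axis k c :: complex^'b) = norm c" for k c
      by (simp add: norm_eq_sqrt_inner inner_axis_axis)
    note nrm = this
    have ax: "bounded_linear (\<lambda>c. axis k c :: complex^'b)" for k
      by (rule bounded_linear_intro[where K = 1]) (simp_all only: nrm, simp_all add: axis_def vec_eq_iff)
    have "((\<lambda>z. \<Sum>k\<in>UNIV. axis k (h z $ k)) has_derivative (\<lambda>v. \<Sum>k\<in>UNIV. axis k (D k v))) (at x)"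
      by (intro has_derivative_sum bounded_linear.has_derivative[OF ax] D(1))
    moreover have "(\<Sum>k\<in>UNIV. axis k (f k)) = (\<chi> k. f k)" for f :: "'b \<Rightarrow> complex"
      by (simp add: vec_eq_iff axis_def)
    ultimately show ?thesis by simp
  qed
  with D(2) show "\<exists>D. (h has_derivative D) (at x) \<and> (\<forall>c v. D (c *s v) = c *s D v)"
    by (intro exI[of _ "\<lambda>v. \<chi> k. D k v"]) (auto simp: vec_eq_iff)
qed

lemma cdiff_at_lift [simp]: "cdiff_at (\<lambda>z. wps_lift i z $ j) x"
  by (cases rule: wps_index_cases[of j i]) auto

lemma cdiff_at_imp_continuous: "cdiff_at f x \<Longrightarrow> isCont f x"
  unfolding cdiff_at_def using has_derivative_continuous by blast

lemma wps_transition_exists: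
  fixes p :: "'n::finite option \<Rightarrow> nat"
  assumes pos: "\<And>i. p i > 0" and eq: "wps_chart p i x = wps_chart p j y"
  shows "\<exists>W h. orbifold_transition (\<lambda>_. UNIV) (wps_chart p) i j W h \<and> x \<in> W \<and> h x = y"
proof -
  obtain c where c: "c \<noteq> 0" "wps_lift j y = wscale p c (wps_lift i x)"
    using eq by (auto simp: wps_chart_eq_iff)
  define a where "a = wps_lift i x $ j"
  have ca: "c ^ p j * a = 1"
    using c(2) wps_lift_same[of j y] by (simp add: a_def)
  then have a: "a \<noteq> 0" by auto
  define l where "l z = wps_lift i z $ j / a" for z
  have lx: "l x = 1" using a by (simp add: l_def a_def)
  have cl: "cdiff_at l z" for z
    unfolding l_def divide_inverse by (intro cdiff_at_mult) auto
  define e where "e = pi * p j / p i"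
  have e: "e > 0" using pos by (simp add: e_def)
  have "isCont Ln 1" by (intro continuous_at_Ln) auto
  then obtain d where d: "d > 0" "\<And>w. dist w 1 < d \<Longrightarrow> dist (Ln w) (Ln 1) < e"
    using e unfolding continuous_at_eps_delta by blast
  define S where "S = ball (1::complex) (min d 1)"
  have S: "w \<notin> \<real>\<^sub>\<le>\<^sub>0" "\<bar>Im (Ln w)\<bar> < e" if "w \<in> S" for w
  proof -
    have "dist w 1 < d" "cmod (1 - w) < 1" using that by (auto simp: S_def dist_commute dist_norm)
    then have "dist (Ln w) (Ln 1) < e" "\<bar>Re (1 - w)\<bar> < 1"
      using d abs_Re_le_cmod[of "1 - w"] by auto
    then show "w \<notin> \<real>\<^sub>\<le>\<^sub>0" "\<bar>Im (Ln w)\<bar> < e"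
      using abs_Im_le_cmod[of "Ln w"] by (auto simp: complex_nonpos_Reals_iff)
  qed
  define W where "W = l -` S"
  have openW: "open W"
    unfolding W_def by (intro continuous_open_vimage) (auto simp: S_def cdiff_at_imp_continuous cl)
  have xW: "x \<in> W" using d by (simp add: W_def S_def lx)
  define r where "r z = c * exp (- (1 / of_nat (p j)) * Ln (l z))" for z
  have r0: "r z \<noteq> 0" for z using c by (simp add: r_def)
  have cr: "cdiff_at r z" if "z \<in> W" for z
  proof -
    have "l z \<notin> \<real>\<^sub>\<le>\<^sub>0" using S that by (simp add: W_def)
    then have "((\<lambda>w. c * exp (- (1 / of_nat (p j)) * Ln w)) has_field_derivative
       c * (exp (- (1 / of_nat (p j)) * Ln (l z)) * (- (1 / of_nat (p j)) * inverse (l z)))) (at (l z))"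
      using pos[of j] by (auto intro!: derivative_eq_intros simp: divide_simps)
    from cdiff_at_compose[OF cl this] show ?thesis unfolding r_def .
  qed
  define h where "h z = (\<chi> k. wscale p (r z) (wps_lift i z) $ Transposition.transpose None j (Some k))" for z
  have lift: "wps_lift j (h z) = wscale p (r z) (wps_lift i z)" if "z \<in> W" for z
    unfolding h_def
  proof (rule wps_lift_section)
    have lz: "l z \<noteq> 0" using S(1)[of "l z"] that by (auto simp: W_def complex_nonpos_Reals_iff)
    have "r z ^ p j = c ^ p j * exp (- Ln (l z))"
      using pos[of j] by (simp add: r_def power_mult_distrib flip: exp_of_nat_mult)
    also have "\<dots> = c ^ p j / l z" using lz by (simp add: exp_minus field_simps)
    finally show "wscale p (r z) (wps_lift i z) $ j = 1"
      using lz ca a by (simp add: l_def field_simps)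
  qed
  have "inj_on h W"
  proof (rule inj_onI)
    fix z w assume zw: "z \<in> W" "w \<in> W" "h z = h w"
    then have eq: "wscale p (r z) (wps_lift i z) = wscale p (r w) (wps_lift i w)"
      using lift by metis
    then have "wscale p (r z) (wps_lift i z) $ i = wscale p (r w) (wps_lift i w) $ i" by simp
    then have "r z ^ p i = r w ^ p i" by simp
    then have ex: "exp (of_nat (p i) * (- (1 / of_nat (p j)) * Ln (l z))) =
        exp (of_nat (p i) * (- (1 / of_nat (p j)) * Ln (l w)))"
      using c(1) by (simp add: r_def power_mult_distrib del: mult_minus_left mult_minus_right add: exp_of_nat_mult[symmetric])
    have im: "\<bar>Im (of_nat (p i) * (- (1 / of_nat (p j)) * Ln (l u)))\<bar> < pi" if "u \<in> W" for u
    proof -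
      have "\<bar>Im (Ln (l u))\<bar> < pi * p j / p i" using S that by (simp add: W_def e_def)
      moreover have "Im (of_nat (p i) * (- (1 / of_nat (p j)) * Ln (l u))) = - (p i / p j * Im (Ln (l u)))"
        by (simp add: Im_divide_of_nat)
      ultimately show ?thesis using pos[of i] pos[of j] by (simp add: abs_mult field_simps)
    qed
    have "of_nat (p i) * (- (1 / of_nat (p j)) * Ln (l z)) = of_nat (p i) * (- (1 / of_nat (p j)) * Ln (l w))"
    proof (rule exp_complex_eqI[OF _ ex])
      show "\<bar>Im (of_nat (p i) * (- (1 / of_nat (p j)) * Ln (l z)))
          - Im (of_nat (p i) * (- (1 / of_nat (p j)) * Ln (l w)))\<bar> < 2 * pi"
        using im[OF zw(1)] im[OF zw(2)] by linarith
    qed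
    then have "Ln (l z) = Ln (l w)" using pos[of i] pos[of j] by simp
    then have "r z = r w" by (simp add: r_def)
    with eq r0[of w] have "wps_lift i z = wps_lift i w" by (simp add: vec_eq_iff)
    then show "z = w" by simp
  qed
  moreover have "holomorphic_map_on W h"
  proof (rule holomorphic_map_onI)
    fix z k assume "z \<in> W"
    then show "cdiff_at (\<lambda>z. h z $ k) z"
      unfolding h_def wscale_nth vec_lambda_beta by (intro cdiff_at_mult cdiff_at_power cr cdiff_at_lift)
  qed
  moreover have "wps_chart p j (h z) = wps_chart p i z" if "z \<in> W" for z
    using lift[OF that] r0[of z] wps_chart_eq_iff[of p i z j "h z"] by auto
  moreover have "h x = y"
  proof -
    have "r x = c" by (simp add: r_def lx)
    then have "wps_lift j (h x) = wps_lift j y" using lift[OF xW] c by simp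
    then show ?thesis by simp
  qed
  ultimately show ?thesis using openW xW
    by (intro exI[of _ W] exI[of _ h]) (auto simp: orbifold_transition_def)
qed

lemma wps_hausdorff:
  fixes p :: "'n::finite option \<Rightarrow> nat"
  assumes pos: "\<And>i. p i > 0" and ne: "wps_chart p i x \<noteq> wps_chart p j y"
  shows "\<exists>W W'. open W \<and> x \<in> W \<and> open W' \<and> y \<in> W' \<and> wps_chart p i ` W \<inter> wps_chart p j ` W' = {}"
proof (rule ccontr)
  assume no: "\<not> ?thesis"
  have "\<exists>u v c. dist x u < 1 / real (Suc n) \<and> dist y v < 1 / real (Suc n) \<and> c \<noteq> 0 \<and>
      wps_lift j v = wscale p c (wps_lift i u)" for n
  proof -
    have "wps_chart p i ` ball x (1 / real (Suc n)) \<inter> wps_chart p j ` ball y (1 / real (Suc n)) \<noteq> {}"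
    proof
      assume "wps_chart p i ` ball x (1 / real (Suc n)) \<inter> wps_chart p j ` ball y (1 / real (Suc n)) = {}"
      moreover have "x \<in> ball x (1 / real (Suc n))" "y \<in> ball y (1 / real (Suc n))" by simp_all
      ultimately show False using no open_ball by blast
    qed
    then obtain u v where uv: "u \<in> ball x (1 / real (Suc n))" "v \<in> ball y (1 / real (Suc n))"
      "wps_chart p i u = wps_chart p j v" by blast
    then show ?thesis unfolding wps_chart_eq_iff mem_ball by blast
  qed
  then obtain u v c where uvc: "\<And>n. dist x (u n) < 1 / real (Suc n)" "\<And>n. dist y (v n) < 1 / real (Suc n)"
    "\<And>n. c n \<noteq> 0" "\<And>n. wps_lift j (v n) = wscale p (c n) (wps_lift i (u n))"
    by metis
  have lim0: "(\<lambda>n. 1 / real (Suc n)) \<longlonglongrightarrow> 0"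
    using LIMSEQ_inverse_real_of_nat by (simp add: inverse_eq_divide)
  have u: "u \<longlonglongrightarrow> x"
  proof (subst tendsto_dist_iff, rule Lim_null_comparison[OF always_eventually lim0], rule allI)
    show "norm (dist (u n) x) \<le> 1 / real (Suc n)" for n
      using uvc(1)[of n] unfolding dist_commute[of x] real_norm_def abs_of_nonneg[OF zero_le_dist]
      by (rule less_imp_le)
  qed
  have v: "v \<longlonglongrightarrow> y"
  proof (subst tendsto_dist_iff, rule Lim_null_comparison[OF always_eventually lim0], rule allI)
    show "norm (dist (v n) y) \<le> 1 / real (Suc n)" for n
      using uvc(2)[of n] unfolding dist_commute[of y] real_norm_def abs_of_nonneg[OF zero_le_dist]
      by (rule less_imp_le)
  qed
  have lift: "(\<lambda>n. wps_lift i' (w n) $ k) \<longlonglongrightarrow> wps_lift i' w0 $ k"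
    if "w \<longlonglongrightarrow> w0" for w :: "nat \<Rightarrow> complex^'n" and w0 i' k
    by (rule isCont_tendsto_compose[OF cdiff_at_imp_continuous[OF cdiff_at_lift] that])
  have "(\<lambda>n. c n ^ p i) \<longlonglongrightarrow> wps_lift j y $ i"
    using lift[OF v, of j i] by (simp add: uvc(4))
  then have "Bseq (\<lambda>n. c n ^ p i)" by (intro convergent_imp_Bseq) (auto simp: convergent_def)
  then obtain K where K: "K > 0" "\<And>n. norm (c n ^ p i) \<le> K" by (auto elim: BseqE)
  have "norm (c n) \<le> max 1 K" for n
  proof (cases "norm (c n) \<le> 1")
    case False
    then have "norm (c n) ^ 1 \<le> norm (c n) ^ p i"
      using pos[of i] by (intro power_increasing) auto
    with K(2)[of n] show ?thesis by (simp add: norm_power)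
  qed auto
  then have "bounded (range c)" by (auto simp: bounded_iff)
  then obtain c0 f where f: "strict_mono (f :: nat \<Rightarrow> nat)" "(c \<circ> f) \<longlonglongrightarrow> c0"
    using bounded_imp_convergent_subsequence by blast
  have "wps_lift j y $ k = c0 ^ p k * wps_lift i x $ k" for k
  proof (rule LIMSEQ_unique)
    show "(\<lambda>n. wps_lift j ((v \<circ> f) n) $ k) \<longlonglongrightarrow> wps_lift j y $ k"
      by (intro lift LIMSEQ_subseq_LIMSEQ v f)
    have "(\<lambda>n. (c \<circ> f) n ^ p k * wps_lift i ((u \<circ> f) n) $ k) \<longlonglongrightarrow> c0 ^ p k * wps_lift i x $ k"
      by (intro tendsto_intros lift LIMSEQ_subseq_LIMSEQ u f)
    then show "(\<lambda>n. wps_lift j ((v \<circ> f) n) $ k) \<longlonglongrightarrow> c0 ^ p k * wps_lift i x $ k"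
      by (simp add: uvc(4))
  qed
  then have eq: "wps_lift j y = wscale p c0 (wps_lift i x)" by (simp add: vec_eq_iff)
  then have "wps_lift j y $ j = wscale p c0 (wps_lift i x) $ j" by simp
  then have "c0 \<noteq> 0" using pos[of j] by (auto simp: power_0_left)
  with eq ne show False by (auto simp: wps_chart_eq_iff)
qed

lemma wps_group_group:
  fixes p :: "'n::finite option \<Rightarrow> nat"
  assumes "p i > 0"
  shows "finite (wps_group p i)"
    and "a \<in> wps_group p i \<Longrightarrow> bij a"
    and "a \<in> wps_group p i \<Longrightarrow> holomorphic_map_on UNIV a"
    and "\<exists>e\<in>wps_group p i. \<forall>x. e x = x"
    and "a \<in> wps_group p i \<Longrightarrow> b \<in> wps_group p i \<Longrightarrow> \<exists>c\<in>wps_group p i. \<forall>x. c x = a (b x)"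
    and "a \<in> wps_group p i \<Longrightarrow> \<exists>b\<in>wps_group p i. \<forall>x. b (a x) = x"
proof -
  define rot where "rot c = (\<lambda>z::complex^'n. \<chi> k. c ^ p (Transposition.transpose None i (Some k)) * z $ k)" for c
  have grp: "wps_group p i = rot ` {c. c ^ p i = 1}"
    by (auto simp: wps_group_def rot_def)
  have rr: "rot c (rot d z) = rot (c * d) z" for c d z
    by (simp add: rot_def vec_eq_iff power_mult_distrib)
  have r1: "rot 1 z = z" for z by (simp add: rot_def vec_eq_iff)
  have nz: "c \<noteq> 0" if "c ^ p i = 1" for c :: complex
    using that assms by (auto simp: power_0_left)
  show "finite (wps_group p i)"
    unfolding grp using assms by (intro finite_imageI finite_roots_unity) simp
  show "bij a" if a: "a \<in> wps_group p i"
  proof -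
    obtain c where c: "a = rot c" "c ^ p i = 1" using a unfolding grp by blast
    show ?thesis unfolding c
      by (rule o_bij[of "rot (inverse c)"]) (use nz[OF c(2)] in \<open>auto simp: rr r1\<close>)
  qed
  show "holomorphic_map_on UNIV a" if "a \<in> wps_group p i"
    using that unfolding grp rot_def by (auto intro!: holomorphic_map_onI cdiff_at_mult)
  show "\<exists>e\<in>wps_group p i. \<forall>x. e x = x"
    unfolding grp using r1 by (intro bexI[of _ "rot 1"]) auto
  show "\<exists>c\<in>wps_group p i. \<forall>x. c x = a (b x)" if ab: "a \<in> wps_group p i" "b \<in> wps_group p i"
  proof -
    obtain c d where "a = rot c" "b = rot d" "c ^ p i = 1" "d ^ p i = 1"
      using ab unfolding grp by blast
    then show ?thesis unfolding grp
      by (intro bexI[of _ "rot (c * d)"]) (auto simp: rr power_mult_distrib)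
  qed
  show "\<exists>b\<in>wps_group p i. \<forall>x. b (a x) = x" if a: "a \<in> wps_group p i"
  proof -
    obtain c where c: "a = rot c" "c ^ p i = 1" using a unfolding grp by blast
    then show ?thesis unfolding grp using nz[OF c(2)]
      by (intro bexI[of _ "rot (inverse c)"]) (auto simp: rr r1 power_inverse)
  qed
qed

theorem complex_orbifold_wps:
  fixes p :: "'n::finite option \<Rightarrow> nat"
  assumes pos: "\<And>i. p i > 0"
  shows "complex_orbifold (wps p) (\<lambda>_. UNIV) (wps_group p) (wps_chart p)"
  unfolding complex_orbifold_def
  using wps_group_group[OF pos] wps_charts_cover[OF pos] wps_chart_fibre[OF pos]
    wps_transition_exists[OF pos] wps_hausdorff[OF pos]
  by (intro conjI allI ballI impI) (simp_all, blast+)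

end

theory Submission
  imports Defs
begin

text \<open>
  The weighted \<open>\<complex>\<^sup>*\<close>-action preserves the spherical CR structure of the unit sphere in \<open>\<complex>\<^sup>n\<^sup>+\<^sup>1\<close>, and the metric
  is the Kaehler metric transverse to its Reeb flow.  With \<open>P = diag p\<close>, let \<open>t(Z)\<close> be the logarithmic radius,
  \<open>\<Sum> e^(-2 p\<^sub>j t) |Z\<^sub>j|\<^sup>2 = 1\<close>, which is a Kaehler potential, and \<open>W = e^(-t P) Z\<close>.  Tangent vectors are taken
  modulo \<open>P Z\<close>, and the metric is \<open>1 / (W\<^sup>* P W)\<close> times the hermitian product of the projections of
  \<open>e^(-t P) v\<close> to the orthogonal complement of \<open>W\<close> along \<open>P W\<close>.

  Let \<open>\<sigma>\<^sub>k = W\<^sup>* P\<^sup>k W / W\<^sup>* P W\<close>, \<open>a(v) = W\<^sup>* e^(-t P) v / W\<^sup>* P W\<close> and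
  \<open>b(v) = W\<^sup>* P e^(-t P) v / W\<^sup>* P W - \<sigma>\<^sub>2 a(v)\<close>.  In the affine chart \<open>Z\<^sub>i = 1\<close> put \<open>T = (P\<^sup>2 - p\<^sub>i P) z\<close>
  and let \<open>L v = P v - a(v) T\<close>, the endomorphism which \<open>P\<close> induces on \<open>\<complex>\<^sup>n\<^sup>+\<^sup>1 / \<complex> P Z\<close>.  The Chern connection is
  \<open>\<theta>(v) w = a(v) a(w) T - a(v) P w - a(w) P v - b(w) v - b(v) w\<close>, and the structure equations hold with
  \<open>H = s - L\<close>, this \<open>T\<close>, and \<open>V = s\<^sup>2 - s \<sigma>\<^sub>2 - \<sigma>\<^sub>3 + \<sigma>\<^sub>2\<^sup>2\<close>, where \<open>s = tr P / (n + 2)\<close>.  The scalars involved form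
  a differential ring, so that all these equations are polynomial identities.
\<close>

section \<open>Calculus of smooth functions\<close>

lemma C_k_on_Suc_imp: "C_k_on (Suc k) S f \<Longrightarrow> C_k_on k S f"
proof (induction k arbitrary: f)
  case 0
  then show ?case
    by (auto intro!: continuous_at_imp_continuous_on differentiable_imp_continuous_within)
next
  case (Suc k)
  then show ?case by (simp only: C_k_on.simps) blast
qed

text \<open>\<open>frechet_derivative\<close> is a choice made from the predicate
  \<open>has_derivative\<close> alone, and on an open set that predicate is the same for two
  functions that agree there.\<close>

lemma C_k_on_cong:
  assumes "open S" "\<And>x. x \<in> S \<Longrightarrow> f x = g x" "C_k_on k S f"
  shows "C_k_on k S g"
  using assms(2,3)
proof (induction k arbitrary: f g)
  case 0
  then show ?case by (simp cong: continuous_on_cong)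
next
  case (Suc k)
  have eq: "(f has_derivative D) (at x) \<longleftrightarrow> (g has_derivative D) (at x)" if "x \<in> S" for x D
    using has_derivative_transform_within_open[OF _ \<open>open S\<close> that, of f D UNIV g]
      has_derivative_transform_within_open[OF _ \<open>open S\<close> that, of g D UNIV f] Suc.prems(1) by auto
  have "frechet_derivative f (at x) = frechet_derivative g (at x)" if "x \<in> S" for x
    unfolding frechet_derivative_def eq[OF that] ..
  moreover have "f differentiable (at x) \<longleftrightarrow> g differentiable (at x)" if "x \<in> S" for x
    unfolding differentiable_def eq[OF that] ..
  ultimately show ?case
    using Suc.prems(2) Suc.IH[of "\<lambda>x. frechet_derivative f (at x) v" "\<lambda>x. frechet_derivative g (at x) v" for v]
    by auto
qed

text \<open>Derivatives are unique, so any explicit formula \<open>f'\<close> for them may replace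
  the chosen \<open>frechet_derivative\<close>.\<close>

lemma C_k_on_SucI:
  assumes "open S" "\<And>x. x \<in> S \<Longrightarrow> (f has_derivative f' x) (at x)" "\<And>v. C_k_on k S (\<lambda>x. f' x v)"
  shows "C_k_on (Suc k) S f"
proof -
  have "f' x v = frechet_derivative f (at x) v" if "x \<in> S" for x v
    using frechet_derivative_at[OF assms(2)[OF that]] by simp
  then have "C_k_on k S (\<lambda>x. frechet_derivative f (at x) v)" for v
    using C_k_on_cong[OF assms(1) _ assms(3), of v "\<lambda>x. frechet_derivative f (at x) v"] by blast
  then show ?thesis using assms(2) by (auto simp: differentiable_def)
qed

lemma C_k_on_subset: "C_k_on k S f \<Longrightarrow> S' \<subseteq> S \<Longrightarrow> C_k_on k S' f"
  by (induction k arbitrary: f) (auto intro: continuous_on_subset)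

lemma C_k_on_SucE:
  assumes "C_k_on (Suc k) S f"
  obtains f' where "\<And>x. x \<in> S \<Longrightarrow> (f has_derivative f' x) (at x)" "\<And>v. C_k_on k S (\<lambda>x. f' x v)"
    "C_k_on k S f"
  using that[of "\<lambda>x. frechet_derivative f (at x)"] assms C_k_on_Suc_imp[OF assms]
  by (auto simp: frechet_derivative_works)

lemma C_k_on_const: "C_k_on k S (\<lambda>x. c)"
proof (induction k arbitrary: c)
  case (Suc k)
  have "frechet_derivative (\<lambda>x. c) (at x) v = 0" for x v
    using frechet_derivative_at[OF has_derivative_const[of c "at x"]] by metis
  then show ?case using Suc by simp
qed simp

lemma C_k_on_bounded_linear_compose:
  assumes "open S" "bounded_linear L" "C_k_on k S f"
  shows "C_k_on k S (\<lambda>x. L (f x))"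
  using assms(3)
proof (induction k arbitrary: f)
  case 0
  then show ?case using bounded_linear.continuous_on[OF assms(2)] by auto
next
  case (Suc k)
  obtain f' where f': "\<And>x. x \<in> S \<Longrightarrow> (f has_derivative f' x) (at x)"
    "\<And>v. C_k_on k S (\<lambda>x. f' x v)" using C_k_on_SucE[OF Suc(2)] by metis
  show ?case
    by (rule C_k_on_SucI[OF assms(1), where f' = "\<lambda>x v. L (f' x v)"])
       (use f' assms(2) in \<open>auto intro: bounded_linear.has_derivative Suc.IH\<close>)
qed

lemma C_k_on_bounded_linear:
  assumes "open S" "bounded_linear f" shows "C_k_on k S f"
proof (cases k)
  case 0
  then show ?thesis using linear_continuous_on[OF assms(2)] by simp
next
  case (Suc m)
  show ?thesis unfolding Suc
  proof (rule C_k_on_SucI[OF assms(1), where f' = "\<lambda>_. f"])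
    show "(f has_derivative f) (at x)" for x
      by (rule bounded_linear_imp_has_derivative[OF assms(2)])
    show "C_k_on m S (\<lambda>x. f v)" for v
      by (rule C_k_on_const)
  qed
qed

lemma C_k_on_add:
  assumes "open S" "C_k_on k S f" "C_k_on k S g" shows "C_k_on k S (\<lambda>x. f x + g x)"
  using assms(2,3)
proof (induction k arbitrary: f g)
  case (Suc k)
  obtain f' where f': "\<And>x. x \<in> S \<Longrightarrow> (f has_derivative f' x) (at x)"
    "\<And>v. C_k_on k S (\<lambda>x. f' x v)" using C_k_on_SucE[OF Suc(2)] by metis
  obtain g' where g': "\<And>x. x \<in> S \<Longrightarrow> (g has_derivative g' x) (at x)"
    "\<And>v. C_k_on k S (\<lambda>x. g' x v)" using C_k_on_SucE[OF Suc(3)] by metis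
  show ?case
    by (rule C_k_on_SucI[OF assms(1), where f' = "\<lambda>x v. f' x v + g' x v"])
       (use f' g' in \<open>auto intro: has_derivative_add Suc.IH\<close>)
qed (simp add: continuous_on_add)

text \<open>The product rule needs \<open>f\<close> and \<open>g\<close> at level \<open>k\<close>
  as well as their derivatives, which is why \<open>C_k_on_SucE\<close> also returns the lower
  regularity of the function itself.\<close>

lemma C_k_on_bilinear:
  assumes "open S" "bounded_bilinear b" "C_k_on k S f" "C_k_on k S g"
  shows "C_k_on k S (\<lambda>x. b (f x) (g x))"
  using assms(3,4)
proof (induction k arbitrary: f g)
  case 0
  then show ?case using bounded_bilinear.continuous_on[OF assms(2)] by auto
next
  case (Suc k)
  obtain f' where f': "\<And>x. x \<in> S \<Longrightarrow> (f has_derivative f' x) (at x)"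
    "\<And>v. C_k_on k S (\<lambda>x. f' x v)" "C_k_on k S f" using C_k_on_SucE[OF Suc(2)] by metis
  obtain g' where g': "\<And>x. x \<in> S \<Longrightarrow> (g has_derivative g' x) (at x)"
    "\<And>v. C_k_on k S (\<lambda>x. g' x v)" "C_k_on k S g" using C_k_on_SucE[OF Suc(3)] by metis
  show ?case
    by (rule C_k_on_SucI[OF assms(1), where f' = "\<lambda>x v. b (f x) (g' x v) + b (f' x v) (g x)"])
       (use f' g' assms(1,2) in \<open>auto intro!: bounded_bilinear.FDERIV C_k_on_add[OF assms(1)] Suc.IH\<close>)
qed

lemma C_k_on_mult:
  fixes f g :: "'a::euclidean_space \<Rightarrow> 'b::real_normed_algebra"
  shows "open S \<Longrightarrow> C_k_on k S f \<Longrightarrow> C_k_on k S g \<Longrightarrow> C_k_on k S (\<lambda>x. f x * g x)"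
  by (rule C_k_on_bilinear[OF _ bounded_bilinear_mult])

lemma C_k_on_minus: "open S \<Longrightarrow> C_k_on k S f \<Longrightarrow> C_k_on k S (\<lambda>x. - f x)"
  by (rule C_k_on_bounded_linear_compose[OF _ bounded_linear_minus[OF bounded_linear_ident]])

lemma C_k_on_diff:
  "open S \<Longrightarrow> C_k_on k S f \<Longrightarrow> C_k_on k S g \<Longrightarrow> C_k_on k S (\<lambda>x. f x - g x)"
  using C_k_on_add[OF _ _ C_k_on_minus, of S k f g] by simp

lemma C_k_on_sum:
  "open S \<Longrightarrow> (\<And>i. i \<in> I \<Longrightarrow> C_k_on k S (f i)) \<Longrightarrow> C_k_on k S (\<lambda>x. \<Sum>i\<in>I. f i x)"
  by (induction I rule: infinite_finite_induct) (auto intro: C_k_on_add C_k_on_const)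

lemma C_k_on_prod:
  fixes f :: "'i \<Rightarrow> 'a::euclidean_space \<Rightarrow> 'b::{real_normed_algebra,comm_ring_1}"
  shows "open S \<Longrightarrow> (\<And>i. i \<in> I \<Longrightarrow> C_k_on k S (f i)) \<Longrightarrow> C_k_on k S (\<lambda>x. \<Prod>i\<in>I. f i x)"
  by (induction I rule: infinite_finite_induct) (auto intro: C_k_on_mult C_k_on_const)

text \<open>The derivative is a polynomial in \<open>inverse f\<close> and the derivative of
  \<open>f\<close>, so regularity climbs one level at a time.\<close>

lemma C_k_on_inverse:
  fixes f :: "'a::euclidean_space \<Rightarrow> 'b::real_normed_field"
  assumes "open S" "\<And>x. x \<in> S \<Longrightarrow> f x \<noteq> 0" "C_k_on k S f"
  shows "C_k_on k S (\<lambda>x. inverse (f x))"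
  using assms(3)
proof (induction k)
  case 0
  then show ?case using assms(2) by (auto intro: continuous_on_inverse)
next
  case (Suc k)
  obtain f' where f': "\<And>x. x \<in> S \<Longrightarrow> (f has_derivative f' x) (at x)"
    "\<And>v. C_k_on k S (\<lambda>x. f' x v)" "C_k_on k S f" using C_k_on_SucE[OF Suc(2)] by metis
  have d: "((\<lambda>x. inverse (f x)) has_derivative (\<lambda>h. - (inverse (f x) * f' x h * inverse (f x)))) (at x)"
    if "x \<in> S" for x by (rule Deriv.has_derivative_inverse[OF assms(2)[OF that] f'(1)[OF that]])
  show ?case
    by (rule C_k_on_SucI[OF assms(1) d], assumption) (intro C_k_on_minus C_k_on_mult assms(1) Suc.IH f'(2,3))
qed

lemma C_k_on_exp:
  fixes f :: "'a::euclidean_space \<Rightarrow> real"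
  assumes "open S" "C_k_on k S f"
  shows "C_k_on k S (\<lambda>x. exp (f x))"
  using assms(2)
proof (induction k)
  case 0
  then show ?case by (auto intro: continuous_on_exp)
next
  case (Suc k)
  obtain f' where f': "\<And>x. x \<in> S \<Longrightarrow> (f has_derivative f' x) (at x)"
    "\<And>v. C_k_on k S (\<lambda>x. f' x v)" "C_k_on k S f" using C_k_on_SucE[OF Suc(2)] by metis
  have d: "((\<lambda>x. exp (f x)) has_derivative (\<lambda>h. exp (f x) * f' x h)) (at x)" if "x \<in> S" for x
    using f'(1)[OF that] by (auto intro!: derivative_eq_intros)
  show ?case
    by (rule C_k_on_SucI[OF assms(1) d], assumption) (intro C_k_on_mult assms(1) Suc.IH f'(2,3))
qed

text \<open>Serves to pull functions on the base back along \<open>fst\<close>.\<close>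

lemma C_k_on_compose_bounded_linear:
  assumes "open S" "bounded_linear L" "C_k_on k S f"
  shows "C_k_on k (L -` S) (\<lambda>x. f (L x))"
  using assms(3)
proof (induction k arbitrary: f)
  case 0
  then show ?case
    using continuous_on_compose2[of S f "L -` S" L] linear_continuous_on[OF assms(2)] by auto
next
  case (Suc k)
  obtain f' where f': "\<And>x. x \<in> S \<Longrightarrow> (f has_derivative f' x) (at x)"
    "\<And>v. C_k_on k S (\<lambda>x. f' x v)" using C_k_on_SucE[OF Suc(2)] by metis
  have o: "open (L -` S)"
    using continuous_open_vimage[OF assms(1), of L] assms(2) linear_continuous_at by blast
  have d: "((\<lambda>x. f (L x)) has_derivative (\<lambda>h. f' (L x) (L h))) (at x)" if "x \<in> L -` S" for x
    by (rule has_derivative_compose[OF bounded_linear_imp_has_derivative[OF assms(2)]])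
       (use f'(1) that in auto)
  show ?case by (rule C_k_on_SucI[OF o d Suc.IH[OF f'(2)]])
qed

section \<open>Vector- and matrix-valued functions\<close>

lemma norm_axis_vec: "norm (axis k c :: 'b::real_normed_vector^'n::finite) = norm c"
proof -
  have "norm (axis k c $ i :: 'b) = (if i = k then norm c else 0)" for i
    by (simp add: axis_def)
  then show ?thesis
    unfolding norm_vec_def L2_set_def by (simp add: if_distrib[of "\<lambda>x. x\<^sup>2"] cong: if_cong)
qed

lemma bounded_linear_axis: "bounded_linear (axis k :: 'b::real_normed_vector \<Rightarrow> 'b^'n::finite)"
  by (rule bounded_linear_intro[where K = 1])
     (simp_all add: norm_axis_vec, simp_all add: axis_def vec_eq_iff)

lemma sum_axis_eq: "(\<Sum>k\<in>UNIV. axis k (x $ k)) = (x :: 'b::ab_group_add^'n::finite)"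
  by (simp add: vec_eq_iff axis_def)

lemma C_k_on_vec:
  fixes f :: "'a::euclidean_space \<Rightarrow> 'b::real_normed_vector^'n::finite"
  assumes "open S" "\<And>i. C_k_on k S (\<lambda>x. f x $ i)" shows "C_k_on k S f"
proof -
  have "C_k_on k S (\<lambda>x. \<Sum>i\<in>UNIV. axis i (f x $ i))"
    by (intro C_k_on_sum assms(1) C_k_on_bounded_linear_compose[OF assms(1) bounded_linear_axis] assms(2))
  then show ?thesis by (simp add: sum_axis_eq)
qed

lemma has_derivative_vecI:
  fixes f :: "'a::real_normed_vector \<Rightarrow> 'b::real_normed_vector^'n::finite"
  assumes "\<And>i. ((\<lambda>x. f x $ i) has_derivative (\<lambda>v. f' v $ i)) F" shows "(f has_derivative f') F"
proof -
  have "((\<lambda>x. \<Sum>i\<in>UNIV. axis i (f x $ i)) has_derivative (\<lambda>v. \<Sum>i\<in>UNIV. axis i (f' v $ i))) F"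
    by (intro has_derivative_sum bounded_linear.has_derivative[OF bounded_linear_axis] assms)
  then show ?thesis by (simp add: sum_axis_eq)
qed

lemma has_derivative_vec_nth:
  fixes f :: "'a::real_normed_vector \<Rightarrow> 'b::real_normed_vector^'n::finite"
  shows "(f has_derivative f') F \<Longrightarrow> ((\<lambda>x. f x $ i) has_derivative (\<lambda>v. f' v $ i)) F"
  by (rule bounded_linear.has_derivative[OF bounded_linear_vec_nth])

lemma C_k_on_vec_nth:
  fixes f :: "'a::euclidean_space \<Rightarrow> 'b::real_normed_vector^'n::finite"
  shows "open S \<Longrightarrow> C_k_on k S f \<Longrightarrow> C_k_on k S (\<lambda>x. f x $ i)"
  by (rule C_k_on_bounded_linear_compose[OF _ bounded_linear_vec_nth])

lemma matrix_vector_mult_axis_nth: "(M *v axis j 1) $ i = (M $ i $ j :: complex)"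
  by (simp add: matrix_vector_mult_def axis_def if_distrib cong: if_cong)

text \<open>Later derivative formulas concern a matrix acting on a fixed vector; the columns
  \<open>M x *v axis j 1\<close> recover the entries.\<close>

lemma has_derivative_matrixI:
  fixes M :: "'a::real_normed_vector \<Rightarrow> complex^'n::finite^'m::finite"
  assumes "\<And>w. ((\<lambda>x. M x *v w) has_derivative (\<lambda>v. M' v *v w)) F"
  shows "(M has_derivative M') F"
proof (intro has_derivative_vecI)
  fix i j
  have "((\<lambda>x. (M x *v axis j 1) $ i) has_derivative (\<lambda>v. (M' v *v axis j 1) $ i)) F"
    by (rule has_derivative_vec_nth[OF assms])
  then show "((\<lambda>x. M x $ i $ j) has_derivative (\<lambda>v. M' v $ i $ j)) F"
    by (simp add: matrix_vector_mult_axis_nth)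
qed

lemma C_k_on_matrixI:
  fixes M :: "'a::euclidean_space \<Rightarrow> complex^'n::finite^'m::finite"
  assumes "open S" "\<And>w. C_k_on k S (\<lambda>x. M x *v w)" shows "C_k_on k S M"
proof (intro C_k_on_vec assms(1))
  fix i j
  have "C_k_on k S (\<lambda>x. (M x *v axis j 1) $ i)"
    by (intro C_k_on_vec_nth assms)
  then show "C_k_on k S (\<lambda>x. M x $ i $ j)"
    by (simp add: matrix_vector_mult_axis_nth)
qed

lemma C_k_on_matrix_mult:
  fixes M :: "'a::euclidean_space \<Rightarrow> complex^'n::finite^'m::finite"
    and N :: "'a::euclidean_space \<Rightarrow> complex^'l::finite^'n::finite"
  assumes "open S" "C_k_on k S M" "C_k_on k S N" shows "C_k_on k S (\<lambda>x. M x ** N x)"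
  by (intro C_k_on_vec assms(1)) (auto simp: matrix_matrix_mult_def intro!: C_k_on_sum C_k_on_mult C_k_on_vec_nth assms)

lemma C_k_on_det:
  fixes M :: "'a::euclidean_space \<Rightarrow> complex^'n::finite^'n"
  assumes "open S" "\<And>i j. C_k_on k S (\<lambda>x. M x $ i $ j)" shows "C_k_on k S (\<lambda>x. det (M x))"
  unfolding det_def by (intro C_k_on_sum C_k_on_mult C_k_on_prod C_k_on_const assms)

lemma matrix_inv:
  fixes A :: "complex^'n::finite^'n"
  assumes "det A \<noteq> 0"
  shows matrix_inv_right: "A ** matrix_inv A = mat 1" and matrix_inv_left: "matrix_inv A ** A = mat 1"
proof -
  have "\<exists>A'. A ** A' = mat 1 \<and> A' ** A = mat 1"
    using assms unfolding invertible_det_nz[symmetric] invertible_def .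
  from someI_ex[OF this] show "A ** matrix_inv A = mat 1" "matrix_inv A ** A = mat 1"
    by (auto simp: matrix_inv_def)
qed

text \<open>Cramer's rule, in the form that reduces smoothness of inversion to that of
  determinants.\<close>

lemma matrix_inv_nth:
  fixes A :: "complex^'n::finite^'n"
  assumes "det A \<noteq> 0"
  shows "matrix_inv A $ k $ l = det (\<chi> i j. if j = k then axis l 1 $ i else A $ i $ j) * inverse (det A)"
proof -
  have "A *v (matrix_inv A *v axis l 1) = axis l 1"
    using assms by (simp add: matrix_vector_mul_assoc matrix_inv_right)
  then have "matrix_inv A *v axis l 1 = (\<chi> k. det (\<chi> i j. if j = k then axis l 1 $ i else A $ i $ j) / det A)"
    using cramer[OF assms] by blast
  then have "(matrix_inv A *v axis l 1) $ k = det (\<chi> i j. if j = k then axis l 1 $ i else A $ i $ j) / det A"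
    by simp
  then show ?thesis by (simp add: matrix_vector_mult_axis_nth divide_inverse)
qed

lemma C_k_on_matrix_inv:
  fixes M :: "'a::euclidean_space \<Rightarrow> complex^'n::finite^'n"
  assumes "open S" "C_k_on k S M" "\<And>x. x \<in> S \<Longrightarrow> det (M x) \<noteq> 0"
  shows "C_k_on k S (\<lambda>x. matrix_inv (M x))"
proof (intro C_k_on_vec assms(1))
  fix i j
  have "C_k_on k S (\<lambda>x. det (\<chi> r s. if s = i then axis j (1::complex) $ r else M x $ r $ s) * inverse (det (M x)))"
  proof (intro C_k_on_mult C_k_on_inverse C_k_on_det assms(1,3))
    show "C_k_on k S (\<lambda>x. (\<chi> r s. if s = i then axis j (1::complex) $ r else M x $ r $ s) $ a $ b)" for a b
      by (cases "b = i") (auto intro!: C_k_on_const C_k_on_vec_nth assms)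
  qed (auto intro!: C_k_on_vec_nth assms)
  then show "C_k_on k S (\<lambda>x. matrix_inv (M x) $ i $ j)"
    by (rule C_k_on_cong[OF assms(1), rotated]) (simp add: matrix_inv_nth assms(3))
qed

section \<open>Algebra of matrix products, adjoints and the hermitian product\<close>

lemma bounded_bilinear_matrix_matrix_mult:
  "bounded_bilinear ((**) :: complex^'n::finite^'m::finite \<Rightarrow> complex^'l::finite^'n \<Rightarrow> complex^'l^'m)"
  unfolding bilinear_conv_bounded_bilinear[symmetric] bilinear_def
  by (auto intro!: linearI simp: vec_eq_iff matrix_matrix_mult_def scaleR_sum_right algebra_simps sum.distrib)

lemma bounded_bilinear_matrix_vector_mult:
  "bounded_bilinear ((*v) :: complex^'n::finite^'m::finite \<Rightarrow> complex^'n \<Rightarrow> complex^'m)"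
  unfolding bilinear_conv_bounded_bilinear[symmetric] bilinear_def
  by (auto intro!: linearI simp: vec_eq_iff matrix_vector_mult_def scaleR_sum_right algebra_simps sum.distrib)

lemma bounded_linear_cadjoint:
  "bounded_linear (cadjoint :: complex^'n::finite^'m::finite \<Rightarrow> _)"
  unfolding linear_conv_bounded_linear[symmetric]
  by (auto intro!: linearI simp: vec_eq_iff cadjoint_def)

lemma minus_matrix_vector_mult: "(- A) *v x = - (A *v (x :: 'a::ring_1^'n))"
  by (simp add: vec_eq_iff matrix_vector_mult_def sum_negf)

lemma matrix_vector_mult_minus: "A *v (- x) = - (A *v (x :: 'a::ring_1^'n))"
  by (simp add: vec_eq_iff matrix_vector_mult_def sum_negf)

lemma mat_vector_mult: "mat c *v x = c *s (x :: 'a::semiring_1^'n)"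
  by (simp add: vec_eq_iff matrix_vector_mult_def mat_def if_distrib[of "\<lambda>c. c * _"] cong: if_cong)

lemma outer_vector_mult: "outer a b *v x = cdot b x *s a"
  by (simp add: vec_eq_iff matrix_vector_mult_def outer_def cdot_def sum_distrib_left sum_distrib_right mult_ac)

lemma cdot_add_left: "cdot (a + b) c = cdot a c + cdot b c"
  and cdot_add_right: "cdot a (b + c) = cdot a b + cdot a c"
  and cdot_diff_left: "cdot (a - b) c = cdot a c - cdot b c"
  and cdot_diff_right: "cdot a (b - c) = cdot a b - cdot a c"
  and cdot_scale_left: "cdot (k *s a) c = cnj k * cdot a c"
  and cdot_scale_right: "cdot a (k *s c) = k * cdot a c"
  and cdot_scaleR_left: "cdot (r *\<^sub>R a) c = r *\<^sub>R cdot a c"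
  and cdot_scaleR_right: "cdot a (r *\<^sub>R c) = r *\<^sub>R cdot a c"
  by (simp_all add: cdot_def sum.distrib sum_subtractf algebra_simps sum_distrib_left scaleR_sum_right)

lemma cdot_cnj: "cnj (cdot a b) = cdot b a"
  by (simp add: cdot_def mult.commute)

lemma inner_eq_Re_cdot: "inner a b = Re (cdot a b)"
  by (simp add: cdot_def inner_vec_def inner_complex_def)

lemma cdot_cadjoint: "cdot (M *v a) b = cdot a (cadjoint M *v b)"
proof -
  have "cdot (M *v a) b = (\<Sum>i\<in>UNIV. \<Sum>j\<in>UNIV. cnj (M $ i $ j) * cnj (a $ j) * b $ i)"
    by (simp add: cdot_def matrix_vector_mult_def sum_distrib_right)
  also have "\<dots> = (\<Sum>j\<in>UNIV. \<Sum>i\<in>UNIV. cnj (M $ i $ j) * cnj (a $ j) * b $ i)"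
    by (rule sum.swap)
  also have "\<dots> = cdot a (cadjoint M *v b)"
    by (simp add: cdot_def matrix_vector_mult_def cadjoint_def sum_distrib_left mult_ac)
  finally show ?thesis .
qed

lemma cadjoint_cadjoint [simp]: "cadjoint (cadjoint A) = A"
  by (simp add: cadjoint_def vec_eq_iff)

lemma eqI_Re_cdot:
  assumes "\<And>v. Re (cdot v a) = Re (cdot v b)" shows "a = b"
proof -
  have "inner (a - b) (a - b) = 0"
    using assms[of "a - b"] by (simp add: inner_eq_Re_cdot cdot_diff_right)
  then show ?thesis by simp
qed

lemmas matrix_vector_simps = matrix_vector_mul_assoc[symmetric] matrix_vector_mult_add_rdistrib
  matrix_vector_mult_diff_rdistrib matrix_vector_mult_diff_distrib matrix_vector_right_distrib
  minus_matrix_vector_mult matrix_vector_mult_minus mat_vector_mult outer_vector_mult vector_scalar_commute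

text \<open>Cramer's rule only provides some derivative \<open>D\<close>; its formula comes from
  differentiating \<open>matrix_inv B ** B\<close>, which is constant on the open set of invertible
  matrices.\<close>

lemma has_derivative_matrix_inv:
  fixes A :: "complex^'n::finite^'n"
  assumes "det A \<noteq> 0"
  shows "(matrix_inv has_derivative (\<lambda>B. - (matrix_inv A ** B ** matrix_inv A))) (at A)"
proof -
  define S where "S = {A :: complex^'n^'n. det A \<noteq> 0}"
  have cdet: "continuous_on UNIV (det :: complex^'n^'n \<Rightarrow> complex)"
    unfolding C_k_on.simps(1)[symmetric]
    by (intro C_k_on_det C_k_on_vec_nth C_k_on_bounded_linear bounded_linear_ident open_UNIV)
  then have "open S"
    using open_Collect_neq[of det "\<lambda>_. 0"] by (auto simp: S_def)
  have "C_k_on (Suc 0) S matrix_inv"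
    by (rule C_k_on_matrix_inv[OF \<open>open S\<close> C_k_on_bounded_linear[OF \<open>open S\<close> bounded_linear_ident]])
       (simp add: S_def)
  then obtain D where D: "(matrix_inv has_derivative D) (at A)"
    using assms by (auto simp: S_def frechet_derivative_works)
  have "((\<lambda>B. matrix_inv B ** B) has_derivative (\<lambda>B. matrix_inv A ** B + D B ** A)) (at A)"
    by (rule bounded_bilinear.FDERIV[OF bounded_bilinear_matrix_matrix_mult D has_derivative_ident])
  moreover have "((\<lambda>B. matrix_inv B ** B) has_derivative (\<lambda>B. 0)) (at A)"
    by (rule has_derivative_transform_within_open[OF has_derivative_const[of "mat 1"] \<open>open S\<close>])
       (use assms in \<open>auto simp: S_def matrix_inv_left\<close>)
  ultimately have "(\<lambda>B. matrix_inv A ** B + D B ** A) = (\<lambda>B. 0)"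
    by (rule has_derivative_unique)
  then have "matrix_inv A ** B + D B ** A = 0" for B
    by (rule fun_cong)
  then have "(matrix_inv A ** B + D B ** A) ** matrix_inv A = 0" for B by simp
  moreover have "(matrix_inv A ** B + D B ** A) ** matrix_inv A = matrix_inv A ** B ** matrix_inv A + D B" for B
    using matrix_inv_right[OF assms]
    by (simp add: bounded_bilinear.add_left[OF bounded_bilinear_matrix_matrix_mult] flip: matrix_mul_assoc)
  ultimately have "matrix_inv A ** B ** matrix_inv A + D B = 0" for B by simp
  then have "D B = - (matrix_inv A ** B ** matrix_inv A)" for B
    using add.inverse_unique[of "matrix_inv A ** B ** matrix_inv A" "D B"] by simp
  then have "D = (\<lambda>B. - (matrix_inv A ** B ** matrix_inv A))" by (rule ext)
  then show ?thesis using D by (simp only:)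
qed

section \<open>From the base to the unitary coframe bundle\<close>

lemma inv_vector:
  fixes A :: "complex^'n::finite^'n"
  assumes "det A \<noteq> 0"
  shows "matrix_inv A *v (A *v x) = x" "A *v (matrix_inv A *v x) = x"
  by (simp_all add: matrix_vector_mul_assoc matrix_inv_left matrix_inv_right assms)

text \<open>Every vector is of the form \<open>A *v y\<close>, and testing on such vectors lets the
  factors \<open>matrix_inv A\<close> of the structure functions cancel.\<close>

lemma matrix_eqI_frame:
  fixes A :: "complex^'n::finite^'n"
  assumes "det A \<noteq> 0" "\<And>y. M *v (A *v y) = M' *v (A *v y)" shows "M = M'"
  unfolding matrix_eq using assms(2)[of "matrix_inv A *v y" for y] inv_vector(2)[OF assms(1)] by simp

lemma has_derivative_fst_at: "((\<lambda>u. fst u) has_derivative fst) F"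
  and has_derivative_snd_at: "((\<lambda>u. snd u) has_derivative snd) F"
  by (auto intro!: derivative_eq_intros)

lemma deriv_fst_compose:
  assumes "(f has_derivative D) (at (fst u))"
  shows "((\<lambda>z. f (fst z)) has_derivative (\<lambda>v. D (fst v))) (at u)"
  by (rule has_derivative_compose[OF has_derivative_fst_at assms])

lemma deriv_inv_snd:
  fixes u :: "'b::real_normed_vector \<times> (complex^'n::finite^'n)"
  assumes "det (snd u) \<noteq> 0"
  shows "((\<lambda>z. matrix_inv (snd z)) has_derivative
      (\<lambda>v. - (matrix_inv (snd u) ** snd v ** matrix_inv (snd u)))) (at u)"
  by (rule has_derivative_compose[OF has_derivative_snd_at has_derivative_matrix_inv[OF assms]])

lemmas deriv_mm = bounded_bilinear.FDERIV[OF bounded_bilinear_matrix_matrix_mult]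

text \<open>The structure equations written on the base: \<open>h\<close> is the hermitian metric, \<open>\<theta>\<close> its Chern connection with
  derivative \<open>\<theta>'\<close>, and the structure functions of a coframe \<open>A\<close> are \<open>A H A\<^sup>-\<^sup>1\<close>, \<open>A T\<close> and \<open>V\<close>.\<close>

locale bochner_kaehler_base =
  fixes U :: "(complex^'n::finite) set" and h :: "complex^'n \<Rightarrow> complex^'n^'n"
    and \<theta> :: "complex^'n \<Rightarrow> complex^'n \<Rightarrow> complex^'n^'n"
    and \<theta>' :: "complex^'n \<Rightarrow> complex^'n \<Rightarrow> complex^'n \<Rightarrow> complex^'n^'n"
    and H :: "complex^'n \<Rightarrow> complex^'n^'n" and T :: "complex^'n \<Rightarrow> complex^'n" and V :: "complex^'n \<Rightarrow> real"
  assumes open_U: "open U"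
    and hermitian: "\<And>x v w. x \<in> U \<Longrightarrow> cnj (cdot v (h x *v w)) = cdot w (h x *v v)"
    and positive: "\<And>x v. x \<in> U \<Longrightarrow> v \<noteq> 0 \<Longrightarrow> Re (cdot v (h x *v v)) > 0"
    and smooth_h: "\<And>v w. smooth_on U (\<lambda>x. cdot v (h x *v w))"
    and smooth_\<theta>: "\<And>v w. smooth_on U (\<lambda>x. \<theta> x v *v w)"
    and linear_\<theta>: "\<And>x. x \<in> U \<Longrightarrow> linear (\<theta> x)"
    and torsion_free: "\<And>x v w. x \<in> U \<Longrightarrow> \<theta> x v *v w = \<theta> x w *v v"
    and deriv_h: "\<And>x u w. x \<in> U \<Longrightarrow> ((\<lambda>y. cdot u (h y *v w)) has_derivative
        (\<lambda>v. cdot u (h x *v (\<theta> x v *v w)) + cnj (cdot w (h x *v (\<theta> x v *v u))))) (at x)"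
    and deriv_\<theta>: "\<And>x v w. x \<in> U \<Longrightarrow> ((\<lambda>y. \<theta> y v *v w) has_derivative (\<lambda>u. \<theta>' x u v *v w)) (at x)"
    and curvature: "\<And>x u v w. x \<in> U \<Longrightarrow>
        \<theta>' x u v *v w - \<theta>' x v u *v w + \<theta> x u *v (\<theta> x v *v w) - \<theta> x v *v (\<theta> x u *v w) =
          (cdot u (h x *v v) - cdot v (h x *v u)) *s (H x *v w)
          - (cdot v (h x *v w) *s (H x *v u) - cdot u (h x *v w) *s (H x *v v))
          - (cdot v (h x *v (H x *v w)) *s u - cdot u (h x *v (H x *v w)) *s v)
          + (cdot u (h x *v (H x *v v)) - cdot v (h x *v (H x *v u))) *s w
          + trace (H x) *s ((cdot u (h x *v v) - cdot v (h x *v u)) *s w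
              - (cdot v (h x *v w) *s u - cdot u (h x *v w) *s v))"
    and hermitian_H: "\<And>x v w. x \<in> U \<Longrightarrow> cdot (H x *v v) (h x *v w) = cdot v (h x *v (H x *v w))"
    and deriv_H: "\<And>x w. x \<in> U \<Longrightarrow> ((\<lambda>y. H y *v w) has_derivative
        (\<lambda>v. H x *v (\<theta> x v *v w) - \<theta> x v *v (H x *v w)
          + cdot v (h x *v w) *s T x + cdot (T x) (h x *v w) *s v)) (at x)"
    and deriv_T: "\<And>x. x \<in> U \<Longrightarrow> (T has_derivative
        (\<lambda>v. H x *v (H x *v v) + trace (H x) *s (H x *v v) + of_real (V x) *s v - \<theta> x v *v T x)) (at x)"
    and deriv_V: "\<And>x. x \<in> U \<Longrightarrow> ((\<lambda>y. complex_of_real (V y)) has_derivative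
        (\<lambda>v. trace (H x) * (cdot (T x) (h x *v v) + cdot v (h x *v T x))
          + (cdot (T x) (h x *v (H x *v v)) + cdot v (h x *v (H x *v T x))))) (at x)"
begin

definition g :: "'n metric" where "g x v w = Re (cdot v (h x *v w))"

lemma cadjoint_h: assumes "x \<in> U" shows "cadjoint (h x) = h x"
proof -
  have "cadjoint (h x) *v w = h x *v w" for w
  proof (rule eqI_Re_cdot)
    fix v
    have "cdot v (cadjoint (h x) *v w) = cnj (cdot w (h x *v v))"
      unfolding cdot_cadjoint[symmetric] by (rule cdot_cnj[symmetric])
    then show "Re (cdot v (cadjoint (h x) *v w)) = Re (cdot v (h x *v w))"
      by (simp only: hermitian[OF assms])
  qed
  then show ?thesis by (simp add: matrix_eq)
qed

lemma smooth_\<theta>': "smooth_on U (\<lambda>x. \<theta> x v)"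
  using smooth_\<theta> by (auto simp: smooth_on_def intro: C_k_on_matrixI open_U)

text \<open>\<open>deriv_h\<close> as the matrix equation
  \<open>dh = h \<theta> + \<theta>\<^sup>* h\<close>, the form in which it is compared with the
  derivative of \<open>cadjoint A ** A\<close>.\<close>

lemma deriv_h':
  assumes "x \<in> U"
  shows "(h has_derivative (\<lambda>v. h x ** \<theta> x v + cadjoint (\<theta> x v) ** h x)) (at x)"
proof (intro has_derivative_matrixI has_derivative_vecI)
  fix w i
  have *: "cdot (axis i 1) y = y $ i" for y :: "complex^'n"
    by (simp add: cdot_def axis_def if_distrib[of "\<lambda>c. c * _"] if_distrib[of cnj] cong: if_cong)
  have "((h x ** \<theta> x v + cadjoint (\<theta> x v) ** h x) *v w) $ i =
      cdot (axis i 1) (h x *v (\<theta> x v *v w)) + cnj (cdot w (h x *v (\<theta> x v *v axis i 1)))" for v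
  proof -
    have "cnj (cdot w (h x *v (\<theta> x v *v axis i 1))) = cdot (\<theta> x v *v axis i 1) (h x *v w)"
      by (rule hermitian[OF assms])
    also have "\<dots> = (cadjoint (\<theta> x v) *v (h x *v w)) $ i"
      by (simp add: cdot_cadjoint *)
    finally show ?thesis by (simp add: * matrix_vector_simps)
  qed
  then show "((\<lambda>y. (h y *v w) $ i) has_derivative
      (\<lambda>v. ((h x ** \<theta> x v + cadjoint (\<theta> x v) ** h x) *v w) $ i)) (at x)"
    using deriv_h[OF assms, of "axis i 1" w] by (simp add: *)
qed

lemma deriv_g:
  assumes "x \<in> U"
  shows "frechet_derivative (\<lambda>y. kaehler_form g y b c) (at x) a =
    Im (cdot b (h x *v (\<theta> x a *v c))) - Im (cdot c (h x *v (\<theta> x a *v b)))"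
proof -
  \<comment> \<open>Moving \<open>\<i>\<close> out of the conjugate-linear slot gives the factor
    \<open>- \<i>\<close>, and \<open>Re (- \<i> * z) = Im z\<close>.\<close>
  have "kaehler_form g y b c = Im (cdot b (h y *v c))" for y
    by (simp add: kaehler_form_def g_def cdot_scale_left)
  moreover have "((\<lambda>y. Im (cdot b (h y *v c))) has_derivative
      (\<lambda>a. Im (cdot b (h x *v (\<theta> x a *v c)) + cnj (cdot c (h x *v (\<theta> x a *v b)))))) (at x)"
    by (rule bounded_linear.has_derivative[OF bounded_linear_Im deriv_h[OF assms]])
  note frechet_derivative_at[OF this, symmetric]
  ultimately show ?thesis by simp
qed

lemma kaehler: "kaehler_metric_on U g"
  unfolding kaehler_metric_on_def
proof (intro conjI allI ballI impI open_U)
  show "smooth_on U (\<lambda>x. g x v w)" for v w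
    using smooth_h[of v w] unfolding smooth_on_def g_def
    by (auto intro: C_k_on_bounded_linear_compose[OF open_U bounded_linear_Re])
  fix x assume x: "x \<in> U"
  show "bilinear (g x)"
    unfolding bilinear_def g_def
    by (auto intro!: linearI simp: cdot_add_left cdot_add_right matrix_vector_simps cdot_scaleR_left cdot_scaleR_right
      bounded_bilinear.scaleR_right[OF bounded_bilinear_matrix_vector_mult])
  show "g x v w = g x w v" for v w
    unfolding g_def using arg_cong[OF hermitian[OF x, of v w], of Re] by simp
  show "g x v v > 0" if "v \<noteq> 0" for v
    using positive[OF x that] by (simp add: g_def)
  show "g x (\<i> *s v) (\<i> *s w) = g x v w" for v w
    by (simp add: g_def cdot_scale_left cdot_scale_right vector_scalar_commute)
  show "frechet_derivative (\<lambda>y. kaehler_form g y b c) (at x) a +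
        frechet_derivative (\<lambda>y. kaehler_form g y c a) (at x) b +
        frechet_derivative (\<lambda>y. kaehler_form g y a b) (at x) c = 0" for a b c
    \<comment> \<open>Closedness: the cyclic sum has six terms, which cancel in pairs because
      \<theta> is torsion free.\<close>
    unfolding deriv_g[OF x]
    unfolding torsion_free[OF x, of b a] torsion_free[OF x, of c a] torsion_free[OF x, of c b] by linarith
qed

definition P where "P = unitary_coframes U g"

text \<open>Real parts determine a hermitian product once one argument is arbitrary, so being an
  isometry of the real metric is a matrix equation.\<close>

lemma P_iff: "(x, A) \<in> P \<longleftrightarrow> x \<in> U \<and> cadjoint A ** A = h x"
proof -
  have "(\<forall>v w. inner (A *v v) (A *v w) = g x v w) \<longleftrightarrow> cadjoint A ** A = h x"
  proof
    assume *: "\<forall>v w. inner (A *v v) (A *v w) = g x v w"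
    have "(cadjoint A ** A) *v w = h x *v w" for w
      by (rule eqI_Re_cdot) (use * in \<open>simp add: inner_eq_Re_cdot g_def cdot_cadjoint matrix_vector_simps\<close>)
    then show "cadjoint A ** A = h x" by (simp add: matrix_eq)
  next
    assume "cadjoint A ** A = h x"
    then show "\<forall>v w. inner (A *v v) (A *v w) = g x v w"
      by (simp add: inner_eq_Re_cdot g_def cdot_cadjoint matrix_vector_mul_assoc)
  qed
  then show ?thesis by (auto simp: P_def unitary_coframes_def)
qed

lemma P_cdot: "(x, A) \<in> P \<Longrightarrow> cdot (A *v v) (A *v w) = cdot v (h x *v w)"
  by (simp add: P_iff cdot_cadjoint matrix_vector_mul_assoc)

text \<open>A kernel vector \<open>v\<close> of \<open>A\<close> would satisfy
  \<open>cdot v (h x *v v) = 0\<close>, against positivity.\<close>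

lemma P_det: assumes "(x, A) \<in> P" shows "det A \<noteq> 0"
proof
  assume "det A = 0"
  then have "\<not> inj ((*v) A)"
    using det_nz_iff_inj_gen[of "(*v) A"] by (simp add: matrix_vector_mul_linear_gen)
  then obtain v w where "A *v v = A *v w" "v \<noteq> w"
    by (auto simp: inj_def)
  then obtain v where v: "A *v v = 0" "v \<noteq> 0"
    using that[of "v - w"] by (simp add: matrix_vector_mult_diff_distrib)
  then have "cdot v (h x *v v) = 0"
    using P_cdot[OF assms, of v v] by (simp add: cdot_def)
  then show False using positive[of x v] v assms by (simp add: P_iff)
qed

text \<open>Both sides are the velocity of \<open>h\<close> along a curve in \<open>P\<close>,
  computed once from \<open>cadjoint A ** A = h x\<close> and once from
  \<open>deriv_h'\<close>.\<close>

lemma P_tangent: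
  assumes "(x, A) \<in> P" "(v, B) \<in> tangent_space P (x, A)"
  shows "cadjoint B ** A + cadjoint A ** B = h x ** \<theta> x v + cadjoint (\<theta> x v) ** h x"
proof -
  obtain c where c: "\<And>t. c t \<in> P" "c 0 = (x, A)" "(c has_vector_derivative (v, B)) (at 0)"
    using assms(2) by (auto simp: tangent_space_def)
  have x: "x \<in> U" using assms by (simp add: P_iff)
  have d: "((\<lambda>t. fst (c t)) has_derivative (\<lambda>s. s *\<^sub>R v)) (at 0)"
    "((\<lambda>t. snd (c t)) has_derivative (\<lambda>s. s *\<^sub>R B)) (at 0)"
    using bounded_linear.has_derivative[OF bounded_linear_fst c(3)[unfolded has_vector_derivative_def]]
      bounded_linear.has_derivative[OF bounded_linear_snd c(3)[unfolded has_vector_derivative_def]] by simp_all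
  have "(h has_derivative (\<lambda>v. h x ** \<theta> x v + cadjoint (\<theta> x v) ** h x)) (at (fst (c 0)))"
    using deriv_h'[OF x] c(2) by simp
  from has_derivative_compose[OF d(1) this]
  have 1: "((\<lambda>t. h (fst (c t))) has_derivative
      (\<lambda>s. h x ** \<theta> x (s *\<^sub>R v) + cadjoint (\<theta> x (s *\<^sub>R v)) ** h x)) (at 0)" .
  have eq: "h (fst (c t)) = cadjoint (snd (c t)) ** snd (c t)" for t
    using c(1)[of t] P_iff[of "fst (c t)" "snd (c t)"] by simp
  have 2: "((\<lambda>t. h (fst (c t))) has_derivative
      (\<lambda>s. cadjoint (snd (c 0)) ** (s *\<^sub>R B) + cadjoint (s *\<^sub>R B) ** snd (c 0))) (at 0)"
    unfolding eq
    by (rule bounded_bilinear.FDERIV[OF bounded_bilinear_matrix_matrix_mult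
          bounded_linear.has_derivative[OF bounded_linear_cadjoint d(2)] d(2)])
  from fun_cong[OF has_derivative_unique[OF 1 2], of 1] show ?thesis by (simp add: c(2) add.commute)
qed

text \<open>The gauge transform \<open>A \<theta> A\<^sup>-\<^sup>1 - dA A\<^sup>-\<^sup>1\<close>
  of the base connection. As the coframe form is \<open>A dx\<close>, torsion freeness gives
  \<open>d\<omega> = - \<phi> \<and> \<omega>\<close>.\<close>

definition \<phi> :: "(complex^'n) \<times> (complex^'n^'n) \<Rightarrow> (complex^'n) \<times> (complex^'n^'n) \<Rightarrow> complex^'n^'n" where
  "\<phi> u v = snd u ** \<theta> (fst u) (fst v) ** matrix_inv (snd u) - snd v ** matrix_inv (snd u)"

definition H\<^sub>P :: "(complex^'n) \<times> (complex^'n^'n) \<Rightarrow> complex^'n^'n" where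
  "H\<^sub>P u = snd u ** H (fst u) ** matrix_inv (snd u)"

definition T\<^sub>P :: "(complex^'n) \<times> (complex^'n^'n) \<Rightarrow> complex^'n" where
  "T\<^sub>P u = snd u *v T (fst u)"

text \<open>An open neighbourhood of \<open>P\<close> in the ambient space on which the formula for
  \<open>\<phi>\<close> is smooth, so that \<open>\<phi>\<close> is its own local extension.\<close>

definition N :: "((complex^'n) \<times> (complex^'n^'n)) set" where
  "N = {u. fst u \<in> U \<and> det (snd u) \<noteq> 0}"

lemma P_subset_N: "P \<subseteq> N"
  using P_det by (auto simp: N_def P_iff)

lemma open_N: "open N"
proof -
  have "continuous_on UNIV (\<lambda>u :: (complex^'n) \<times> (complex^'n^'n). det (snd u))"
    unfolding C_k_on.simps(1)[symmetric]
    by (intro C_k_on_det C_k_on_vec_nth C_k_on_bounded_linear bounded_linear_snd open_UNIV)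
  then have "open {u :: (complex^'n) \<times> (complex^'n^'n). det (snd u) \<noteq> 0}"
    using open_Collect_neq[of "\<lambda>u. det (snd u)" "\<lambda>_. 0"] by auto
  moreover have "open (fst -` U)"
    using open_U by (rule open_vimage_fst)
  ultimately have "open (fst -` U \<inter> {u :: (complex^'n) \<times> (complex^'n^'n). det (snd u) \<noteq> 0})"
    by blast
  then show ?thesis by (simp add: N_def vimage_def Collect_conj_eq)
qed

lemma local_extension_\<phi>: "local_extension P \<phi> N \<phi>"
  unfolding local_extension_def
proof (intro conjI ballI allI open_N)
  fix y assume "y \<in> N"
  then have "linear (\<theta> (fst y))" using linear_\<theta> by (simp add: N_def)
  then show "linear (\<phi> y)"
    by (auto intro!: linearI simp: \<phi>_def linear_add linear_cmul
      bounded_bilinear.add_left[OF bounded_bilinear_matrix_matrix_mult] bounded_bilinear.add_right[OF bounded_bilinear_matrix_matrix_mult]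
      bounded_bilinear.scaleR_left[OF bounded_bilinear_matrix_matrix_mult] bounded_bilinear.scaleR_right[OF bounded_bilinear_matrix_matrix_mult]
      scaleR_diff_right)
next
  fix v :: "(complex^'n) \<times> (complex^'n^'n)"
  have "C_k_on k N (\<lambda>u. \<theta> (fst u) (fst v))" for k
  proof -
    have "C_k_on k (fst -` U) (\<lambda>u :: (complex^'n) \<times> (complex^'n^'n). \<theta> (fst u) (fst v))"
      by (rule C_k_on_compose_bounded_linear[OF open_U bounded_linear_fst])
         (use smooth_\<theta>' in \<open>simp add: smooth_on_def\<close>)
    then show ?thesis by (rule C_k_on_subset) (auto simp: N_def)
  qed
  moreover have "C_k_on k N (\<lambda>u. snd u)" for k
    by (intro C_k_on_bounded_linear bounded_linear_snd open_N)
  moreover from this have "C_k_on k N (\<lambda>u. matrix_inv (snd u))" for k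
    by (rule C_k_on_matrix_inv[OF open_N]) (auto simp: N_def)
  ultimately show "smooth_on N (\<lambda>y. \<phi> y v)"
    unfolding smooth_on_def \<phi>_def
    by (intro allI C_k_on_diff[OF open_N] C_k_on_matrix_mult[OF open_N] C_k_on_const)
qed simp

text \<open>Pairing the matrix equation \<open>P_tangent\<close> with \<open>z'\<close> and
  \<open>y'\<close> is skewness tested on \<open>A *v z'\<close> and \<open>A *v y'\<close>.\<close>

lemma skew_\<phi>:
  assumes "u \<in> P" "v \<in> tangent_space P u"
  shows "cadjoint (\<phi> u v) = - \<phi> u v"
proof -
  obtain x A w B where u: "u = (x, A)" and v: "v = (w, B)" by (metis prod.exhaust)
  have det: "det A \<noteq> 0" using P_det assms(1) by (simp add: u)
  have tan: "cadjoint B ** A + cadjoint A ** B = h x ** \<theta> x w + cadjoint (\<theta> x w) ** h x"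
    using P_tangent assms by (simp add: u v)
  have h: "h x = cadjoint A ** A" using assms(1) by (simp add: u P_iff)
  have "cdot z (cadjoint (\<phi> u v) *v y) = cdot z (- \<phi> u v *v y)" for y z
  proof -
    define y' z' where "y' = matrix_inv A *v y" and "z' = matrix_inv A *v z"
    have y: "y = A *v y'" "z = A *v z'" by (simp_all add: y'_def z'_def inv_vector det)
    have "cdot z' ((cadjoint B ** A + cadjoint A ** B) *v y') =
        cdot z' ((h x ** \<theta> x w + cadjoint (\<theta> x w) ** h x) *v y')" by (simp only: tan)
    then have "cdot (B *v z') (A *v y') + cdot (A *v z') (B *v y') =
        cdot (A *v z') (A *v (\<theta> x w *v y')) + cdot (A *v (\<theta> x w *v z')) (A *v y')"
      by (simp add: matrix_vector_simps cdot_add_right cdot_cadjoint h)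
    then show ?thesis
      unfolding cdot_cadjoint[symmetric] y
      by (simp add: \<phi>_def u v matrix_vector_simps inv_vector det cdot_diff_left cdot_diff_right algebra_simps)
  qed
  then have "cadjoint (\<phi> u v) *v y = - \<phi> u v *v y" for y
    by (intro eqI_Re_cdot) simp
  then show ?thesis by (simp add: matrix_eq)
qed

lemma ext_deriv_\<omega>:
  "has_ext_deriv_on coframe_form (\<lambda>u v w. - wedge (*v) (\<phi> u) (coframe_form u) v w) P"
  unfolding has_ext_deriv_on_def
proof (intro ballI exI conjI)
  show "local_extension P coframe_form UNIV coframe_form"
    unfolding local_extension_def smooth_on_def
  proof (intro conjI allI ballI open_UNIV)
    show "linear (coframe_form y)" for y
      by (auto intro!: linearI simp: coframe_form_def matrix_vector_right_distrib
        bounded_bilinear.scaleR_right[OF bounded_bilinear_matrix_vector_mult])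
    show "C_k_on k UNIV (\<lambda>y. coframe_form y v)" for k v
      unfolding coframe_form_def
      by (intro C_k_on_bounded_linear open_UNIV bounded_linear_compose[OF
            bounded_bilinear.bounded_linear_left[OF bounded_bilinear_matrix_vector_mult] bounded_linear_snd])
  qed simp
  fix u v w assume "u \<in> P \<inter> UNIV"
  then obtain x A where u: "u = (x, A)" "(x, A) \<in> P" by (cases u) auto
  have x: "x \<in> U" using u by (simp add: P_iff)
  \<comment> \<open>For a fixed direction \<open>w\<close> the form is linear in the point, so it is
    its own derivative.\<close>
  have fr: "frechet_derivative (\<lambda>z. coframe_form z w) (at u) = (\<lambda>v. snd v *v fst w)" for w u
  proof -
    have "bounded_linear (\<lambda>z. coframe_form z w)"
      unfolding coframe_form_def
      by (rule bounded_linear_compose[OF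
            bounded_bilinear.bounded_linear_left[OF bounded_bilinear_matrix_vector_mult] bounded_linear_snd])
    from frechet_derivative_at[OF bounded_linear_imp_has_derivative[OF this]]
    show ?thesis by (simp add: coframe_form_def)
  qed
  show "ext_deriv1 coframe_form u v w = - wedge (*v) (\<phi> u) (coframe_form u) v w"
    unfolding ext_deriv1_def fr using torsion_free[OF x, of "fst v" "fst w"]
    by (simp add: wedge_def coframe_form_def \<phi>_def u(1) matrix_vector_simps inv_vector P_det[OF u(2)])
qed simp

text \<open>The direction \<open>(w, C)\<close> is held constant, as in \<open>ext_deriv1\<close>;
  applying the result to \<open>A *v y\<close> removes the outer inverses.\<close>

lemma frechet_\<phi>:
  assumes "(x, A) \<in> P"
  shows "frechet_derivative (\<lambda>z. \<phi> z (w, C)) (at (x, A)) (v, B) *v (A *v y) =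
    B *v (\<theta> x w *v y) + A *v (\<theta>' x v w *v y)
    - A *v (\<theta> x w *v (matrix_inv A *v (B *v y))) + C *v (matrix_inv A *v (B *v y))"
proof -
  have x: "x \<in> U" using assms by (simp add: P_iff)
  have det: "det A \<noteq> 0" by (rule P_det[OF assms])
  have d\<theta>: "((\<lambda>x. \<theta> x w) has_derivative (\<lambda>v. \<theta>' x v w)) (at (fst (x, A)))"
    by (rule has_derivative_matrixI) (simp add: deriv_\<theta>[OF x])
  have "det (snd (x, A)) \<noteq> 0" using det by simp
  note dA = deriv_inv_snd[OF this]
  note D = has_derivative_diff[OF deriv_mm[OF deriv_mm[OF has_derivative_snd_at deriv_fst_compose[OF d\<theta>]] dA]
    deriv_mm[OF has_derivative_const[of C] dA]]
  then have "((\<lambda>z. \<phi> z (w, C)) has_derivative (\<lambda>v. A ** \<theta> x w ** - (matrix_inv A ** snd v ** matrix_inv A) +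
       (A ** \<theta>' x (fst v) w + snd v ** \<theta> x w) ** matrix_inv A -
       (C ** - (matrix_inv A ** snd v ** matrix_inv A) + 0 ** matrix_inv A))) (at (x, A))"
    unfolding \<phi>_def by simp
  from frechet_derivative_at[OF this, symmetric] show ?thesis
    by (simp add: matrix_vector_simps inv_vector det)
qed

lemma trace_H\<^sub>P:
  assumes "(x, A) \<in> P" shows "trace (H\<^sub>P (x, A)) = trace (H x)"
  using trace_mul_sym[of "A ** H x" "matrix_inv A"] matrix_inv_left[OF P_det[OF assms]]
  by (simp add: H\<^sub>P_def matrix_mul_assoc)

lemma ext_deriv_\<phi>:
  "has_ext_deriv_on \<phi>
          (\<lambda>u v w. - wedge (**) (\<phi> u) (\<phi> u) v w
             + mat (wedge cdot (coframe_form u) (coframe_form u) v w) ** H\<^sub>P u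
             - H\<^sub>P u ** wedge outer (coframe_form u) (coframe_form u) v w
             - wedge outer (coframe_form u) (coframe_form u) v w ** H\<^sub>P u
             + mat (wedge cdot (coframe_form u) (\<lambda>y. H\<^sub>P u *v coframe_form u y) v w)
             + mat (trace (H\<^sub>P u)) **
                 (mat (wedge cdot (coframe_form u) (coframe_form u) v w)
                   - wedge outer (coframe_form u) (coframe_form u) v w)) P"
  unfolding has_ext_deriv_on_def
proof (intro ballI exI conjI)
  show "local_extension P \<phi> N \<phi>" by (rule local_extension_\<phi>)
  show "u \<in> P \<Longrightarrow> u \<in> N" for u using P_subset_N by blast
  fix u v w :: "(complex^'n) \<times> (complex^'n^'n)" assume "u \<in> P \<inter> N"
  then obtain x A where u: "u = (x, A)" "(x, A) \<in> P" by (cases u) auto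
  obtain v1 B w1 C where v: "v = (v1, B)" and w: "w = (w1, C)" by (metis prod.exhaust)
  have x: "x \<in> U" using u by (simp add: P_iff)
  have det: "det A \<noteq> 0" by (rule P_det[OF u(2)])
  note tr = trace_H\<^sub>P[OF u(2)]
  have "ext_deriv1 \<phi> u v w *v (A *v y) = (- wedge (**) (\<phi> u) (\<phi> u) v w
             + mat (wedge cdot (coframe_form u) (coframe_form u) v w) ** H\<^sub>P u
             - H\<^sub>P u ** wedge outer (coframe_form u) (coframe_form u) v w
             - wedge outer (coframe_form u) (coframe_form u) v w ** H\<^sub>P u
             + mat (wedge cdot (coframe_form u) (\<lambda>y. H\<^sub>P u *v coframe_form u y) v w)
             + mat (trace (H\<^sub>P u)) **
                 (mat (wedge cdot (coframe_form u) (coframe_form u) v w)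
                   - wedge outer (coframe_form u) (coframe_form u) v w)) *v (A *v y)" for y
  proof -
    \<comment> \<open>The base curvature identity, pushed forward by \<open>A\<close>. The terms in
      \<open>B\<close> and \<open>C\<close> cancel between \<open>d\<phi>\<close> and
      \<open>\<phi> \<and> \<phi>\<close>, as curvature is gauge covariant.\<close>
    note c = arg_cong[OF curvature[OF x, of v1 w1 y], of "(*v) A"]
    show ?thesis
      unfolding ext_deriv1_def u(1) tr v w matrix_vector_mult_diff_rdistrib frechet_\<phi>[OF u(2)] using c
      by (simp add: wedge_def coframe_form_def \<phi>_def H\<^sub>P_def
        matrix_vector_simps inv_vector det P_cdot[OF u(2)] vec.scale_right_diff_distrib vec.scale_left_diff_distrib
        algebra_simps)
  qed
  then show "ext_deriv1 \<phi> u v w = (- wedge (**) (\<phi> u) (\<phi> u) v w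
             + mat (wedge cdot (coframe_form u) (coframe_form u) v w) ** H\<^sub>P u
             - H\<^sub>P u ** wedge outer (coframe_form u) (coframe_form u) v w
             - wedge outer (coframe_form u) (coframe_form u) v w ** H\<^sub>P u
             + mat (wedge cdot (coframe_form u) (\<lambda>y. H\<^sub>P u *v coframe_form u y) v w)
             + mat (trace (H\<^sub>P u)) **
                 (mat (wedge cdot (coframe_form u) (coframe_form u) v w)
                   - wedge outer (coframe_form u) (coframe_form u) v w))"
    by (rule matrix_eqI_frame[OF det])
qed

text \<open>A derivative in the ambient space restricts to one within \<open>P\<close>; the
  equations for \<open>H\<close>, \<open>T\<close> and \<open>V\<close> are proved in all ambient
  directions.\<close>

lemma differential_onI:
  assumes "\<And>x A. (x, A) \<in> P \<Longrightarrow> (f has_derivative D x A) (at (x, A))"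
    and "\<And>x A v B. (x, A) \<in> P \<Longrightarrow> D x A (v, B) = \<alpha> (x, A) (v, B)"
  shows "has_differential_on f \<alpha> P"
  unfolding has_differential_on_def
proof
  fix u assume "u \<in> P"
  then obtain x A where u: "u = (x, A)" "(x, A) \<in> P" by (cases u) auto
  have "\<forall>v\<in>tangent_space P u. D x A v = \<alpha> u v"
    using assms(2)[OF u(2)] u(1) by auto
  then show "\<exists>D. (f has_derivative D) (at u within P) \<and> (\<forall>v\<in>tangent_space P u. D v = \<alpha> u v)"
    using has_derivative_at_withinI[OF assms(1)[OF u(2)], of P] u(1) by blast
qed

lemma differential_H:
  "has_differential_on H\<^sub>P
          (\<lambda>u v. - \<phi> u v ** H\<^sub>P u + H\<^sub>P u ** \<phi> u v + outer (T\<^sub>P u) (coframe_form u v)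
            + outer (coframe_form u v) (T\<^sub>P u)) P"
proof (rule differential_onI)
  fix x A assume P: "(x, A) \<in> P"
  have x: "x \<in> U" using P by (simp add: P_iff)
  have det: "det A \<noteq> 0" by (rule P_det[OF P])
  \<comment> \<open>\<open>deriv_H\<close> as a matrix: hermitian symmetry of \<open>h x\<close>
    turns \<open>cdot v (h x *v w) *s T x\<close> into
    \<open>outer (T x) (h x *v v) *v w\<close>.\<close>
  define D where "D v = H x ** \<theta> x v - \<theta> x v ** H x + outer (T x) (h x *v v) + outer v (h x *v T x)" for v
  have "(H has_derivative D) (at (fst (x, A)))"
  proof (rule has_derivative_matrixI)
    fix w
    have "D v *v w = H x *v (\<theta> x v *v w) - \<theta> x v *v (H x *v w)
          + cdot v (h x *v w) *s T x + cdot (T x) (h x *v w) *s v" for v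
      using cadjoint_h[OF x] by (simp add: D_def matrix_vector_simps cdot_cadjoint)
    then show "((\<lambda>y. H y *v w) has_derivative (\<lambda>v. D v *v w)) (at (fst (x, A)))"
      using deriv_H[OF x, of w] by simp
  qed
  note dH = deriv_fst_compose[OF this]
  have "det (snd (x, A)) \<noteq> 0" using det by simp
  note dA = deriv_inv_snd[OF this]
  show "(H\<^sub>P has_derivative (\<lambda>v. A ** H x ** - (matrix_inv A ** snd v ** matrix_inv A) +
       (A ** D (fst v) + snd v ** H x) ** matrix_inv A)) (at (x, A))"
    using deriv_mm[OF deriv_mm[OF has_derivative_snd_at dH] dA] unfolding H\<^sub>P_def by simp
  fix v B
  show "(\<lambda>v. A ** H x ** - (matrix_inv A ** snd v ** matrix_inv A) +
       (A ** D (fst v) + snd v ** H x) ** matrix_inv A) (v, B) =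
    - \<phi> (x, A) (v, B) ** H\<^sub>P (x, A) + H\<^sub>P (x, A) ** \<phi> (x, A) (v, B)
       + outer (T\<^sub>P (x, A)) (coframe_form (x, A) (v, B)) + outer (coframe_form (x, A) (v, B)) (T\<^sub>P (x, A))"
    using cadjoint_h[OF x]
    by (intro matrix_eqI_frame[OF det])
       (simp add: D_def coframe_form_def \<phi>_def H\<^sub>P_def T\<^sub>P_def matrix_vector_simps inv_vector det P_cdot[OF P]
          cdot_cadjoint[of "h x"] algebra_simps)
qed

lemma differential_T:
  "has_differential_on T\<^sub>P
          (\<lambda>u v. - \<phi> u v *v T\<^sub>P u
             + (H\<^sub>P u ** H\<^sub>P u + mat (trace (H\<^sub>P u)) ** H\<^sub>P u + mat (complex_of_real (V (fst u)))) *v coframe_form u v) P"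
proof (rule differential_onI)
  fix x A assume P: "(x, A) \<in> P"
  have x: "x \<in> U" using P by (simp add: P_iff)
  have det: "det A \<noteq> 0" by (rule P_det[OF P])
  note tr = trace_H\<^sub>P[OF P]
  have "(T has_derivative (\<lambda>v. H x *v (H x *v v) + trace (H x) *s (H x *v v) + of_real (V x) *s v - \<theta> x v *v T x))
      (at (fst (x, A)))" using deriv_T[OF x] by simp
  note dT = deriv_fst_compose[OF this]
  show "(T\<^sub>P has_derivative (\<lambda>v. A *v (H x *v (H x *v fst v) + trace (H x) *s (H x *v fst v)
        + of_real (V x) *s fst v - \<theta> x (fst v) *v T x) + snd v *v T x)) (at (x, A))"
    using bounded_bilinear.FDERIV[OF bounded_bilinear_matrix_vector_mult has_derivative_snd_at dT]
    unfolding T\<^sub>P_def by simp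
  fix v B
  show "(\<lambda>v. A *v (H x *v (H x *v fst v) + trace (H x) *s (H x *v fst v)
        + of_real (V x) *s fst v - \<theta> x (fst v) *v T x) + snd v *v T x) (v, B) =
     - \<phi> (x, A) (v, B) *v T\<^sub>P (x, A)
             + (H\<^sub>P (x, A) ** H\<^sub>P (x, A) + mat (trace (H\<^sub>P (x, A))) ** H\<^sub>P (x, A)
               + mat (complex_of_real (V (fst (x, A))))) *v coframe_form (x, A) (v, B)"
    unfolding tr
    by (simp add: coframe_form_def \<phi>_def H\<^sub>P_def T\<^sub>P_def matrix_vector_simps inv_vector det)
qed

lemma differential_V:
  "has_differential_on (\<lambda>u. complex_of_real (V (fst u)))
          (\<lambda>u v. trace (H\<^sub>P u) * (cdot (T\<^sub>P u) (coframe_form u v) + cdot (coframe_form u v) (T\<^sub>P u))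
             + (cdot (T\<^sub>P u) (H\<^sub>P u *v coframe_form u v) + cdot (coframe_form u v) (H\<^sub>P u *v T\<^sub>P u))) P"
proof (rule differential_onI)
  fix x A assume P: "(x, A) \<in> P"
  have x: "x \<in> U" using P by (simp add: P_iff)
  have det: "det A \<noteq> 0" by (rule P_det[OF P])
  note tr = trace_H\<^sub>P[OF P]
  have "((\<lambda>y. complex_of_real (V y)) has_derivative
        (\<lambda>v. trace (H x) * (cdot (T x) (h x *v v) + cdot v (h x *v T x))
          + (cdot (T x) (h x *v (H x *v v)) + cdot v (h x *v (H x *v T x))))) (at (fst (x, A)))"
    using deriv_V[OF x] by simp
  from deriv_fst_compose[OF this]
  show "((\<lambda>u. complex_of_real (V (fst u))) has_derivative
        (\<lambda>v. trace (H x) * (cdot (T x) (h x *v fst v) + cdot (fst v) (h x *v T x))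
          + (cdot (T x) (h x *v (H x *v fst v)) + cdot (fst v) (h x *v (H x *v T x))))) (at (x, A))" .
  fix v B
  show "(\<lambda>v. trace (H x) * (cdot (T x) (h x *v fst v) + cdot (fst v) (h x *v T x))
          + (cdot (T x) (h x *v (H x *v fst v)) + cdot (fst v) (h x *v (H x *v T x)))) (v, B) =
     trace (H\<^sub>P (x, A)) * (cdot (T\<^sub>P (x, A)) (coframe_form (x, A) (v, B)) + cdot (coframe_form (x, A) (v, B)) (T\<^sub>P (x, A)))
             + (cdot (T\<^sub>P (x, A)) (H\<^sub>P (x, A) *v coframe_form (x, A) (v, B))
             + cdot (coframe_form (x, A) (v, B)) (H\<^sub>P (x, A) *v T\<^sub>P (x, A)))"
    unfolding tr
    by (simp add: coframe_form_def H\<^sub>P_def T\<^sub>P_def matrix_vector_simps inv_vector det P_cdot[OF P])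
qed

lemma hermitian_H\<^sub>P: assumes "u \<in> P" shows "cadjoint (H\<^sub>P u) = H\<^sub>P u"
proof -
  obtain x A where u: "u = (x, A)" by (cases u)
  have x: "x \<in> U" using assms by (simp add: u P_iff)
  have det: "det A \<noteq> 0" using P_det assms by (simp add: u)
  have "cdot z (cadjoint (H\<^sub>P u) *v y) = cdot z (H\<^sub>P u *v y)" for y z
  proof -
    define y' z' where "y' = matrix_inv A *v y" and "z' = matrix_inv A *v z"
    have y: "y = A *v y'" "z = A *v z'" by (simp_all add: y'_def z'_def inv_vector det)
    show ?thesis
      unfolding cdot_cadjoint[symmetric] y using assms
      by (simp add: H\<^sub>P_def u matrix_vector_simps inv_vector det P_cdot hermitian_H[OF x])
  qed
  then have "cadjoint (H\<^sub>P u) *v y = H\<^sub>P u *v y" for y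
    by (intro eqI_Re_cdot) simp
  then show ?thesis by (simp add: matrix_eq)
qed

theorem bochner_kaehler: "bochner_kaehler_on U g"
  unfolding bochner_kaehler_on_def Let_def P_def[symmetric]
proof (intro conjI kaehler exI[of _ \<phi>] exI[of _ H\<^sub>P] exI[of _ T\<^sub>P] exI[of _ "\<lambda>u. V (fst u)"] ballI)
  show "one_form_on P \<phi>"
    unfolding one_form_on_def
  proof (intro ballI exI conjI)
    show "u \<in> N" if "u \<in> P" for u using P_subset_N that by blast
  qed (rule local_extension_\<phi>)
qed (assumption | rule skew_\<phi> ext_deriv_\<omega> ext_deriv_\<phi> differential_H differential_T differential_V hermitian_H\<^sub>P)+

end

section \<open>The logarithmic radius\<close>

definition weight_sum :: "('m::finite \<Rightarrow> nat) \<Rightarrow> complex^'m \<Rightarrow> real \<Rightarrow> real" where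
  "weight_sum p Z t = (\<Sum>j\<in>UNIV. exp (- 2 * real (p j) * t) * (cmod (Z $ j))\<^sup>2)"

definition log_radius :: "('m::finite \<Rightarrow> nat) \<Rightarrow> complex^'m \<Rightarrow> real" where
  "log_radius p Z = (THE t. weight_sum p Z t = 1)"

text \<open>With \<open>E = e^(-t P)\<close>, where \<open>t\<close> is the logarithmic radius of
  \<open>Z\<close>, this is \<open>(E X)\<^sup>* P\<^sup>k (E Y)\<close>.\<close>

definition weighted_form :: "('m::finite \<Rightarrow> nat) \<Rightarrow> nat \<Rightarrow> complex^'m \<Rightarrow> complex^'m \<Rightarrow> complex^'m \<Rightarrow> complex" where
  "weighted_form p k Z X Y =
     (\<Sum>j\<in>UNIV. of_nat (p j) ^ k * of_real (exp (- 2 * real (p j) * log_radius p Z)) * (cnj (X $ j) * Y $ j))"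

lemma cnj_mult_self: "cnj z * z = (complex_of_real (cmod z))\<^sup>2"
  by (simp add: complex_norm_square mult.commute flip: of_real_power)

lemma continuous_weight_sum: "continuous_on A (weight_sum p Z)"
  unfolding weight_sum_def by (intro continuous_intros)

context
  fixes p :: "'m::finite \<Rightarrow> nat"
  assumes pos: "\<And>i. p i > 0"
begin

lemma weight_sum_strict_decreasing:
  assumes "Z \<noteq> 0" "s < t" shows "weight_sum p Z t < weight_sum p Z s"
  unfolding weight_sum_def
proof (rule sum_strict_mono_ex1)
  obtain j where j: "Z $ j \<noteq> 0" using assms(1) by (auto simp: vec_eq_iff)
  have e: "exp (- 2 * real (p j) * t) < exp (- 2 * real (p j) * s)" for j
    using pos[of j] assms(2) by simp
  show "\<forall>j\<in>UNIV. exp (- 2 * real (p j) * t) * (cmod (Z $ j))\<^sup>2 \<le> exp (- 2 * real (p j) * s) * (cmod (Z $ j))\<^sup>2"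
    using e less_imp_le by (intro ballI mult_right_mono) auto
  show "\<exists>j\<in>UNIV. exp (- 2 * real (p j) * t) * (cmod (Z $ j))\<^sup>2 < exp (- 2 * real (p j) * s) * (cmod (Z $ j))\<^sup>2"
    using e j by (intro bexI[of _ j] mult_strict_right_mono) auto
qed simp

lemma weight_sum_inj: "Z \<noteq> 0 \<Longrightarrow> weight_sum p Z s = weight_sum p Z t \<Longrightarrow> s = t"
  using weight_sum_strict_decreasing[of Z s t] weight_sum_strict_decreasing[of Z t s]
  by (cases s t rule: linorder_cases) auto

lemma weight_sum_log_radius:
  assumes "Z \<noteq> 0" shows "weight_sum p Z (log_radius p Z) = 1"
proof -
  obtain j where j: "Z $ j \<noteq> 0" using assms by (auto simp: vec_eq_iff)
  define r where "r = (cmod (Z $ j))\<^sup>2"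
  have r: "r > 0" using j by (simp add: r_def)
  \<comment> \<open>At \<open>t = - 1 / r\<close> a single coordinate suffices: its term is at least
    \<open>r + 2 * p j\<close>, and \<open>p j\<close> is a positive integer.\<close>
  have lo: "1 \<le> weight_sum p Z (- (1 / r))"
  proof -
    have "(1 + 2 * real (p j) * (1 / r)) * r = r + 2 * p j" using r by (simp add: field_simps)
    moreover have "1 \<le> r + 2 * p j" using r pos[of j] by linarith
    ultimately have "1 \<le> (1 + 2 * real (p j) * (1 / r)) * r" by simp
    also have "\<dots> \<le> exp (2 * real (p j) * (1 / r)) * r"
      using r by (intro mult_right_mono exp_ge_add_one_self) auto
    also have "\<dots> = exp (- 2 * real (p j) * (- (1 / r))) * (cmod (Z $ j))\<^sup>2" by (simp add: r_def)
    also have "\<dots> \<le> weight_sum p Z (- (1 / r))"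
      unfolding weight_sum_def by (rule member_le_sum) auto
    finally show ?thesis .
  qed
  define s where "s = (\<Sum>j\<in>UNIV. (cmod (Z $ j))\<^sup>2)"
  have s: "s \<ge> 0" by (auto simp: s_def intro: sum_nonneg)
  \<comment> \<open>At \<open>t = s\<close>, the squared norm of \<open>Z\<close>, every exponential
    is at most \<open>exp (- s)\<close>, and \<open>exp (- s) * s \<le> 1\<close>.\<close>
  have hi: "weight_sum p Z s \<le> 1"
  proof -
    have "weight_sum p Z s \<le> (\<Sum>j\<in>UNIV. exp (- s) * (cmod (Z $ j))\<^sup>2)"
      unfolding weight_sum_def
    proof (intro sum_mono mult_right_mono)
      fix j
      have "1 * s \<le> 2 * real (p j) * s" using s pos[of j] by (intro mult_right_mono) auto
      then show "exp (- 2 * real (p j) * s) \<le> exp (- s)" by simp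
    qed auto
    also have "\<dots> = exp (- s) * s" by (simp add: s_def sum_distrib_left)
    also have "\<dots> = s / exp s" by (simp add: exp_minus field_simps)
    also have "\<dots> \<le> 1" using exp_ge_add_one_self[of s] by (simp add: divide_le_eq_1 del: exp_ge_add_one_self)
    finally show ?thesis .
  qed
  have "\<exists>t. - (1 / r) \<le> t \<and> t \<le> s \<and> weight_sum p Z t = 1"
    using hi lo continuous_weight_sum r s
    by (intro IVT2') (auto intro: order_trans[of _ 0])
  then have "\<exists>!t. weight_sum p Z t = 1" using weight_sum_inj[OF assms] by (metis)
  then show ?thesis unfolding log_radius_def by (rule theI')
qed

lemma log_radius_unique: "Z \<noteq> 0 \<Longrightarrow> weight_sum p Z t = 1 \<Longrightarrow> log_radius p Z = t"
  using weight_sum_inj weight_sum_log_radius by metis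

lemma weighted_form_1_self: "Z \<noteq> 0 \<Longrightarrow> \<exists>r>0. weighted_form p 1 Z Z Z = of_real r"
proof -
  assume "Z \<noteq> 0"
  then obtain j where j: "Z $ j \<noteq> 0" by (auto simp: vec_eq_iff)
  let ?r = "\<Sum>j\<in>UNIV. p j * exp (- 2 * real (p j) * log_radius p Z) * (cmod (Z $ j))\<^sup>2"
  have "weighted_form p 1 Z Z Z = of_real ?r"
    unfolding weighted_form_def of_real_sum
    by (rule sum.cong) (simp_all add: cnj_mult_self del: of_real_exp)
  moreover have "?r > 0"
    using pos[of j] j by (intro sum_pos2[of UNIV j]) auto
  ultimately show ?thesis by blast
qed

lemma weighted_form_1_nonzero: "Z \<noteq> 0 \<Longrightarrow> weighted_form p 1 Z Z Z \<noteq> 0"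
  using weighted_form_1_self[of Z] by auto

text \<open>The radius is defined implicitly, so the inverse function theorem is applied to
  \<open>f (Z, t) = (Z, weight_sum p Z t)\<close>, whose left inverse \<open>g\<close> satisfies
  \<open>snd (g (W, 1)) = log_radius p W\<close>.\<close>

lemma has_derivative_log_radius:
  assumes "Z \<noteq> 0"
  shows "(log_radius p has_derivative (\<lambda>X. Re (weighted_form p 0 Z Z X / weighted_form p 1 Z Z Z))) (at Z)"
proof -
  define t0 where "t0 = log_radius p Z"
  define e where "e j = exp (- 2 * real (p j) * t0)" for j
  define s1 where "s1 = (\<Sum>j\<in>UNIV. real (p j) * e j * (cmod (Z $ j))\<^sup>2)"
  define f where "f = (\<lambda>(Z, t). (Z, weight_sum p Z t))"
  define g where "g = (\<lambda>(Z, y). (Z, THE t. weight_sum p Z t = y))"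
  define f' where "f' = (\<lambda>(X :: complex^'m, s :: real). (X, 2 * (\<Sum>j\<in>UNIV. e j * Re (cnj (Z $ j) * X $ j)) - 2 * s * s1))"
  \<comment> \<open>Obtained by solving \<open>f' (X, s) = (X, y)\<close> for \<open>s\<close>; the
    partial derivative of \<open>weight_sum\<close> in \<open>t\<close> is
    \<open>- 2 * s1\<close>.\<close>
  define g' where "g' = (\<lambda>(X :: complex^'m, y :: real). (X, (2 * (\<Sum>j\<in>UNIV. e j * Re (cnj (Z $ j) * X $ j)) - y) / (2 * s1)))"
  define S where "S = (- {0 :: complex^'m}) \<times> (UNIV :: real set)"
  have s1: "weighted_form p 1 Z Z Z = of_real s1"
    unfolding weighted_form_def s1_def of_real_sum e_def t0_def
    by (rule sum.cong) (simp_all add: cnj_mult_self del: of_real_exp)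
  have s1_nz: "s1 \<noteq> 0" using weighted_form_1_nonzero[OF assms] s1 by auto
  have ws: "weight_sum p Z t = (\<Sum>j\<in>UNIV. exp (- 2 * real (p j) * t) * ((Re (Z $ j))\<^sup>2 + (Im (Z $ j))\<^sup>2))" for Z t
    by (simp add: weight_sum_def cmod_power2)
  have "(g has_derivative g') (at (f (Z, t0)))"
  proof (rule has_derivative_inverse_strong[where S = S and f' = f' and f = f and x = "(Z, t0)"])
    show "open S" unfolding S_def by (intro open_Times) auto
    show "(Z, t0) \<in> S" using assms by (simp add: S_def)
    have "continuous_on UNIV (\<lambda>u. weight_sum p (fst u) (snd u))"
      unfolding weight_sum_def by (intro continuous_intros)
    then show "continuous_on S f"
      unfolding f_def case_prod_unfold
      by (intro continuous_on_Pair continuous_on_fst continuous_on_id)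
        (rule continuous_on_subset, auto)
    show "g (f u) = u" if "u \<in> S" for u
    proof (cases u)
      case (Pair W t)
      then have "W \<noteq> 0" using that by (simp add: S_def)
      then have "(THE t'. weight_sum p W t' = weight_sum p W t) = t"
        using weight_sum_inj by blast
      then show ?thesis by (simp add: g_def f_def Pair)
    qed
    have d: "((\<lambda>u. fst u $ j) has_derivative (\<lambda>u. fst u $ j)) (at u0)"
      for j and u0 :: "(complex^'m) \<times> real"
      by (intro bounded_linear_imp_has_derivative bounded_linear_compose[OF bounded_linear_vec_nth] bounded_linear_fst)
    have "((\<lambda>u. weight_sum p (fst u) (snd u)) has_derivative
        (\<lambda>u. \<Sum>j\<in>UNIV. e j * (2 * Re (Z $ j) * Re (fst u $ j) + 2 * Im (Z $ j) * Im (fst u $ j))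
            + e j * (- 2 * real (p j) * snd u) * ((Re (Z $ j))\<^sup>2 + (Im (Z $ j))\<^sup>2))) (at (Z, t0))"
      unfolding ws
      by (rule has_derivative_sum)
         (auto intro!: derivative_eq_intros d simp: e_def algebra_simps)
    then have "((\<lambda>u. weight_sum p (fst u) (snd u)) has_derivative (\<lambda>u. snd (f' u))) (at (Z, t0))"
      by (rule has_derivative_eq_rhs)
         (auto simp: f'_def s1_def fun_eq_iff sum_distrib_left sum_subtractf[symmetric] cmod_power2 algebra_simps
            intro!: sum.cong)
    from has_derivative_Pair[OF has_derivative_fst[OF has_derivative_ident] this]
    show "(f has_derivative f') (at (Z, t0))"
      by (simp add: f_def f'_def case_prod_unfold)
    show "f' \<circ> g' = id"
      using s1_nz by (auto simp: f'_def g'_def fun_eq_iff field_simps)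
  qed
  moreover have f0: "f (Z, t0) = (Z, 1)"
    using weight_sum_log_radius[OF assms] by (simp add: f_def t0_def)
  moreover have "((\<lambda>W. (W, 1::real)) has_derivative (\<lambda>X. (X, 0))) (at Z)"
    by (auto intro!: derivative_eq_intros)
  ultimately have "((\<lambda>W. snd (g (W, 1))) has_derivative (\<lambda>X. snd (g' (X, 0)))) (at Z)"
    using has_derivative_compose[of "\<lambda>W. (W, 1::real)" "\<lambda>X. (X, 0)" Z UNIV g g'] has_derivative_snd by fastforce
  moreover have "snd (g (W, 1)) = log_radius p W" for W by (simp add: g_def log_radius_def)
  moreover have "snd (g' (X, 0)) = Re (weighted_form p 0 Z Z X / weighted_form p 1 Z Z Z)" for X
    unfolding s1 by (simp add: g'_def weighted_form_def e_def t0_def sum_distrib_left[symmetric] mult.left_commute[of _ 2] del: of_real_exp)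
  ultimately show ?thesis by simp
qed


end

section \<open>Algebra and derivatives of the weighted hermitian forms\<close>

lemma weighted_form_add_left: "weighted_form p k Z (X + X') Y = weighted_form p k Z X Y + weighted_form p k Z X' Y"
  and weighted_form_add_right: "weighted_form p k Z X (Y + Y') = weighted_form p k Z X Y + weighted_form p k Z X Y'"
  and weighted_form_diff_left: "weighted_form p k Z (X - X') Y = weighted_form p k Z X Y - weighted_form p k Z X' Y"
  and weighted_form_diff_right: "weighted_form p k Z X (Y - Y') = weighted_form p k Z X Y - weighted_form p k Z X Y'"
  and weighted_form_scale_left: "weighted_form p k Z (c *s X) Y = cnj c * weighted_form p k Z X Y"
  and weighted_form_scale_right: "weighted_form p k Z X (c *s Y) = c * weighted_form p k Z X Y"
  by (simp_all add: weighted_form_def algebra_simps sum.distrib sum_subtractf sum_distrib_left)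

lemma cnj_weighted_form: "cnj (weighted_form p k Z X Y) = weighted_form p k Z Y X"
  by (simp add: weighted_form_def mult_ac)

definition weight_mult :: "('m::finite \<Rightarrow> nat) \<Rightarrow> complex^'m \<Rightarrow> complex^'m" where
  "weight_mult p X = (\<chi> j. of_nat (p j) * X $ j)"

lemma weighted_form_weight_mult:
  "weighted_form p k Z X (weight_mult p Y) = weighted_form p (Suc k) Z X Y"
  "weighted_form p k Z (weight_mult p X) Y = weighted_form p (Suc k) Z X Y"
  by (simp_all add: weighted_form_def weight_mult_def mult_ac)

text \<open>Normalising by \<open>W\<^sup>* P W\<close> makes the derivatives of these forms polynomial in them.\<close>

definition reeb_form :: "('m::finite \<Rightarrow> nat) \<Rightarrow> nat \<Rightarrow> complex^'m \<Rightarrow> complex^'m \<Rightarrow> complex^'m \<Rightarrow> complex" where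
  "reeb_form p k Z X Y = weighted_form p k Z X Y / weighted_form p 1 Z Z Z"

lemma reeb_form_add_left: "reeb_form p k Z (X + X') Y = reeb_form p k Z X Y + reeb_form p k Z X' Y"
  and reeb_form_add_right: "reeb_form p k Z X (Y + Y') = reeb_form p k Z X Y + reeb_form p k Z X Y'"
  and reeb_form_diff_left: "reeb_form p k Z (X - X') Y = reeb_form p k Z X Y - reeb_form p k Z X' Y"
  and reeb_form_diff_right: "reeb_form p k Z X (Y - Y') = reeb_form p k Z X Y - reeb_form p k Z X Y'"
  and reeb_form_scale_left: "reeb_form p k Z (c *s X) Y = cnj c * reeb_form p k Z X Y"
  and reeb_form_scale_right: "reeb_form p k Z X (c *s Y) = c * reeb_form p k Z X Y"
  and reeb_form_weight_mult_right: "reeb_form p k Z X (weight_mult p Y) = reeb_form p (Suc k) Z X Y"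
  and reeb_form_weight_mult_left: "reeb_form p k Z (weight_mult p X) Y = reeb_form p (Suc k) Z X Y"
  by (simp_all add: reeb_form_def weighted_form_add_left weighted_form_add_right weighted_form_diff_left
    weighted_form_diff_right weighted_form_scale_left weighted_form_scale_right weighted_form_weight_mult
    add_divide_distrib diff_divide_distrib)

lemma reeb_form_zero [simp]: "reeb_form p k Z 0 Y = 0" "reeb_form p k Z X 0 = 0"
  by (simp_all add: reeb_form_def weighted_form_def)

text \<open>\<open>reeb_b\<close> plus its conjugate is the logarithmic derivative of the
  normalising factor \<open>weighted_form p 1 Z Z Z\<close>; hence it enters the derivative of every
  \<open>reeb_form\<close>.\<close>

definition reeb_b :: "('m::finite \<Rightarrow> nat) \<Rightarrow> complex^'m \<Rightarrow> complex^'m \<Rightarrow> complex" where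
  "reeb_b p Z X = reeb_form p 1 Z Z X - reeb_form p 2 Z Z Z * reeb_form p 0 Z Z X"

lemma cnj_reeb_form: "cnj (reeb_form p k Z X Y) = reeb_form p k Z Y X"
  by (simp add: reeb_form_def cnj_weighted_form)

context
  fixes p :: "'m::finite \<Rightarrow> nat"
  assumes pos: "\<And>i. p i > 0"
begin

lemma reeb_form_1_self: "Z \<noteq> 0 \<Longrightarrow> reeb_form p 1 Z Z Z = 1"
  using weighted_form_1_nonzero[OF pos] by (simp add: reeb_form_def)

lemma has_derivative_log_radius_compose:
  assumes "(Z has_derivative Z') (at x)" "Z x \<noteq> 0"
  shows "((\<lambda>x. log_radius p (Z x)) has_derivative (\<lambda>v. Re (reeb_form p 0 (Z x) (Z x) (Z' v)))) (at x)"
  using has_derivative_compose[OF assms(1) has_derivative_log_radius[OF pos assms(2)]]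
  by (simp add: reeb_form_def)

text \<open>Beyond the product rule, the exponentials contribute \<open>- 2 p\<^sub>j dt\<close>.
  Here \<open>2 dt = a + cnj a\<close>, and the factor \<open>p\<^sub>j\<close> raises the index
  \<open>k\<close> by one.\<close>

lemma has_derivative_weighted_form:
  assumes Z: "(Z has_derivative Z') (at x)" "Z x \<noteq> 0"
    and X: "(X has_derivative X') (at x)" and Y: "(Y has_derivative Y') (at x)"
  shows "((\<lambda>x. weighted_form p k (Z x) (X x) (Y x)) has_derivative
    (\<lambda>v. weighted_form p k (Z x) (X' v) (Y x) + weighted_form p k (Z x) (X x) (Y' v)
      - (reeb_form p 0 (Z x) (Z x) (Z' v) + cnj (reeb_form p 0 (Z x) (Z x) (Z' v)))
          * weighted_form p (Suc k) (Z x) (X x) (Y x))) (at x)"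
proof -
  define L where "L v = Re (reeb_form p 0 (Z x) (Z x) (Z' v))" for v
  have L: "((\<lambda>x. log_radius p (Z x)) has_derivative L) (at x)"
    using has_derivative_log_radius_compose[OF Z] by (simp add: L_def[abs_def])
  have e: "((\<lambda>x. of_real (exp (- 2 * real (p j) * log_radius p (Z x))) :: complex) has_derivative
      (\<lambda>v. of_real (exp (- 2 * real (p j) * log_radius p (Z x)) * (- 2 * real (p j) * L v)))) (at x)" for j
    by (rule bounded_linear.has_derivative[OF bounded_linear_of_real]) (auto intro!: derivative_eq_intros L)
  have X: "((\<lambda>x. cnj (X x $ j)) has_derivative (\<lambda>v. cnj (X' v $ j))) (at x)" for j
    by (rule bounded_linear.has_derivative[OF bounded_linear_cnj has_derivative_vec_nth[OF X]])
  note Y = has_derivative_vec_nth[OF Y]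
  have "((\<lambda>x. weighted_form p k (Z x) (X x) (Y x)) has_derivative
    (\<lambda>v. \<Sum>j\<in>UNIV. of_nat (p j) ^ k * of_real (exp (- 2 * real (p j) * log_radius p (Z x)))
        * (cnj (X x $ j) * Y' v $ j + cnj (X' v $ j) * Y x $ j)
       + of_nat (p j) ^ k * of_real (exp (- 2 * real (p j) * log_radius p (Z x)) * (- 2 * real (p j) * L v))
        * (cnj (X x $ j) * Y x $ j))) (at x)"
    unfolding weighted_form_def
    by (intro has_derivative_sum has_derivative_mult has_derivative_mult_right e X Y)
  then show ?thesis
  proof (rule has_derivative_eq_rhs, intro ext)
    fix v
    have "reeb_form p 0 (Z x) (Z x) (Z' v) + cnj (reeb_form p 0 (Z x) (Z x) (Z' v)) = of_real (2 * L v)"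
      by (simp add: L_def complex_add_cnj)
    then show "(\<Sum>j\<in>UNIV. of_nat (p j) ^ k * of_real (exp (- 2 * real (p j) * log_radius p (Z x)))
        * (cnj (X x $ j) * Y' v $ j + cnj (X' v $ j) * Y x $ j)
       + of_nat (p j) ^ k * of_real (exp (- 2 * real (p j) * log_radius p (Z x)) * (- 2 * real (p j) * L v))
        * (cnj (X x $ j) * Y x $ j)) = weighted_form p k (Z x) (X' v) (Y x) + weighted_form p k (Z x) (X x) (Y' v)
      - (reeb_form p 0 (Z x) (Z x) (Z' v) + cnj (reeb_form p 0 (Z x) (Z x) (Z' v)))
          * weighted_form p (Suc k) (Z x) (X x) (Y x)"
      by (simp only: weighted_form_def sum.distrib[symmetric] sum_subtractf[symmetric] sum_distrib_left)
         (intro sum.cong refl, simp add: algebra_simps del: of_real_exp)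
  qed
qed

lemma has_derivative_reeb_form:
  assumes Z: "(Z has_derivative Z') (at x)" "Z x \<noteq> 0"
    and X: "(X has_derivative X') (at x)" and Y: "(Y has_derivative Y') (at x)"
  shows "((\<lambda>x. reeb_form p k (Z x) (X x) (Y x)) has_derivative
    (\<lambda>v. reeb_form p k (Z x) (X' v) (Y x) + reeb_form p k (Z x) (X x) (Y' v)
      - (reeb_form p 0 (Z x) (Z x) (Z' v) + cnj (reeb_form p 0 (Z x) (Z x) (Z' v)))
          * reeb_form p (Suc k) (Z x) (X x) (Y x)
      - (reeb_b p (Z x) (Z' v) + cnj (reeb_b p (Z x) (Z' v))) * reeb_form p k (Z x) (X x) (Y x))) (at x)"
proof -
  have nz: "weighted_form p 1 (Z x) (Z x) (Z x) \<noteq> 0" by (rule weighted_form_1_nonzero[OF pos Z(2)])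
  show ?thesis
    unfolding reeb_form_def[of p k]
    apply (rule has_derivative_eq_rhs)
     apply (rule has_derivative_divide'[OF has_derivative_weighted_form[OF Z X Y] has_derivative_weighted_form[OF Z Z(1) Z(1)] nz])
    apply (rule ext)
    using nz cnj_weighted_form[of p 0 "Z x" "Z x"] cnj_weighted_form[of p 1 "Z x" "Z x"] cnj_weighted_form[of p 2 "Z x" "Z x" "Z x"]
      cnj_weighted_form[of p 1 "Z x" "Z x" "Z x"]
    apply (simp add: reeb_b_def reeb_form_def numeral_2_eq_2)
    apply (simp add: divide_simps)
    apply (simp add: algebra_simps)
    done
qed

end

section \<open>The metric in an affine chart\<close>

text \<open>The linear part of the affine map \<open>wps_lift i\<close>, hence its
  derivative.\<close>

definition wps_lin :: "'n option \<Rightarrow> complex^'n \<Rightarrow> complex^('n::finite option)" where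
  "wps_lin i v = (\<chi> j. case Transposition.transpose None i j of None \<Rightarrow> 0 | Some k \<Rightarrow> v $ k)"

lemma wps_lin_same [simp]: "wps_lin i v $ i = 0"
  by (simp add: wps_lin_def)

lemma wps_lin_other [simp]: "wps_lin i v $ Transposition.transpose None i (Some k) = v $ k"
  by (simp add: wps_lin_def)

lemma wps_lin_eqI:
  assumes "X $ i = 0" "\<And>k. X $ Transposition.transpose None i (Some k) = v $ k"
  shows "wps_lin i v = X"
proof -
  have "wps_lin i v $ j = X $ j" for j
    by (cases rule: wps_index_cases[of j i]) (use assms in auto)
  then show ?thesis by (simp add: vec_eq_iff)
qed

lemma wps_lin_add: "wps_lin i (v + w) = wps_lin i v + wps_lin i w"
  and wps_lin_diff: "wps_lin i (v - w) = wps_lin i v - wps_lin i w"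
  and wps_lin_scale: "wps_lin i (c *s v) = c *s wps_lin i v"
  by (rule wps_lin_eqI; simp)+

lemma wps_lift_nonzero [simp]: "wps_lift i x \<noteq> 0"
  by (metis wps_lift_same zero_index zero_neq_one)

lemma has_derivative_wps_lift: "(wps_lift i has_derivative wps_lin i) (at x)"
proof (rule has_derivative_vecI)
  fix j
  show "((\<lambda>x. wps_lift i x $ j) has_derivative (\<lambda>v. wps_lin i v $ j)) (at x)"
    by (cases rule: wps_index_cases[of j i])
       (auto intro: bounded_linear_imp_has_derivative bounded_linear_vec_nth)
qed

context
  fixes p :: "'n::finite option \<Rightarrow> nat" and i :: "'n option"
begin

definition chart_mult :: "complex^'n \<Rightarrow> complex^'n" where
  "chart_mult v = (\<chi> k. of_nat (p (Transposition.transpose None i (Some k))) * v $ k)"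

definition chart_T :: "complex^'n \<Rightarrow> complex^'n" where
  "chart_T x = chart_mult (chart_mult x) - of_nat (p i) *s chart_mult x"

text \<open>At index 0 this is the form \<open>a\<close> of the overview; \<open>chart_S k\<close>
  below is \<open>\<sigma>\<^sub>k\<close>.\<close>

definition chart_A :: "nat \<Rightarrow> complex^'n \<Rightarrow> complex^'n \<Rightarrow> complex" where
  "chart_A k x v = reeb_form p k (wps_lift i x) (wps_lift i x) (wps_lin i v)"

definition chart_S :: "nat \<Rightarrow> complex^'n \<Rightarrow> complex" where
  "chart_S k x = reeb_form p k (wps_lift i x) (wps_lift i x) (wps_lift i x)"

definition chart_M :: "nat \<Rightarrow> complex^'n \<Rightarrow> complex^'n \<Rightarrow> complex^'n \<Rightarrow> complex" where
  "chart_M k x v w = reeb_form p k (wps_lift i x) (wps_lin i v) (wps_lin i w)"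

abbreviation chart_a :: "complex^'n \<Rightarrow> complex^'n \<Rightarrow> complex" where
  "chart_a \<equiv> chart_A 0"

definition chart_b :: "complex^'n \<Rightarrow> complex^'n \<Rightarrow> complex" where
  "chart_b x v = chart_A 1 x v - chart_S 2 x * chart_A 0 x v"

text \<open>The product of two horizontal projections multiplied out, see
  \<open>chart_h_horizontal\<close>; in this form it can be differentiated term by term.\<close>

definition chart_h :: "complex^'n \<Rightarrow> complex^'n \<Rightarrow> complex^'n \<Rightarrow> complex" where
  "chart_h x v w = chart_M 0 x v w - cnj (chart_a x v) * chart_b x w - cnj (chart_b x v) * chart_a x w
     - chart_S 2 x * cnj (chart_a x v) * chart_a x w"

definition chart_\<theta> :: "complex^'n \<Rightarrow> complex^'n \<Rightarrow> complex^'n \<Rightarrow> complex^'n" where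
  "chart_\<theta> x v w = (chart_a x v * chart_a x w) *s chart_T x - chart_a x v *s chart_mult w - chart_a x w *s chart_mult v
     - chart_b x w *s v - chart_b x v *s w"

text \<open>The derivative of \<open>chart_a\<close> along \<open>v\<close>. Its part
  conjugate-linear in \<open>v\<close> is \<open>chart_h\<close>; since \<open>dt = Re a\<close>,
  this makes the logarithmic radius a Kaehler potential up to a constant factor.\<close>

definition chart_da :: "complex^'n \<Rightarrow> complex^'n \<Rightarrow> complex^'n \<Rightarrow> complex" where
  "chart_da x v w = chart_h x v w - chart_a x v * chart_b x w - chart_a x w * chart_b x v
     - chart_S 2 x * chart_a x v * chart_a x w"

definition chart_L :: "complex^'n \<Rightarrow> complex^'n \<Rightarrow> complex^'n" where
  "chart_L x w = chart_mult w - chart_a x w *s chart_T x"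

text \<open>The derivative of \<open>chart_b\<close> along \<open>v\<close>, arranged so that the
  curvature identity can be checked without expanding \<open>chart_h\<close>.\<close>

definition chart_db :: "complex^'n \<Rightarrow> complex^'n \<Rightarrow> complex^'n \<Rightarrow> complex" where
  "chart_db x v w = chart_h x v (chart_L x w) - chart_S 2 x * chart_h x v w + chart_b x (chart_\<theta> x v w) + chart_b x v * chart_b x w"

text \<open>The product rule along \<open>u\<close>; the term with \<open>chart_T u\<close> appears
  because \<open>chart_T\<close> is linear in the base point.\<close>

definition chart_d\<theta> :: "complex^'n \<Rightarrow> complex^'n \<Rightarrow> complex^'n \<Rightarrow> complex^'n \<Rightarrow> complex^'n" where
  "chart_d\<theta> x u v w = (chart_da x u v * chart_a x w + chart_a x v * chart_da x u w) *s chart_T x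
     + (chart_a x v * chart_a x w) *s chart_T u
     - chart_da x u v *s chart_mult w - chart_da x u w *s chart_mult v
     - chart_db x u w *s v - chart_db x u v *s w"

lemma wps_lin_chart_mult: "wps_lin i (chart_mult v) = weight_mult p (wps_lin i v)"
  by (rule wps_lin_eqI) (simp_all add: chart_mult_def weight_mult_def)

text \<open>The lift has entry 1 at \<open>i\<close>, so the right side has entry
  \<open>p\<^sub>i\<^sup>2 - p\<^sub>i p\<^sub>i = 0\<close> there. Thus \<open>chart_T\<close>
  represents \<open>P\<^sup>2 Z\<close> modulo \<open>P Z\<close> by a vector tangent to the
  slice.\<close>

lemma wps_lin_chart_T:
  "wps_lin i (chart_T x) = weight_mult p (weight_mult p (wps_lift i x)) - of_nat (p i) *s weight_mult p (wps_lift i x)"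
  by (rule wps_lin_eqI) (simp_all add: chart_T_def chart_mult_def weight_mult_def)

lemma cnj_chart_S [simp]: "cnj (chart_S k x) = chart_S k x"
  by (simp add: chart_S_def cnj_reeb_form)

lemma cnj_chart_M: "cnj (chart_M k x v w) = chart_M k x w v"
  by (simp add: chart_M_def cnj_reeb_form)

lemma chart_A_simps:
  "chart_A k x (v + w) = chart_A k x v + chart_A k x w"
  "chart_A k x (v - w) = chart_A k x v - chart_A k x w"
  "chart_A k x (c *s v) = c * chart_A k x v"
  "chart_A k x (chart_mult v) = chart_A (Suc k) x v"
  "chart_A k x (chart_T x) = chart_S (Suc (Suc k)) x - of_nat (p i) * chart_S (Suc k) x"
  by (simp_all add: chart_A_def chart_S_def wps_lin_add wps_lin_diff wps_lin_scale wps_lin_chart_mult wps_lin_chart_T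
      reeb_form_add_right reeb_form_diff_right reeb_form_scale_right reeb_form_weight_mult_right)

lemma chart_M_simps:
  "chart_M k x u (v + w) = chart_M k x u v + chart_M k x u w"
  "chart_M k x u (v - w) = chart_M k x u v - chart_M k x u w"
  "chart_M k x u (c *s v) = c * chart_M k x u v"
  "chart_M k x u (chart_mult v) = chart_M (Suc k) x u v"
  "chart_M k x u (chart_T x) = cnj (chart_A (Suc (Suc k)) x u) - of_nat (p i) * cnj (chart_A (Suc k) x u)"
  "chart_M k x (v + w) u = chart_M k x v u + chart_M k x w u"
  "chart_M k x (v - w) u = chart_M k x v u - chart_M k x w u"
  "chart_M k x (c *s v) u = cnj c * chart_M k x v u"
  "chart_M k x (chart_mult v) u = chart_M (Suc k) x v u"
  "chart_M k x (chart_T x) u = chart_A (Suc (Suc k)) x u - of_nat (p i) * chart_A (Suc k) x u"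
  by (simp_all add: chart_M_def chart_A_def cnj_reeb_form wps_lin_add wps_lin_diff wps_lin_scale wps_lin_chart_mult wps_lin_chart_T
      reeb_form_add_right reeb_form_diff_right reeb_form_scale_right reeb_form_weight_mult_right
      reeb_form_add_left reeb_form_diff_left reeb_form_scale_left reeb_form_weight_mult_left)

lemma chart_A_1: "chart_A (Suc 0) x v = chart_b x v + chart_S 2 x * chart_a x v"
  by (simp add: chart_b_def)

lemma chart_b_simps:
  "chart_b x (v + w) = chart_b x v + chart_b x w"
  "chart_b x (v - w) = chart_b x v - chart_b x w"
  "chart_b x (c *s v) = c * chart_b x v"
  "chart_b x (chart_mult v) = chart_A 2 x v - chart_S 2 x * (chart_b x v + chart_S 2 x * chart_a x v)"
  by (simp_all add: chart_b_def chart_A_simps algebra_simps numeral_2_eq_2)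

lemma chart_h_simps:
  "chart_h x u (v + w) = chart_h x u v + chart_h x u w"
  "chart_h x u (v - w) = chart_h x u v - chart_h x u w"
  "chart_h x u (c *s v) = c * chart_h x u v"
  "chart_h x (v + w) u = chart_h x v u + chart_h x w u"
  "chart_h x (v - w) u = chart_h x v u - chart_h x w u"
  "chart_h x (c *s v) u = cnj c * chart_h x v u"
  by (simp_all add: chart_h_def chart_A_simps chart_b_simps chart_M_simps algebra_simps)

lemma cnj_chart_h: "cnj (chart_h x v w) = chart_h x w v"
  by (simp add: chart_h_def cnj_chart_M mult_ac)

end

section \<open>Derivatives of the chart scalars and the structure equations\<close>

context
  fixes p :: "'n::finite option \<Rightarrow> nat" and i :: "'n option"
  assumes pos: "\<And>i. p i > 0"
begin

lemma chart_S_1: "chart_S p i (Suc 0) x = 1"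
  using reeb_form_1_self[OF pos wps_lift_nonzero] by (simp add: chart_S_def)

lemma chart_a_T: "chart_a p i x (chart_T p i x) = chart_S p i 2 x - of_nat (p i)"
  by (simp add: chart_A_simps chart_S_1 numeral_2_eq_2)

lemma chart_b_T: "chart_b p i x (chart_T p i x) = chart_S p i 3 x - (chart_S p i 2 x)\<^sup>2"
  unfolding chart_b_def chart_A_simps
  by (simp add: chart_S_1 numeral_2_eq_2 numeral_3_eq_3 algebra_simps)

lemma reeb_b_lift: "reeb_b p (wps_lift i x) (wps_lin i v) = chart_b p i x v"
  unfolding reeb_b_def chart_b_def chart_A_def chart_S_def by simp

lemma has_derivative_chart_M:
  "((\<lambda>y. chart_M p i k y u w) has_derivative
    (\<lambda>v. - (chart_a p i x v + cnj (chart_a p i x v)) * chart_M p i (Suc k) x u w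
       - (chart_b p i x v + cnj (chart_b p i x v)) * chart_M p i k x u w)) (at x)"
  unfolding chart_M_def
  by (rule has_derivative_eq_rhs[OF has_derivative_reeb_form[OF pos has_derivative_wps_lift wps_lift_nonzero
      has_derivative_const has_derivative_const]])
     (simp add: fun_eq_iff reeb_b_lift chart_A_def algebra_simps)

lemma has_derivative_chart_A:
  "((\<lambda>y. chart_A p i k y w) has_derivative
    (\<lambda>v. chart_M p i k x v w - (chart_a p i x v + cnj (chart_a p i x v)) * chart_A p i (Suc k) x w
       - (chart_b p i x v + cnj (chart_b p i x v)) * chart_A p i k x w)) (at x)"
  unfolding chart_A_def
  by (rule has_derivative_eq_rhs[OF has_derivative_reeb_form[OF pos has_derivative_wps_lift wps_lift_nonzero
      has_derivative_wps_lift has_derivative_const]])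
     (simp add: fun_eq_iff reeb_b_lift chart_A_def chart_M_def algebra_simps)

lemma has_derivative_chart_S:
  "((\<lambda>y. chart_S p i k y) has_derivative
    (\<lambda>v. chart_A p i k x v + cnj (chart_A p i k x v) - (chart_a p i x v + cnj (chart_a p i x v)) * chart_S p i (Suc k) x
       - (chart_b p i x v + cnj (chart_b p i x v)) * chart_S p i k x)) (at x)"
  unfolding chart_S_def
  by (rule has_derivative_eq_rhs[OF has_derivative_reeb_form[OF pos has_derivative_wps_lift wps_lift_nonzero
      has_derivative_wps_lift has_derivative_wps_lift]])
     (simp add: fun_eq_iff reeb_b_lift chart_A_def cnj_reeb_form algebra_simps)

lemma has_derivative_chart_a: "((\<lambda>y. chart_a p i y w) has_derivative (\<lambda>v. chart_da p i x v w)) (at x)"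
  by (rule has_derivative_eq_rhs[OF has_derivative_chart_A])
     (simp add: fun_eq_iff chart_da_def chart_h_def chart_A_1 algebra_simps)

lemma has_derivative_chart_b: "((\<lambda>y. chart_b p i y w) has_derivative (\<lambda>v. chart_db p i x v w)) (at x)"
  unfolding chart_b_def
  apply (rule has_derivative_eq_rhs[OF has_derivative_diff[OF has_derivative_chart_A
      has_derivative_mult[OF has_derivative_chart_S has_derivative_chart_a]]])
  apply (simp add: fun_eq_iff chart_db_def chart_da_def chart_\<theta>_def chart_L_def chart_h_simps chart_b_simps)
  apply (simp add: chart_h_def chart_M_simps chart_A_simps chart_b_simps chart_b_T chart_a_T chart_A_1 chart_S_1
     numeral_2_eq_2[symmetric] numeral_3_eq_3[symmetric] power2_eq_square)
  apply (simp add: chart_b_def)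
  apply (simp add: algebra_simps)
  done

text \<open>Compatibility of the Chern connection with the metric: expanded in
  \<open>chart_M\<close>, \<open>chart_A\<close> and \<open>chart_S\<close>, both sides are the same
  polynomial.\<close>

lemma has_derivative_chart_h:
  "((\<lambda>y. chart_h p i y u w) has_derivative
     (\<lambda>v. chart_h p i x u (chart_\<theta> p i x v w) + cnj (chart_h p i x w (chart_\<theta> p i x v u)))) (at x)"
proof -
  have cnj: "((\<lambda>y. cnj (f y)) has_derivative (\<lambda>v. cnj (f' v))) (at x)" if "(f has_derivative f') (at x)" for f f'
    by (rule bounded_linear.has_derivative[OF bounded_linear_cnj that])
  show ?thesis
    unfolding chart_h_def[abs_def]
    apply (rule has_derivative_eq_rhs)
     apply (rule has_derivative_diff has_derivative_mult cnj has_derivative_chart_M has_derivative_chart_a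
        has_derivative_chart_b has_derivative_chart_S)+
    apply (simp add: fun_eq_iff chart_db_def chart_da_def chart_\<theta>_def chart_L_def chart_h_simps chart_b_simps)
    apply (simp add: chart_h_def chart_M_simps chart_A_simps chart_b_simps chart_b_T chart_a_T chart_A_1 chart_S_1 cnj_chart_M
       numeral_2_eq_2[symmetric] numeral_3_eq_3[symmetric] power2_eq_square)
    apply (simp add: algebra_simps)
    done
qed

lemma bounded_linear_chart_T: "bounded_linear (chart_T p i)"
  unfolding linear_conv_bounded_linear[symmetric]
  by (auto intro!: linearI simp: chart_T_def chart_mult_def vec_eq_iff algebra_simps scaleR_diff_right)

lemma has_derivative_chart_T: "(chart_T p i has_derivative chart_T p i) (at x)"
  by (rule bounded_linear_imp_has_derivative[OF bounded_linear_chart_T])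

lemma has_derivative_chart_\<theta>:
  "((\<lambda>y. chart_\<theta> p i y v w) has_derivative (\<lambda>u. chart_d\<theta> p i x u v w)) (at x)"
proof (rule has_derivative_vecI)
  fix k
  show "((\<lambda>y. chart_\<theta> p i y v w $ k) has_derivative (\<lambda>u. chart_d\<theta> p i x u v w $ k)) (at x)"
    unfolding chart_\<theta>_def chart_d\<theta>_def
    apply (simp only: vector_minus_component vector_add_component vector_smult_component)
    apply (rule has_derivative_eq_rhs)
     apply (rule has_derivative_diff has_derivative_add has_derivative_mult has_derivative_chart_a has_derivative_chart_b
         has_derivative_const has_derivative_vec_nth[OF has_derivative_chart_T])+
    apply (simp add: fun_eq_iff algebra_simps)
    done
qed

text \<open>The number \<open>s\<close> is arbitrary, since its terms on the right cancel. It is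
  fixed only later, by requiring that \<open>chart_S p i 2 x - 2 * s\<close> be the trace of
  \<open>s - L\<close>.\<close>

lemma chart_curvature:
  "chart_d\<theta> p i x u v w - chart_d\<theta> p i x v u w + chart_\<theta> p i x u (chart_\<theta> p i x v w) - chart_\<theta> p i x v (chart_\<theta> p i x u w) =
     (chart_h p i x u v - chart_h p i x v u) *s (s *s w - chart_L p i x w)
          - (chart_h p i x v w *s (s *s u - chart_L p i x u) - chart_h p i x u w *s (s *s v - chart_L p i x v))
          - (chart_h p i x v (s *s w - chart_L p i x w) *s u - chart_h p i x u (s *s w - chart_L p i x w) *s v)
          + (chart_h p i x u (s *s v - chart_L p i x v) - chart_h p i x v (s *s u - chart_L p i x u)) *s w
          + (chart_S p i 2 x - 2 * s) *s ((chart_h p i x u v - chart_h p i x v u) *s w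
              - (chart_h p i x v w *s u - chart_h p i x u w *s v))" (is "?l = ?r")
proof -
  have "?l $ k = ?r $ k" for k
    apply (simp add: chart_d\<theta>_def chart_db_def chart_da_def chart_h_simps)
    apply (simp add: chart_\<theta>_def chart_A_simps(1-4) chart_a_T chart_b_T chart_b_simps chart_A_1 del: One_nat_def)
    apply (simp add: chart_L_def chart_T_def chart_mult_def)
    apply (simp add: algebra_simps power2_eq_square)
    done
  then show ?thesis by (simp add: vec_eq_iff)
qed

text \<open>Lowering the index of \<open>T\<close> gives \<open>b\<close> composed with
  \<open>L\<close>; this eliminates the values of \<open>chart_h\<close> at \<open>T\<close> from
  the derivatives of \<open>L\<close> and \<open>V\<close>.\<close>

lemma chart_h_T: "chart_h p i x (chart_T p i x) w = chart_b p i x (chart_L p i x w)"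
  by (simp add: chart_h_def chart_L_def chart_M_simps chart_A_simps(1-4) chart_b_simps chart_b_T chart_a_T chart_A_1
      numeral_2_eq_2[symmetric] numeral_3_eq_3[symmetric] power2_eq_square algebra_simps)

text \<open>\<open>P\<close> is real and diagonal, hence self-adjoint for the weighted forms, and
  the induced map \<open>L\<close> inherits this. It makes \<open>H\<close> hermitian.\<close>

lemma chart_h_L: "chart_h p i x (chart_L p i x v) w = chart_h p i x v (chart_L p i x w)"
  by (simp add: chart_h_def chart_L_def chart_M_simps chart_A_simps(1-4) chart_b_simps chart_b_T chart_a_T chart_A_1
      cnj_chart_M numeral_2_eq_2[symmetric] numeral_3_eq_3[symmetric] power2_eq_square algebra_simps)

lemma has_derivative_chart_L:
  "((\<lambda>y. chart_L p i y w) has_derivative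
     (\<lambda>v. chart_L p i x (chart_\<theta> p i x v w) - chart_\<theta> p i x v (chart_L p i x w)
        - chart_h p i x v w *s chart_T p i x - chart_h p i x (chart_T p i x) w *s v)) (at x)"
proof (rule has_derivative_vecI)
  fix k
  show "((\<lambda>y. chart_L p i y w $ k) has_derivative
     (\<lambda>v. (chart_L p i x (chart_\<theta> p i x v w) - chart_\<theta> p i x v (chart_L p i x w)
        - chart_h p i x v w *s chart_T p i x - chart_h p i x (chart_T p i x) w *s v) $ k)) (at x)"
    unfolding chart_h_T
    unfolding chart_L_def
    apply (simp only: vector_minus_component vector_add_component vector_smult_component)
    apply (rule has_derivative_eq_rhs)
     apply (rule has_derivative_diff has_derivative_add has_derivative_mult has_derivative_chart_a has_derivative_chart_b
         has_derivative_const has_derivative_vec_nth[OF has_derivative_chart_T])+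
    apply (simp add: fun_eq_iff chart_da_def)
    apply (simp add: chart_\<theta>_def chart_A_simps(1-4) chart_a_T chart_b_T chart_b_simps chart_A_1)
    apply (simp add: chart_T_def chart_mult_def)
    apply (simp add: algebra_simps power2_eq_square)
    done
qed

text \<open>\<open>chart_T\<close> is linear, so the left side is its derivative along
  \<open>v\<close>; the identity is the equation for \<open>dT\<close> before \<open>s\<close> is
  inserted.\<close>

lemma chart_T_derivative:
  "chart_T p i v = chart_L p i x (chart_L p i x v) - chart_S p i 2 x *s chart_L p i x v
     - chart_b p i x (chart_T p i x) *s v - chart_\<theta> p i x v (chart_T p i x)"  (is "?l = ?r")
proof -
  have "?l $ k = ?r $ k" for k
    apply (simp add: chart_L_def chart_\<theta>_def chart_A_simps(1-4) chart_a_T chart_b_T chart_b_simps chart_A_1)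
    apply (simp add: chart_T_def chart_mult_def)
    apply (simp add: algebra_simps power2_eq_square)
    done
  then show ?thesis by (simp add: vec_eq_iff)
qed

lemma chart_V_derivative:
  "((\<lambda>y. s\<^sup>2 - s * chart_S p i 2 y - chart_S p i 3 y + (chart_S p i 2 y)\<^sup>2) has_derivative
    (\<lambda>v. (chart_S p i 2 x - 2 * s) * (chart_h p i x (chart_T p i x) v + chart_h p i x v (chart_T p i x))
      + (chart_h p i x (chart_T p i x) (s *s v - chart_L p i x v)
        + chart_h p i x v (s *s chart_T p i x - chart_L p i x (chart_T p i x))))) (at x)"
proof -
  \<comment> \<open>The conjugate of \<open>chart_h_T\<close>, and the same after moving
    \<open>L\<close> across by \<open>chart_h_L\<close>.\<close>
  have *: "chart_h p i x v (chart_T p i x) = cnj (chart_b p i x (chart_L p i x v))"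
    "chart_h p i x v (chart_L p i x (chart_T p i x)) = cnj (chart_b p i x (chart_L p i x (chart_L p i x v)))" for v
    by (metis chart_h_T cnj_chart_h, metis chart_h_T cnj_chart_h chart_h_L)
  show ?thesis
    unfolding power2_eq_square[of "chart_S p i 2 y" for y]
    apply (rule has_derivative_eq_rhs)
     apply (rule has_derivative_diff has_derivative_add has_derivative_mult has_derivative_chart_S has_derivative_const)+
    apply (simp add: fun_eq_iff chart_h_simps(1-3) chart_h_T *)
    apply (simp add: chart_L_def chart_A_simps(1-4) chart_a_T chart_b_T chart_b_simps chart_A_1)
    apply (simp add: chart_b_def chart_A_simps eval_nat_numeral chart_S_1)
    apply (simp add: algebra_simps power2_eq_square)
    done
qed

end

section \<open>Positivity of the chart metric\<close>

definition horizontal :: "('m::finite \<Rightarrow> nat) \<Rightarrow> complex^'m \<Rightarrow> complex^'m \<Rightarrow> complex^'m" where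
  "horizontal p Z X = X - reeb_form p 0 Z Z X *s weight_mult p Z"

lemma reeb_form_0_self_pos:
  fixes p :: "'m::finite \<Rightarrow> nat"
  assumes pos: "\<And>i. p i > 0" and "Z \<noteq> 0" "X \<noteq> 0"
  shows "Re (reeb_form p 0 Z X X) > 0"
proof -
  obtain j where j: "X $ j \<noteq> 0" using assms(3) unfolding vec_eq_iff zero_index by blast
  have "\<exists>r>0. weighted_form p 1 Z Z Z = of_real r"
    by (rule weighted_form_1_self) (fact pos, fact assms(2))
  then obtain r where r: "r > 0" "weighted_form p 1 Z Z Z = of_real r"
    by blast
  let ?s = "\<Sum>j\<in>UNIV. exp (- 2 * real (p j) * log_radius p Z) * (cmod (X $ j))\<^sup>2"
  have "weighted_form p 0 Z X X = of_real ?s"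
    unfolding weighted_form_def of_real_sum
    by (rule sum.cong) (simp_all add: cnj_mult_self del: of_real_exp)
  moreover have "?s > 0" using j by (intro sum_pos2[of UNIV j]) auto
  ultimately show ?thesis using r by (simp add: reeb_form_def del: of_real_sum)
qed

lemma chart_h_horizontal:
  fixes p :: "'n::finite option \<Rightarrow> nat"
  shows "chart_h p i x v w =
    reeb_form p 0 (wps_lift i x) (horizontal p (wps_lift i x) (wps_lin i v)) (horizontal p (wps_lift i x) (wps_lin i w))"
proof -
  have "reeb_form p (Suc 0) (wps_lift i x) (wps_lin i v) (wps_lift i x) = cnj (chart_A p i 1 x v)"
    by (simp add: chart_A_def cnj_reeb_form)
  then show ?thesis
    by (simp add: horizontal_def reeb_form_diff_left reeb_form_diff_right reeb_form_scale_left reeb_form_scale_right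
      reeb_form_weight_mult_left reeb_form_weight_mult_right chart_h_def chart_M_def chart_A_def[symmetric] chart_S_def[symmetric]
      chart_A_1 numeral_2_eq_2[symmetric] algebra_simps)
qed

lemma chart_h_pos:
  fixes p :: "'n::finite option \<Rightarrow> nat"
  assumes pos: "\<And>i. p i > 0" and "v \<noteq> 0"
  shows "Re (chart_h p i x v v) > 0"
  unfolding chart_h_horizontal
proof (rule reeb_form_0_self_pos[OF pos wps_lift_nonzero], rule notI)
  assume 0: "horizontal p (wps_lift i x) (wps_lin i v) = 0"
  \<comment> \<open>Coordinate \<open>i\<close> of a slice vector is 0 while that of
    \<open>P Z\<close> is \<open>p i\<close>. So the coefficient \<open>a\<close> vanishes, and the
    remaining coordinates are those of \<open>v\<close>.\<close>
  then have "horizontal p (wps_lift i x) (wps_lin i v) $ i = 0" by simp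
  then have a: "reeb_form p 0 (wps_lift i x) (wps_lift i x) (wps_lin i v) = 0"
    using pos[of i] by (simp add: horizontal_def weight_mult_def)
  have "v $ k = 0" for k
    using arg_cong[OF 0, of "\<lambda>X. X $ Transposition.transpose None i (Some k)"]
    by (simp add: horizontal_def a)
  then show False using assms(2) by (simp add: vec_eq_iff)
qed

section \<open>Matrices and smoothness of the chart data\<close>

lemma matrix_vector_of_linear:
  fixes f :: "complex^'n::finite \<Rightarrow> complex^'m::finite"
  assumes "\<And>v w. f (v + w) = f v + f w" "\<And>c v. f (c *s v) = c *s f v"
  shows "matrix f *v x = f x"
proof (rule matrix_works)
  show "Vector_Spaces.linear (*s) (*s) f"
    by unfold_locales (simp_all add: assms vec.scale_right_distrib vec.scale_left_distrib)
qed

lemma scaleR_eq_vector_scale: "r *\<^sub>R (v :: complex^'n::finite) = complex_of_real r *s v"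
  unfolding vec_eq_iff vector_scaleR_component vector_smult_component by (simp add: scaleR_conv_of_real)

lemma additive_sum:
  assumes "\<And>v w. f (v + w) = f v + f w"
  shows "f (\<Sum>k\<in>A. g k) = (\<Sum>k\<in>A. f (g k :: 'a::ab_group_add) :: 'b::ab_group_add)"
proof -
  have "f 0 = 0" using assms[of 0 0] by simp
  then show ?thesis by (induction A rule: infinite_finite_induct) (auto simp: assms)
qed

lemma C_k_on_weighted_form:
  assumes "open S" "C_k_on k S (\<lambda>x. log_radius p (Z x))" "C_k_on k S X" "C_k_on k S Y"
  shows "C_k_on k S (\<lambda>x. weighted_form p m (Z x) (X x) (Y x))"
  unfolding weighted_form_def
proof (intro C_k_on_sum[OF assms(1)] C_k_on_mult[OF assms(1)] C_k_on_const)
  fix j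
  have "C_k_on k S (\<lambda>x. exp (- 2 * real (p j) * log_radius p (Z x)))"
    by (intro C_k_on_exp C_k_on_mult C_k_on_const assms)
  then show "C_k_on k S (\<lambda>x. complex_of_real (exp (- 2 * real (p j) * log_radius p (Z x))))"
    by (rule C_k_on_bounded_linear_compose[OF assms(1) bounded_linear_of_real])
  show "C_k_on k S (\<lambda>x. cnj (X x $ j))"
    by (intro C_k_on_bounded_linear_compose[OF assms(1) bounded_linear_cnj] C_k_on_vec_nth assms)
  show "C_k_on k S (\<lambda>x. Y x $ j)"
    by (intro C_k_on_vec_nth assms)
qed

context
  fixes p :: "'n::finite option \<Rightarrow> nat" and i :: "'n option"
begin

definition chart_s :: complex where
  "chart_s = of_nat (\<Sum>j\<in>UNIV. p j) / of_nat (CARD('n) + 2)"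

definition chart_matrix_h :: "complex^'n \<Rightarrow> complex^'n^'n" where
  "chart_matrix_h x = matrix (\<lambda>w. \<chi> k. chart_h p i x (axis k 1) w)"

definition chart_matrix_H :: "complex^'n \<Rightarrow> complex^'n^'n" where
  "chart_matrix_H x = matrix (\<lambda>w. chart_s *s w - chart_L p i x w)"

definition chart_V :: "complex^'n \<Rightarrow> real" where
  "chart_V x = Re (chart_s\<^sup>2 - chart_s * chart_S p i 2 x - chart_S p i 3 x + (chart_S p i 2 x)\<^sup>2)"

definition chart_g :: "'n metric" where
  "chart_g x v w = Re (chart_h p i x v w)"

lemma cnj_chart_s [simp]: "cnj chart_s = chart_s"
  by (simp add: chart_s_def)

lemma chart_V: "complex_of_real (chart_V x) =
    chart_s\<^sup>2 - chart_s * chart_S p i 2 x - chart_S p i 3 x + (chart_S p i 2 x)\<^sup>2"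
proof -
  have *: "of_real (Re z) = z" if "cnj z = z" for z
    using that by (auto simp: complex_eq_iff)
  show ?thesis unfolding chart_V_def by (rule *) simp
qed

lemma chart_\<theta>_sym: "chart_\<theta> p i x v w = chart_\<theta> p i x w v"
  by (simp add: chart_\<theta>_def algebra_simps)

lemma chart_\<theta>_linear:
  "chart_\<theta> p i x (v + v') w = chart_\<theta> p i x v w + chart_\<theta> p i x v' w"
  "chart_\<theta> p i x (c *s v) w = c *s chart_\<theta> p i x v w"
  "chart_\<theta> p i x v (w + w') = chart_\<theta> p i x v w + chart_\<theta> p i x v w'"
  "chart_\<theta> p i x v (c *s w) = c *s chart_\<theta> p i x v w"
  "chart_\<theta> p i x v (w - w') = chart_\<theta> p i x v w - chart_\<theta> p i x v w'"
  by (simp_all add: chart_\<theta>_def chart_A_simps(1-4) chart_b_simps chart_mult_def vec_eq_iff algebra_simps)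

lemma chart_L_linear:
  "chart_L p i x (w + w') = chart_L p i x w + chart_L p i x w'"
  "chart_L p i x (c *s w) = c *s chart_L p i x w"
  "chart_L p i x (w - w') = chart_L p i x w - chart_L p i x w'"
  by (simp_all add: chart_L_def chart_A_simps(1-4) chart_mult_def vec_eq_iff algebra_simps)

lemma chart_d\<theta>_linear:
  "chart_d\<theta> p i x u v (w + w') = chart_d\<theta> p i x u v w + chart_d\<theta> p i x u v w'"
  "chart_d\<theta> p i x u v (c *s w) = c *s chart_d\<theta> p i x u v w"
  by (simp_all add: chart_d\<theta>_def chart_da_def chart_db_def chart_L_linear chart_\<theta>_linear chart_h_simps
      chart_A_simps(1-4) chart_b_simps chart_mult_def vec_eq_iff algebra_simps)

end

context
  fixes p :: "'n::finite option \<Rightarrow> nat" and i :: "'n option"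
  assumes pos: "\<And>i. p i > 0"
begin

lemma C_k_on_wps_lift: "C_k_on k UNIV (wps_lift i :: complex^'n \<Rightarrow> _)"
proof (rule C_k_on_vec[OF open_UNIV])
  fix j
  show "C_k_on k UNIV (\<lambda>x :: complex^'n. wps_lift i x $ j)"
    by (cases rule: wps_index_cases[of j i])
      (auto intro: C_k_on_const C_k_on_bounded_linear bounded_linear_vec_nth)
qed

lemma C_k_on_reeb_form:
  assumes "C_k_on k UNIV (\<lambda>x. log_radius p (wps_lift i x))" "C_k_on k UNIV X" "C_k_on k UNIV Y"
  shows "C_k_on k UNIV (\<lambda>x. reeb_form p m (wps_lift i x) (X x) (Y x))"
  unfolding reeb_form_def divide_inverse
  by (intro C_k_on_mult C_k_on_inverse C_k_on_weighted_form assms C_k_on_wps_lift open_UNIV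
    weighted_form_1_nonzero[OF pos] wps_lift_nonzero)

text \<open>Bootstrapping: the derivative of the radius is the real part of a
  \<open>reeb_form\<close>, which is as regular as the radius itself.\<close>

lemma C_k_on_log_radius: "C_k_on k UNIV (\<lambda>x. log_radius p (wps_lift i x))"
proof (induction k)
  case 0
  have "isCont (\<lambda>x. log_radius p (wps_lift i x)) x" for x
    by (rule has_derivative_continuous[OF has_derivative_log_radius_compose[OF pos has_derivative_wps_lift wps_lift_nonzero]])
  then show ?case by (simp add: continuous_at_imp_continuous_on)
next
  case (Suc k)
  show ?case
  proof (rule C_k_on_SucI[OF open_UNIV has_derivative_log_radius_compose[OF pos has_derivative_wps_lift wps_lift_nonzero]])
    show "C_k_on k UNIV (\<lambda>x. Re (reeb_form p 0 (wps_lift i x) (wps_lift i x) (wps_lin i v)))" for v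
      by (intro C_k_on_bounded_linear_compose[OF open_UNIV bounded_linear_Re] C_k_on_reeb_form Suc C_k_on_wps_lift C_k_on_const)
  qed
qed

lemma C_k_on_chart:
  "C_k_on k UNIV (\<lambda>x. chart_A p i m x v)" "C_k_on k UNIV (\<lambda>x. chart_S p i m x)"
  "C_k_on k UNIV (\<lambda>x. chart_M p i m x v w)"
  unfolding chart_A_def chart_S_def chart_M_def
  by (intro C_k_on_reeb_form C_k_on_log_radius C_k_on_wps_lift C_k_on_const)+

lemma C_k_on_chart_b: "C_k_on k UNIV (\<lambda>x. chart_b p i x v)"
  unfolding chart_b_def by (intro C_k_on_diff C_k_on_mult C_k_on_chart open_UNIV)

lemma smooth_chart_h: "smooth_on UNIV (\<lambda>x. chart_h p i x v w)"
  unfolding smooth_on_def chart_h_def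
  by (intro allI C_k_on_diff C_k_on_mult C_k_on_chart C_k_on_chart_b open_UNIV
    C_k_on_bounded_linear_compose[OF open_UNIV bounded_linear_cnj])

lemma smooth_chart_\<theta>: "smooth_on UNIV (\<lambda>x. chart_\<theta> p i x v w)"
  unfolding smooth_on_def
proof (intro allI C_k_on_vec open_UNIV)
  fix k j
  have "C_k_on k UNIV (\<lambda>x. chart_T p i x)"
    by (intro C_k_on_bounded_linear open_UNIV bounded_linear_chart_T[OF pos])
  then show "C_k_on k UNIV (\<lambda>x. chart_\<theta> p i x v w $ j)"
    unfolding chart_\<theta>_def vector_minus_component vector_add_component vector_smult_component
    by (intro C_k_on_diff C_k_on_mult C_k_on_chart C_k_on_chart_b open_UNIV C_k_on_const C_k_on_vec_nth)
qed

lemma sum_weights: "(\<Sum>j\<in>UNIV. p j) = p i + (\<Sum>k\<in>UNIV. p (Transposition.transpose None i (Some k)))"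
proof -
  have "(\<Sum>j\<in>UNIV. p j) = (\<Sum>j\<in>UNIV. p (Transposition.transpose None i j))"
    by (rule sum.reindex_bij_betw[symmetric]) simp
  also have "\<dots> = p i + (\<Sum>k\<in>UNIV. p (Transposition.transpose None i (Some k)))"
    by (simp add: UNIV_option_conv sum.reindex)
  finally show ?thesis .
qed

lemma chart_matrix_h: "cdot v (chart_matrix_h p i x *v w) = chart_h p i x v w"
proof -
  have "chart_matrix_h p i x *v w = (\<chi> k. chart_h p i x (axis k 1) w)"
    unfolding chart_matrix_h_def
    by (rule matrix_vector_of_linear) (simp_all add: vec_eq_iff chart_h_simps)
  moreover have "chart_h p i x v w = (\<Sum>k\<in>UNIV. chart_h p i x (v $ k *s axis k 1) w)"
    by (subst additive_sum[of "\<lambda>v. chart_h p i x v w", symmetric]) (simp_all add: chart_h_simps basis_expansion)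
  ultimately show ?thesis by (simp add: cdot_def chart_h_simps)
qed

lemma chart_matrix_\<theta>: "matrix (chart_\<theta> p i x v) *v w = chart_\<theta> p i x v w"
  by (rule matrix_vector_of_linear) (simp_all add: chart_\<theta>_linear)

lemma chart_matrix_d\<theta>: "matrix (chart_d\<theta> p i x u v) *v w = chart_d\<theta> p i x u v w"
  by (rule matrix_vector_of_linear) (simp_all add: chart_d\<theta>_linear)

lemma chart_matrix_H: "chart_matrix_H p i x *v w = chart_s p *s w - chart_L p i x w"
  unfolding chart_matrix_H_def
  by (rule matrix_vector_of_linear) (simp_all add: chart_L_linear vec_eq_iff algebra_simps)

text \<open>\<open>tr L = tr P - p\<^sub>i - a(T)\<close> and
  \<open>a(T) = \<sigma>\<^sub>2 - p\<^sub>i\<close>, so \<open>p\<^sub>i\<close> cancels. The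
  choice \<open>(n + 2) s = tr P\<close> then turns \<open>n s - tr P\<close> into
  \<open>- 2 s\<close>.\<close>

lemma trace_chart_matrix_H: "trace (chart_matrix_H p i x) = chart_S p i 2 x - 2 * chart_s p"
proof -
  have "chart_matrix_H p i x $ k $ k = chart_s p - of_nat (p (Transposition.transpose None i (Some k)))
      + chart_a p i x (chart_T p i x $ k *s axis k 1)" for k
    using matrix_vector_mult_axis_nth[of "chart_matrix_H p i x" k k]
    by (simp add: chart_matrix_H chart_L_def chart_mult_def chart_A_simps(3) algebra_simps)
  then have "trace (chart_matrix_H p i x) = of_nat (CARD('n)) * chart_s p
      - of_nat (\<Sum>k\<in>UNIV. p (Transposition.transpose None i (Some k)))
      + (\<Sum>k\<in>UNIV. chart_a p i x (chart_T p i x $ k *s axis k 1))"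
    by (simp add: trace_def sum.distrib sum_subtractf)
  \<comment> \<open>The trace of the rank-one map sending \<open>w\<close> to \<open>a(w) T\<close>
    is \<open>a(T)\<close>.\<close>
  also have "(\<Sum>k\<in>UNIV. chart_a p i x (chart_T p i x $ k *s axis k 1)) = chart_a p i x (chart_T p i x)"
    by (subst additive_sum[of "chart_a p i x", symmetric]) (simp_all add: chart_A_simps(1) basis_expansion)
  also have "\<dots> = chart_S p i 2 x - of_nat (p i)" by (rule chart_a_T[OF pos])
  also have "of_nat (CARD('n)) * chart_s p = of_nat (\<Sum>j\<in>UNIV. p j) - 2 * chart_s p"
  proof -
    have "(of_nat (CARD('n)) + 2 :: complex) \<noteq> 0"
      by (metis of_nat_add of_nat_numeral of_nat_eq_0_iff add_is_0 zero_neq_numeral)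
    then have "(of_nat (CARD('n)) + 2) * chart_s p = of_nat (\<Sum>j\<in>UNIV. p j)"
      by (simp add: chart_s_def add.commute)
    then show ?thesis by (simp add: algebra_simps)
  qed
  finally show ?thesis unfolding sum_weights by simp
qed

theorem bochner_kaehler_chart: "bochner_kaehler_on UNIV (chart_g p i)"
proof -
  interpret bochner_kaehler_base UNIV "chart_matrix_h p i" "\<lambda>x v. matrix (chart_\<theta> p i x v)"
    "\<lambda>x u v. matrix (chart_d\<theta> p i x u v)" "chart_matrix_H p i" "chart_T p i" "chart_V p i"
  \<comment> \<open>Replacing each matrix by the map it represents reduces every locale assumption
    to an equation in the chart.\<close>
  proof (unfold_locales, unfold chart_matrix_h chart_matrix_\<theta> chart_matrix_d\<theta> chart_matrix_H trace_chart_matrix_H chart_V)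
    show "matrix (chart_\<theta> p i x (v + w)) = matrix (chart_\<theta> p i x v) + matrix (chart_\<theta> p i x w)" for x v w
      unfolding matrix_eq matrix_vector_mult_add_rdistrib chart_matrix_\<theta> chart_\<theta>_linear by simp
    show "matrix (chart_\<theta> p i x (r *\<^sub>R v)) = r *\<^sub>R matrix (chart_\<theta> p i x v)" for x r v
      unfolding matrix_eq bounded_bilinear.scaleR_left[OF bounded_bilinear_matrix_vector_mult] chart_matrix_\<theta>
        scaleR_eq_vector_scale chart_\<theta>_linear by simp
    show "cnj (chart_h p i x v w) = chart_h p i x w v" for x v w by (rule cnj_chart_h)
    show "0 < Re (chart_h p i x v v)" if "v \<noteq> 0" for x v by (rule chart_h_pos[OF pos that])
    show "chart_\<theta> p i x v w = chart_\<theta> p i x w v" for x v w by (rule chart_\<theta>_sym)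
    show "((\<lambda>y. chart_s p *s w - chart_L p i y w) has_derivative
        (\<lambda>v. chart_s p *s chart_\<theta> p i x v w - chart_L p i x (chart_\<theta> p i x v w) - chart_\<theta> p i x v (chart_s p *s w - chart_L p i x w)
          + chart_h p i x v w *s chart_T p i x + chart_h p i x (chart_T p i x) w *s v)) (at x)" for x w
      by (rule has_derivative_eq_rhs[OF has_derivative_diff[OF has_derivative_const has_derivative_chart_L[OF pos]]])
         (simp add: fun_eq_iff chart_\<theta>_linear algebra_simps)
    show "chart_h p i x (chart_s p *s v - chart_L p i x v) w = chart_h p i x v (chart_s p *s w - chart_L p i x w)" for x v w
      by (simp add: chart_h_simps chart_h_L[OF pos])
    show "(chart_T p i has_derivative
        (\<lambda>v. chart_s p *s (chart_s p *s v - chart_L p i x v) - chart_L p i x (chart_s p *s v - chart_L p i x v)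
          + (chart_S p i 2 x - 2 * chart_s p) *s (chart_s p *s v - chart_L p i x v)
          + ((chart_s p)\<^sup>2 - chart_s p * chart_S p i 2 x - chart_S p i 3 x + (chart_S p i 2 x)\<^sup>2) *s v
          - chart_\<theta> p i x v (chart_T p i x))) (at x)" for x
      by (rule has_derivative_eq_rhs[OF has_derivative_chart_T[OF pos]], rule ext, subst chart_T_derivative[OF pos, where x = x])
         (simp add: chart_L_linear chart_b_T[OF pos] vec_eq_iff algebra_simps power2_eq_square)
  qed (rule smooth_chart_h smooth_chart_\<theta> has_derivative_chart_h[OF pos] has_derivative_chart_\<theta>[OF pos]
      chart_curvature[OF pos] chart_V_derivative[OF pos] open_UNIV)+
  show ?thesis using bochner_kaehler unfolding g_def chart_g_def chart_matrix_h .
qed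

end

section \<open>Invariance under transition maps\<close>

text \<open>More general than \<open>wscale\<close>: it also allows unit factors in single
  coordinates, which transition maps require where a coordinate vanishes.\<close>

definition diag_act :: "('m::finite \<Rightarrow> complex) \<Rightarrow> complex^'m \<Rightarrow> complex^'m" where
  "diag_act d X = (\<chi> j. d j * X $ j)"

lemma diag_act_nonzero:
  assumes "\<And>j. d j \<noteq> 0" "Z \<noteq> 0" shows "diag_act d Z \<noteq> 0"
  using assms by (simp add: diag_act_def vec_eq_iff)

text \<open>\<open>P Z\<close> has \<open>a\<close>-value \<open>\<sigma>\<^sub>1 = 1\<close>, so
  the projection kills this orbit direction.\<close>

lemma horizontal_add_weight_mult:
  fixes p :: "'m::finite \<Rightarrow> nat"
  assumes pos: "\<And>i. p i > 0" and "Z \<noteq> 0"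
  shows "horizontal p Z (X + c *s weight_mult p Z) = horizontal p Z X"
proof -
  have "reeb_form p 0 Z Z (weight_mult p Z) = 1"
    using reeb_form_1_self[OF pos assms(2)] by (simp add: reeb_form_weight_mult_right)
  then show ?thesis
    by (simp add: horizontal_def reeb_form_add_right reeb_form_scale_right vec_eq_iff algebra_simps)
qed

context
  fixes p :: "'m::finite \<Rightarrow> nat" and d :: "'m \<Rightarrow> complex" and r :: real
  assumes pos: "\<And>i. p i > 0" and r: "r > 0" and d: "\<And>j. cmod (d j) = r ^ p j"
begin

text \<open>Shifting the logarithmic radius by \<open>ln r\<close> compensates the moduli
  \<open>r ^ p j\<close> exactly; the invariance of all weighted forms rests on this.\<close>

lemma exp_log_radius_shift: "exp (- 2 * real (p j) * (t + ln r)) * (cmod (d j))\<^sup>2 = exp (- 2 * real (p j) * t)"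
proof -
  have "(cmod (d j))\<^sup>2 = exp (2 * real (p j) * ln r)"
  proof -
    have "exp (2 * real (p j) * ln r) = exp (real (2 * p j) * ln r)" by simp
    also have "\<dots> = r ^ (2 * p j)" unfolding exp_of_nat_mult using r by simp
    finally show ?thesis by (simp add: d power_mult power_even_eq power2_eq_square power_mult_distrib mult.commute[of 2])
  qed
  then show ?thesis by (simp add: exp_add[symmetric] algebra_simps)
qed

lemma diag_factor_nonzero: "d j \<noteq> 0"
  using d[of j] r by auto

lemma log_radius_diag_act:
  assumes "Z \<noteq> 0" shows "log_radius p (diag_act d Z) = log_radius p Z + ln r"
proof (rule log_radius_unique[OF pos diag_act_nonzero[OF diag_factor_nonzero assms]])
  have "weight_sum p (diag_act d Z) (log_radius p Z + ln r) = weight_sum p Z (log_radius p Z)"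
    unfolding weight_sum_def diag_act_def
    by (rule sum.cong) (simp_all only: vec_lambda_beta norm_mult power_mult_distrib mult.assoc[symmetric] exp_log_radius_shift)
  then show "weight_sum p (diag_act d Z) (log_radius p Z + ln r) = 1"
    using weight_sum_log_radius[OF pos assms] by simp
qed

lemma weighted_form_diag_act:
  assumes "Z \<noteq> 0"
  shows "weighted_form p k (diag_act d Z) (diag_act d X) (diag_act d Y) = weighted_form p k Z X Y"
  unfolding weighted_form_def log_radius_diag_act[OF assms]
proof (rule sum.cong[OF refl])
  fix j
  have "of_real (exp (- 2 * real (p j) * (log_radius p Z + ln r))) * (cnj (d j) * d j) =
      complex_of_real (exp (- 2 * real (p j) * log_radius p Z))"
    unfolding cnj_mult_self of_real_power[symmetric] of_real_mult[symmetric] exp_log_radius_shift ..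
  then have "of_nat (p j) ^ k * (of_real (exp (- 2 * real (p j) * (log_radius p Z + ln r))) * (cnj (d j) * d j)) * (cnj (X $ j) * Y $ j) =
      of_nat (p j) ^ k * complex_of_real (exp (- 2 * real (p j) * log_radius p Z)) * (cnj (X $ j) * Y $ j)"
    by (simp only:)
  then show "of_nat (p j) ^ k * of_real (exp (- 2 * real (p j) * (log_radius p Z + ln r)))
        * (cnj (diag_act d X $ j) * diag_act d Y $ j) =
      of_nat (p j) ^ k * complex_of_real (exp (- 2 * real (p j) * log_radius p Z)) * (cnj (X $ j) * Y $ j)"
    by (simp only: diag_act_def vec_lambda_beta complex_cnj_mult mult_ac)
qed

lemma reeb_form_diag_act:
  "Z \<noteq> 0 \<Longrightarrow> reeb_form p k (diag_act d Z) (diag_act d X) (diag_act d Y) = reeb_form p k Z X Y"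
  by (simp add: reeb_form_def weighted_form_diag_act)

lemma horizontal_diag_act:
  "Z \<noteq> 0 \<Longrightarrow> horizontal p (diag_act d Z) (diag_act d X) = diag_act d (horizontal p Z X)"
  by (simp add: horizontal_def reeb_form_diag_act)
     (simp add: vec_eq_iff diag_act_def weight_mult_def algebra_simps)

end

text \<open>Used at zeros of a coordinate of the lift, where only a power of the difference quotient
  is accessible.\<close>

lemma has_derivative_directional_limit:
  fixes f :: "'a::real_normed_vector \<Rightarrow> complex"
  assumes "(f has_derivative f') (at x)" "f x = 0"
  shows "((\<lambda>s. f (x + s *\<^sub>R v) / of_real s) \<longlongrightarrow> f' v) (at 0)"
proof -
  have "((\<lambda>s. x + s *\<^sub>R v) has_derivative (\<lambda>s. s *\<^sub>R v)) (at (0::real))"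
    by (auto intro!: derivative_eq_intros)
  moreover have "(f has_derivative f') (at (x + 0 *\<^sub>R v))" using assms by simp
  ultimately have "((\<lambda>s. f (x + s *\<^sub>R v)) has_derivative (\<lambda>s. f' (s *\<^sub>R v))) (at 0)"
    by (rule has_derivative_compose)
  then have "((\<lambda>s. norm (f (x + s *\<^sub>R v) - s *\<^sub>R f' v) / norm s) \<longlongrightarrow> 0) (at 0)"
    using assms(2) linear_cmul[OF has_derivative_linear[OF assms(1)]]
    by (simp add: has_derivative_at)
  note lim = this
  have eq: "norm (f (x + s *\<^sub>R v) - s *\<^sub>R f' v) / norm s = norm (f (x + s *\<^sub>R v) / of_real s - f' v)" if "s \<noteq> 0" for s
  proof -
    have "f (x + s *\<^sub>R v) / of_real s - f' v = (f (x + s *\<^sub>R v) - s *\<^sub>R f' v) / of_real s"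
      using that by (simp add: field_simps scaleR_conv_of_real)
    then show ?thesis by (simp add: norm_divide)
  qed
  have "((\<lambda>s. norm (f (x + s *\<^sub>R v) / of_real s - f' v)) \<longlongrightarrow> 0) (at 0)"
    by (rule Lim_transform_eventually[OF lim])
       (unfold eventually_at_filter, intro always_eventually allI impI, rule eq)
  then show ?thesis
    by (simp only: tendsto_norm_zero_iff Lim_null[symmetric])
qed

text \<open>The scaling factor \<open>c\<close> relating the lifts of \<open>z\<close> and \<open>h z\<close> is only determined up to roots of unity and need not
  depend continuously on \<open>z\<close>; what is differentiated is the relation \<open>f\<^sub>k^p\<^sub>i = f\<^sub>i^p\<^sub>k G\<^sub>k^p\<^sub>i\<close> between the
  coordinates \<open>f\<close> and \<open>G\<close> of the two lifts, which does not involve \<open>c\<close>.  It determines the derivative of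
  \<open>f\<^sub>k\<close> only up to a unit factor where \<open>G\<^sub>k\<close> vanishes, but such factors act isometrically.\<close>

lemma frechet_derivative_transition:
  fixes p :: "'n::finite option \<Rightarrow> nat"
  assumes pos: "\<And>i. p i > 0"
    and tr: "orbifold_transition (\<lambda>_. UNIV) (wps_chart p) i j W h" and x: "x \<in> W"
  obtains d r \<mu> where "r > 0" "\<And>k. cmod (d k) = r ^ p k" "wps_lift j (h x) = diag_act d (wps_lift i x)"
    "\<And>v. wps_lin j (frechet_derivative h (at x) v) =
       diag_act d (wps_lin i v + \<mu> v *s weight_mult p (wps_lift i x))"
proof -
  have W: "open W" "\<And>z. z \<in> W \<Longrightarrow> wps_chart p j (h z) = wps_chart p i z" "holomorphic_map_on W h"
    using tr by (auto simp: orbifold_transition_def)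
  obtain D where D: "(h has_derivative D) (at x)" "\<And>c v. D (c *s v) = c *s D v"
    using W(3) x by (auto simp: holomorphic_map_on_def)
  have D_eq: "frechet_derivative h (at x) = D"
    using frechet_derivative_at[OF D(1)] by simp
  have D_add: "D (v + w) = D v + D w" for v w
    by (rule linear_add[OF has_derivative_linear[OF D(1)]])
  define f where "f k z = wps_lift j (h z) $ k" for k z
  define G where "G k z = wps_lift i z $ k" for k z
  define f' where "f' k v = wps_lin j (D v) $ k" for k v
  define G' where "G' k v = wps_lin i v $ k" for k v
  have df: "(f k has_derivative f' k) (at x)" for k
    unfolding f_def[abs_def] f'_def[abs_def]
    by (rule has_derivative_vec_nth[OF has_derivative_compose[OF D(1) has_derivative_wps_lift]])
  have dG: "(G k has_derivative G' k) (at x)" for k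
    unfolding G_def[abs_def] G'_def[abs_def]
    by (rule has_derivative_vec_nth[OF has_derivative_wps_lift])
  have ex: "\<exists>c. c \<noteq> 0 \<and> wps_lift j (h z) = wscale p c (wps_lift i z)" if "z \<in> W" for z
    using W(2)[OF that] wps_chart_eq_iff[of p i z j "h z"] by simp
  obtain c where c: "c \<noteq> 0" "wps_lift j (h x) = wscale p c (wps_lift i x)"
    using ex[OF x] by blast
  have fc: "f k x = c ^ p k * G k x" for k using c by (simp add: f_def G_def)
  have Gi: "G i z = 1" for z by (simp add: G_def)
  have rel: "f k z ^ p i = f i z ^ p k * G k z ^ p i" if z: "z \<in> W" for k z
  proof -
    obtain e where "e \<noteq> 0" "wps_lift j (h z) = wscale p e (wps_lift i z)" using ex[OF z] by blast
    then have "f k z = e ^ p k * G k z" for k by (simp add: f_def G_def)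
    then show ?thesis by (simp add: Gi power_mult_distrib flip: power_mult) (simp add: mult.commute)
  qed
  have fi: "f i x = c ^ p i" by (simp add: fc Gi)
  have fi0: "f i x \<noteq> 0" using c by (simp add: fi)
  \<comment> \<open>Formally \<open>f i\<close> is the power \<open>p i\<close> of the scaling
    factor, so this is the logarithmic derivative of that factor.\<close>
  define \<mu> where "\<mu> v = f' i v / (of_nat (p i) * f i x)" for v
  have key: "\<exists>\<epsilon>. cmod \<epsilon> = 1 \<and> (G k x \<noteq> 0 \<longrightarrow> \<epsilon> = 1) \<and>
      (\<forall>v. f' k v = \<epsilon> * c ^ p k * (G' k v + \<mu> v * (of_nat (p k) * G k x)))" for k
  proof (cases "G k x = 0")
    case False
    have fk: "f k x \<noteq> 0" using False c by (simp add: fc)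
    have d1: "((\<lambda>z. f k z ^ p i) has_derivative (\<lambda>v. of_nat (p i) * f' k v * f k x ^ (p i - 1))) (at x)"
      by (rule has_derivative_power[OF df])
    have "((\<lambda>z. f i z ^ p k * G k z ^ p i) has_derivative
        (\<lambda>v. f i x ^ p k * (of_nat (p i) * G' k v * G k x ^ (p i - 1)) + of_nat (p k) * f' i v * f i x ^ (p k - 1) * G k x ^ p i)) (at x)"
      by (rule has_derivative_mult[OF has_derivative_power[OF df] has_derivative_power[OF dG]])
    then have d2: "((\<lambda>z. f k z ^ p i) has_derivative
        (\<lambda>v. f i x ^ p k * (of_nat (p i) * G' k v * G k x ^ (p i - 1)) + of_nat (p k) * f' i v * f i x ^ (p k - 1) * G k x ^ p i)) (at x)"
      by (rule has_derivative_transform_within_open[OF _ W(1) x]) (simp add: rel)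
    have pw: "y ^ (p k - 1) = y ^ p k / y" if "y \<noteq> 0" for y :: complex and k
      using that pos[of k] by (simp add: power_diff)
    \<comment> \<open>Comparing \<open>d1\<close> with \<open>d2\<close> and dividing by the common
      value of both sides of \<open>rel\<close> leaves a relation between logarithmic
      derivatives.\<close>
    have "f' k v = 1 * c ^ p k * (G' k v + \<mu> v * (of_nat (p k) * G k x))" for v
    proof -
      have "of_nat (p i) * f' k v * (f k x ^ p i / f k x) =
          f i x ^ p k * (of_nat (p i) * G' k v * (G k x ^ p i / G k x)) + of_nat (p k) * f' i v * (f i x ^ p k / f i x) * G k x ^ p i"
        using fun_cong[OF has_derivative_unique[OF d1 d2], of v] by (simp only: pw fk False fi0 not_False_eq_True)
      then have "of_nat (p i) * f' k v * ((f i x ^ p k * G k x ^ p i) / f k x) =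
          (f i x ^ p k * G k x ^ p i) * (of_nat (p i) * G' k v / G k x + of_nat (p k) * f' i v / f i x)"
        unfolding rel[OF x] by (simp add: algebra_simps add_divide_distrib)
      moreover have "f i x ^ p k * G k x ^ p i \<noteq> 0" using fi0 False by simp
      ultimately have "of_nat (p i) * f' k v / f k x = of_nat (p i) * G' k v / G k x + of_nat (p k) * f' i v / f i x"
        by (metis (no_types, lifting) mult_left_cancel times_divide_eq_right mult.commute)
      then show ?thesis
        using fk fi0 False pos[of i] c(1) unfolding \<mu>_def fc[of k] by (simp add: field_simps)
    qed
    then show ?thesis by (intro exI[of _ 1]) auto
  next
    case True
    then have "k \<noteq> i" using Gi[of x] by auto
    then obtain l where l: "k = Transposition.transpose None i (Some l)"
      by (cases rule: wps_index_cases[of k i]) auto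
    have G'l: "G' k v = v $ l" for v by (simp add: G'_def l)
    have Gl: "G k z = z $ l" for z by (simp add: G_def l)
    have xl: "x $ l = 0" using True by (simp add: Gl)
    have fk0: "f k x = 0" using True by (simp add: fc)
    \<comment> \<open>Along \<open>x + s v\<close>, \<open>rel\<close> is divided by
      \<open>s ^ p i\<close> before passing to the limit. This gives \<open>f' k v ^ p i\<close>,
      which determines the modulus of \<open>f' k v\<close>.\<close>
    have nf: "cmod (f' k v) = cmod (c ^ p k) * cmod (v $ l)" for v
    proof -
      have lin: "((\<lambda>s. x + s *\<^sub>R v) \<longlongrightarrow> x) (at (0::real))"
        by (auto intro!: tendsto_eq_intros)
      then have evW: "\<forall>\<^sub>F s in at (0::real). x + s *\<^sub>R v \<in> W"
        by (rule topological_tendstoD[OF _ W(1) x])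
      have ev0: "\<forall>\<^sub>F s in at (0::real). s \<noteq> 0"
        by (simp add: eventually_at_filter)
      have "((\<lambda>s. (f k (x + s *\<^sub>R v) / of_real s) ^ p i) \<longlongrightarrow> f' k v ^ p i) (at 0)"
        by (intro tendsto_power has_derivative_directional_limit df fk0)
      moreover have "\<forall>\<^sub>F s in at (0::real). (f k (x + s *\<^sub>R v) / of_real s) ^ p i = f i (x + s *\<^sub>R v) ^ p k * (v $ l) ^ p i"
        using evW ev0
      proof eventually_elim
        case (elim s)
        have "G k (x + s *\<^sub>R v) = of_real s * v $ l"
          by (simp add: Gl xl scaleR_eq_vector_scale)
        then show ?case
          using rel[OF elim(1), of k] elim(2) by (simp add: power_divide power_mult_distrib)
      qed
      ultimately have "((\<lambda>s. f i (x + s *\<^sub>R v) ^ p k * (v $ l) ^ p i) \<longlongrightarrow> f' k v ^ p i) (at 0)"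
        by (rule Lim_transform_eventually)
      moreover have "((\<lambda>s. f i (x + s *\<^sub>R v) ^ p k * (v $ l) ^ p i) \<longlongrightarrow> f i x ^ p k * (v $ l) ^ p i) (at 0)"
        by (intro tendsto_intros isCont_tendsto_compose[OF has_derivative_continuous[OF df] lin])
      ultimately have "f' k v ^ p i = f i x ^ p k * (v $ l) ^ p i"
        using tendsto_unique[OF at_neq_bot] by blast
      then have "cmod (f' k v) ^ p i = (cmod (c ^ p k) * cmod (v $ l)) ^ p i"
        by (simp add: fi norm_power[symmetric] norm_mult power_mult_distrib flip: power_mult) (simp add: norm_mult norm_power mult.commute)
      then show ?thesis using pos[of i] by (simp add: power_eq_iff_eq_base)
    qed
    define \<epsilon> where "\<epsilon> = f' k (axis l 1) / c ^ p k"
    have "cmod \<epsilon> = 1" using c nf[of "axis l 1"] by (simp add: \<epsilon>_def norm_divide)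
    moreover have "f' k v = \<epsilon> * c ^ p k * (G' k v + \<mu> v * (of_nat (p k) * G k x))" for v
    proof -
      \<comment> \<open>By \<open>nf\<close> the complex-linear map \<open>f' k\<close> vanishes
        where coordinate \<open>l\<close> does, hence is a multiple of that coordinate.\<close>
      have "v = (v - v $ l *s axis l 1) + v $ l *s axis l 1" by simp
      then have "f' k v = f' k (v - v $ l *s axis l 1) + v $ l * f' k (axis l 1)"
        by (metis (no_types, lifting) D_add D(2) f'_def vector_add_component vector_smult_component wps_lin_add wps_lin_scale)
      moreover have "f' k (v - v $ l *s axis l 1) = 0"
        using nf[of "v - v $ l *s axis l 1"] by simp
      ultimately show ?thesis using c(1) by (simp add: \<epsilon>_def G'l True)
    qed
    ultimately show ?thesis using True by blast
  qed
  then obtain \<epsilon> where \<epsilon>: "\<And>k. cmod (\<epsilon> k) = 1" "\<And>k. G k x \<noteq> 0 \<Longrightarrow> \<epsilon> k = 1"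
    "\<And>k v. f' k v = \<epsilon> k * c ^ p k * (G' k v + \<mu> v * (of_nat (p k) * G k x))"
    by metis
  show thesis
  proof (rule that[of "cmod c" "\<lambda>k. \<epsilon> k * c ^ p k" \<mu>])
    show "cmod c > 0" using c by simp
    show "cmod (\<epsilon> k * c ^ p k) = cmod c ^ p k" for k by (simp add: norm_mult norm_power \<epsilon>(1))
    \<comment> \<open>A nontrivial unit factor occurs only at coordinates where the lift vanishes,
      so it leaves the lift unchanged.\<close>
    have "c ^ p k * G k x = \<epsilon> k * c ^ p k * G k x" for k using \<epsilon>(2)[of k] by (cases "G k x = 0") auto
    then show "wps_lift j (h x) = diag_act (\<lambda>k. \<epsilon> k * c ^ p k) (wps_lift i x)"
      unfolding c(2) by (simp add: vec_eq_iff diag_act_def G_def)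
    show "wps_lin j (frechet_derivative h (at x) v) =
       diag_act (\<lambda>k. \<epsilon> k * c ^ p k) (wps_lin i v + \<mu> v *s weight_mult p (wps_lift i x))" for v
      using \<epsilon>(3)[of _ v] unfolding D_eq f'_def G'_def G_def
      by (simp add: vec_eq_iff diag_act_def weight_mult_def)
  qed
qed

text \<open>On lifts a transition is a \<open>diag_act\<close>, under which the forms are invariant;
  its derivative has an extra multiple of \<open>P Z\<close>, which the horizontal projection
  removes.\<close>

lemma chart_h_transition:
  fixes p :: "'n::finite option \<Rightarrow> nat"
  assumes pos: "\<And>i. p i > 0"
    and tr: "orbifold_transition (\<lambda>_. UNIV) (wps_chart p) i j W h" and x: "x \<in> W"
  shows "chart_h p j (h x) (frechet_derivative h (at x) v) (frechet_derivative h (at x) w) = chart_h p i x v w"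
proof (rule frechet_derivative_transition[OF pos tr x])
  fix d :: "'n option \<Rightarrow> complex" and r \<mu>
  assume d: "r > 0" "\<And>k. cmod (d k) = r ^ p k" "wps_lift j (h x) = diag_act d (wps_lift i x)"
    "\<And>v. wps_lin j (frechet_derivative h (at x) v) =
       diag_act d (wps_lin i v + \<mu> v *s weight_mult p (wps_lift i x))"
  show ?thesis
    unfolding chart_h_horizontal d(3,4)
    by (simp only: horizontal_diag_act[OF pos d(1,2) wps_lift_nonzero] reeb_form_diag_act[OF pos d(1,2) wps_lift_nonzero]
        horizontal_add_weight_mult[OF pos wps_lift_nonzero])
qed

theorem theorem11:
  fixes p :: "'n::finite option \<Rightarrow> nat"
  assumes "\<And>i. p i > 0" and "Gcd (range p) = 1"
  shows "\<exists>g. bochner_kaehler_orbifold_metric (wps p) (\<lambda>_. UNIV) (wps_group p) (wps_chart p) g"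
proof (intro exI[of _ "chart_g p"])
  show "bochner_kaehler_orbifold_metric (wps p) (\<lambda>_. UNIV) (wps_group p) (wps_chart p) (chart_g p)"
    unfolding bochner_kaehler_orbifold_metric_def
  proof (intro conjI allI impI ballI)
    show "complex_orbifold (wps p) (\<lambda>_. UNIV) (wps_group p) (wps_chart p)"
      by (rule complex_orbifold_wps[OF assms(1)])
    show "bochner_kaehler_on UNIV (chart_g p i)" for i
      by (rule bochner_kaehler_chart[OF assms(1)])
    show "chart_g p j (h x) (frechet_derivative h (at x) v) (frechet_derivative h (at x) w) = chart_g p i x v w"
      if "orbifold_transition (\<lambda>_. UNIV) (wps_chart p) i j W h" "x \<in> W" for i j W h x v w
      unfolding chart_g_def chart_h_transition[OF assms(1) that] ..
  qed
qed

end
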